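(* Let $\gamma^{current}=\bigcup_{i=0}^{N}\mathrm{SP}(a_i,a_{i+1})$ be a path formed by a set of shooting points $\{a_i\}_{i=1}^N$ (with $a_i\in\xi_i=[u_i,v_i]$, $a_0=\tilde b$, $a_{N+1}=b$), which joins $\tilde b$ and $b$ in $\mathcal D$. If the Collinear Condition (B) holds at all shooting points $a_1,\dots,a_N$, then $\gamma^{current}=\gamma^*$, where $\gamma^*=\mathrm{SP}(\tilde b,b)$ is the shortest path joining $\tilde b$ and $b$ in $\mathcal D$.
   Context: Notation: for points $x,y$ in the plane, $[x,y]=\{(1-\lambda)x+\lambda y:0\le\lambda\le1\}$, $]x,y]=[x,y]\setminus\{x\}$, $[x,y[=[x,y]\setminus\{y\}$, $]x,y[=[x,y]\setminus\{x,y\}$. The polygon $\mathcal D$: let $\mathcal P$ be a simple polygon in the plane and $b$ a vertex of $\mathcal P$ visible from infinity, i.e. there is a ray starting at $b$ that does not meet $\mathcal P$ anywhere else. Let $R$ be a rectangle containing $\mathcal P$ and having no edge touching $\mathcal P$, and let $c$ be the unique point where the ray from $b$ meets the boundary of $R$. Cut the region $R\setminus\mathrm{int}\,\mathcal P$ open along $[b,c]$: insert $[b,c]$ and a copy $[\tilde b,\tilde c]$ of it (the two sides of the slit) into the boundary. The resulting simple polygon $\mathcal D$ (paths in $\mathcal D$ may not cross the slit) has boundary $B_1\cup B_2$, where $B_1$ is the polyline starting at $\tilde b$, going to $\tilde c$, then along the boundary of $R$ all the way around to $c$, and then to $b$; and $B_2$ is the polyline starting at $b$, going along the boundary of $\mathcal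 P$ in clockwise order and returning to $\tilde b$. Partition: $\mathcal D$ is split into sub-polygons $\mathcal D_0,\dots,\mathcal D_N$ ($N\ge1$) by cutting segments $\xi_i=[u_i,v_i]\subset\mathcal D$, $1\le i\le N$, with $]u_i,v_i[\subset\mathrm{int}\,\mathcal D$, $u_i\in B_1$, $v_i\in B_2$; each $\xi_i$ strictly separates $\tilde b$ and $b$ in $\mathcal D$; $\xi_i\cap\xi_j=\emptyset$ for $i\ne j$, $1\le i,j\le N$; $\xi_0=\{\tilde b\}$, $\xi_{N+1}=\{b\}$; $\mathcal D_i$ is bounded by $B_1$, $B_2$, $\xi_i$ and $\xi_{i+1}$; $\mathrm{int}\,\mathcal D_i\cap\mathrm{int}\,\mathcal D_j=\emptyset$ for $i\neq j$, and $\mathcal D=\bigcup_{i=0}^N\mathcal D_i$. Shortest paths and shooting points: $\mathrm{SP}(x,y)$ is the path of minimal length joining $x$ and $y$ in the connected union of sub-polygons containing $x$ and $y$ (equivalently in $\mathcal D$). Points $a_i\in\xi_i$ ($1\le i\le N$), with $a_0=\tilde b$, $a_{N+1}=b$, are called shooting points, and $\bigcup_{i=0}^N\mathrm{SP}(a_i,a_{i+1})$ is the path formed by them. Upper angle: $\angle(\mathrm{SP}(a_{i-1},a_i),\mathrm{SP}(a_i,a_{i+1}))$ denotes the angle at $a_i$ of the polyline $\mathrm{SP}(a_{i-1},a_i)\cup\mathrm{SP}(a_i,a_{i+1})$ on the side containing the ray $a_iu_i$. Collinear Condition (B) at $a_i$ ($1\le i\le N$): either $a_i\in\,]u_i,v_i[$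 and $\angle(\mathrm{SP}(a_{i-1},a_i),\mathrm{SP}(a_i,a_{i+1}))=\pi$; or $a_i=v_i$ and $\angle(\mathrm{SP}(a_{i-1},a_i),\mathrm{SP}(a_i,a_{i+1}))\ge\pi$. (The condition does not include the case $a_i=u_i$; it is not satisfied there.) *)

theory Defs
  imports "HOL-Analysis.Analysis"
begin

text \<open>The plane is \<^typ>\<open>complex\<close>.\<close>

subsection \<open>Polygon, rectangle and slit\<close>

fun polyline :: "complex list \<Rightarrow> real \<Rightarrow> complex" where
  "polyline [] = linepath 0 0"
| "polyline [x] = linepath x x"
| "polyline [x, y] = linepath x y"
| "polyline (x # y # z # zs) = linepath x y +++ polyline (y # z # zs)"

definition boundary_loop :: "complex list \<Rightarrow> real \<Rightarrow> complex" where
  "boundary_loop ps = polyline (ps @ [hd ps])"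

definition poly_boundary :: "complex list \<Rightarrow> complex set" where
  "poly_boundary ps = path_image (boundary_loop ps)"

definition poly_region :: "complex list \<Rightarrow> complex set" where
  "poly_region ps = poly_boundary ps \<union> inside (poly_boundary ps)"

definition simple_polygon :: "complex list \<Rightarrow> bool" where
  "simple_polygon ps \<longleftrightarrow> 3 \<le> length ps \<and> simple_path (boundary_loop ps)"

definition is_rectangle :: "complex set \<Rightarrow> bool" where
  "is_rectangle R \<longleftrightarrow>
     (\<exists>p e f. e \<noteq> 0 \<and> f \<noteq> 0 \<and> e \<bullet> f = 0 \<and>
        R = {p + s *\<^sub>R e + t *\<^sub>R f | s t. s \<in> {0..1} \<and> t \<in> {0..1}})"

definition ray :: "complex \<Rightarrow> complex \<Rightarrow> complex set" where
  "ray p d = {p + t *\<^sub>R d | t. 0 \<le> t}"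

text \<open>
  The vertex list of the polygon starts at the vertex \<open>b\<close> that is visible from infinity, so
  \<open>b = hd ps\<close>.
\<close>

definition slit_data :: "complex list \<Rightarrow> complex set \<Rightarrow> complex \<Rightarrow> bool" where
  "slit_data ps R c \<longleftrightarrow>
     simple_polygon ps \<and> is_rectangle R \<and>
     poly_region ps \<subseteq> R \<and> poly_region ps \<inter> frontier R = {} \<and>
     (\<exists>d. d \<noteq> 0 \<and> ray (hd ps) d \<inter> poly_region ps = {hd ps} \<and>
          ray (hd ps) d \<inter> frontier R = {c})"

definition slit :: "complex list \<Rightarrow> complex \<Rightarrow> complex set" where
  "slit ps c = closed_segment (hd ps) c"


subsection \<open>The cut-open domain\<close>

text \<open>
  A point of the domain is a planar point together with a flag. Over the slit both flags occur
  and give the two copies of it: \<^term>\<open>True\<close> is the copy running from \<open>b\<close> tilde to \<open>c\<close> tilde,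
  \<^term>\<open>False\<close> the copy \<open>[b, c]\<close>. Off the slit the flag is determined by the planar point and
  carries no information, except that close to the slit it tells on which side of the slit the
  point lies.

  Seen from \<open>b\<close>, turning counterclockwise from the direction of the slit, one first sweeps
  the complement of the polygon, then, between the two polygon edges at \<open>b\<close>, the
  polygon, and then again its complement. So close to the slit, and also at its end point \<open>b\<close>, the
  points on the counterclockwise side are those up to the first of the two edges. The boundary
  of the polygon traversed clockwise from \<open>b\<close> leaves on the clockwise side of the slit
  and returns on the counterclockwise side; hence the latter side is that of \<open>b\<close> tilde.
\<close>

type_synonym dpoint = "complex \<times> bool"

definition turn :: "complex list \<Rightarrow> complex \<Rightarrow> complex \<Rightarrow> real" where
  "turn ps c z = Arg2pi ((z - hd ps) / (c - hd ps))"

definition tilde_side :: "complex list \<Rightarrow> complex \<Rightarrow> complex \<Rightarrow> bool" where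
  "tilde_side ps c z \<longleftrightarrow> turn ps c z \<le> min (turn ps c (ps ! 1)) (turn ps c (last ps))"

definition cut_domain :: "complex list \<Rightarrow> complex set \<Rightarrow> complex \<Rightarrow> dpoint set" where
  "cut_domain ps R c =
     {(z, s). z \<in> R - inside (poly_boundary ps) \<and> (z \<notin> slit ps c \<longrightarrow> s = tilde_side ps c z)}"

definition b_tilde :: "complex list \<Rightarrow> dpoint" where
  "b_tilde ps = (hd ps, True)"

definition b_pt :: "complex list \<Rightarrow> dpoint" where
  "b_pt ps = (hd ps, False)"

text \<open>
  The topology: a neighbourhood of a point on one side of the slit contains no points of, or close
  to, the other side. Paths in this topology are the paths that do not cross the slit.
\<close>

definition cut_open :: "complex list \<Rightarrow> complex set \<Rightarrow> complex \<Rightarrow> dpoint set \<Rightarrow> bool" where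
  "cut_open ps R c V \<longleftrightarrow>
     V \<subseteq> cut_domain ps R c \<and>
     (\<forall>x\<in>V. \<exists>r>0. \<forall>y\<in>cut_domain ps R c.
        dist (fst y) (fst x) < r \<and> (fst x \<in> slit ps c \<longrightarrow> snd y = snd x) \<longrightarrow> y \<in> V)"

definition cut_top :: "complex list \<Rightarrow> complex set \<Rightarrow> complex \<Rightarrow> dpoint topology" where
  "cut_top ps R c = topology (cut_open ps R c)"

lemma istopology_cut_open: "istopology (cut_open ps R c)"
  unfolding istopology_def
proof (intro conjI allI impI)
  fix S T assume S: "cut_open ps R c S" and T: "cut_open ps R c T"
  show "cut_open ps R c (S \<inter> T)"
    unfolding cut_open_def
  proof (intro conjI ballI)
    show "S \<inter> T \<subseteq> cut_domain ps R c" using S by (auto simp: cut_open_def)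
    fix x assume x: "x \<in> S \<inter> T"
    obtain r where r: "r > 0" "\<forall>y\<in>cut_domain ps R c.
        dist (fst y) (fst x) < r \<and> (fst x \<in> slit ps c \<longrightarrow> snd y = snd x) \<longrightarrow> y \<in> S"
      using S x unfolding cut_open_def by blast
    obtain q where q: "q > 0" "\<forall>y\<in>cut_domain ps R c.
        dist (fst y) (fst x) < q \<and> (fst x \<in> slit ps c \<longrightarrow> snd y = snd x) \<longrightarrow> y \<in> T"
      using T x unfolding cut_open_def by blast
    show "\<exists>r>0. \<forall>y\<in>cut_domain ps R c.
        dist (fst y) (fst x) < r \<and> (fst x \<in> slit ps c \<longrightarrow> snd y = snd x) \<longrightarrow> y \<in> S \<inter> T"
      using r q by (intro exI[of _ "min r q"]) auto
  qed
next
  fix K assume K: "\<forall>S\<in>K. cut_open ps R c S"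
  show "cut_open ps R c (\<Union>K)"
    unfolding cut_open_def
  proof (intro conjI ballI)
    show "\<Union>K \<subseteq> cut_domain ps R c" using K by (auto simp: cut_open_def)
    fix x assume "x \<in> \<Union>K"
    then obtain S where S: "S \<in> K" "x \<in> S" by blast
    then obtain r where "r > 0" "\<forall>y\<in>cut_domain ps R c.
        dist (fst y) (fst x) < r \<and> (fst x \<in> slit ps c \<longrightarrow> snd y = snd x) \<longrightarrow> y \<in> S"
      using K unfolding cut_open_def by blast
    then show "\<exists>r>0. \<forall>y\<in>cut_domain ps R c.
        dist (fst y) (fst x) < r \<and> (fst x \<in> slit ps c \<longrightarrow> snd y = snd x) \<longrightarrow> y \<in> \<Union>K"
      using S by (intro exI[of _ r]) blast
  qed
qed

lemma openin_cut_top: "openin (cut_top ps R c) = cut_open ps R c"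
  by (simp add: cut_top_def istopology_cut_open)

lemma topspace_cut_top: "topspace (cut_top ps R c) = cut_domain ps R c"
proof -
  have "cut_open ps R c (cut_domain ps R c)"
    unfolding cut_open_def by (auto intro: exI[of _ 1])
  moreover have "\<And>V. cut_open ps R c V \<Longrightarrow> V \<subseteq> cut_domain ps R c"
    by (simp add: cut_open_def)
  ultimately show ?thesis
    unfolding topspace_def openin_cut_top by blast
qed

definition B1 :: "complex list \<Rightarrow> complex set \<Rightarrow> complex \<Rightarrow> dpoint set" where
  "B1 ps R c = {x \<in> cut_domain ps R c. fst x \<in> slit ps c \<union> frontier R}"

definition B2 :: "complex list \<Rightarrow> complex set \<Rightarrow> complex \<Rightarrow> dpoint set" where
  "B2 ps R c = {x \<in> cut_domain ps R c. fst x \<in> poly_boundary ps}"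

text \<open>
  The interior of a subset as a polygon. In \<^const>\<open>cut_top\<close> points of the boundary of the whole
  domain can be interior points, so they have to be removed.
\<close>

definition poly_interior ::
    "complex list \<Rightarrow> complex set \<Rightarrow> complex \<Rightarrow> dpoint set \<Rightarrow> dpoint set" where
  "poly_interior ps R c A = cut_top ps R c interior_of A - (B1 ps R c \<union> B2 ps R c)"


subsection \<open>Paths and shortest paths\<close>

definition joins ::
    "complex list \<Rightarrow> complex set \<Rightarrow> complex \<Rightarrow> (real \<Rightarrow> dpoint) \<Rightarrow> dpoint \<Rightarrow> dpoint \<Rightarrow> bool" where
  "joins ps R c g x y \<longleftrightarrow> pathin (cut_top ps R c) g \<and> g 0 = x \<and> g 1 = y"

definition curve_length :: "(real \<Rightarrow> complex) \<Rightarrow> ennreal" where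
  "curve_length p =
     (SUP ts \<in> {ts. sorted ts \<and> set ts \<subseteq> {0..1}}.
        \<Sum>i<length ts - 1. ennreal (dist (p (ts ! i)) (p (ts ! Suc i))))"

definition path_length :: "(real \<Rightarrow> dpoint) \<Rightarrow> ennreal" where
  "path_length g = curve_length (fst \<circ> g)"

definition shortest_path ::
    "complex list \<Rightarrow> complex set \<Rightarrow> complex \<Rightarrow> (real \<Rightarrow> dpoint) \<Rightarrow> dpoint \<Rightarrow> dpoint \<Rightarrow> bool" where
  "shortest_path ps R c g x y \<longleftrightarrow>
     joins ps R c g x y \<and> (\<forall>h. joins ps R c h x y \<longrightarrow> path_length g \<le> path_length h)"

text \<open>
  Shortest paths are compared as point sets; a parametrization is not part of the notion.
\<close>

definition is_SP ::
    "complex list \<Rightarrow> complex set \<Rightarrow> complex \<Rightarrow> dpoint \<Rightarrow> dpoint \<Rightarrow> dpoint set \<Rightarrow> bool" where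
  "is_SP ps R c x y X \<longleftrightarrow> (\<exists>g. shortest_path ps R c g x y \<and> X = g ` {0..1})"


subsection \<open>The partition by cutting segments\<close>

definition is_segment ::
    "complex list \<Rightarrow> complex set \<Rightarrow> complex \<Rightarrow> dpoint \<Rightarrow> dpoint \<Rightarrow> dpoint set \<Rightarrow> bool" where
  "is_segment ps R c x y X \<longleftrightarrow>
     (\<exists>g. joins ps R c g x y \<and> (\<forall>t\<in>{0..1}. fst (g t) = linepath (fst x) (fst y) t) \<and>
          X = g ` {0..1})"

definition strictly_separates ::
    "complex list \<Rightarrow> complex set \<Rightarrow> complex \<Rightarrow> dpoint set \<Rightarrow> dpoint \<Rightarrow> dpoint \<Rightarrow> bool" where
  "strictly_separates ps R c X x y \<longleftrightarrow>
     x \<notin> X \<and> y \<notin> X \<and> (\<forall>g. joins ps R c g x y \<longrightarrow> g ` {0..1} \<inter> X \<noteq> {})"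

definition cutting_segment ::
    "complex list \<Rightarrow> complex set \<Rightarrow> complex \<Rightarrow> dpoint \<Rightarrow> dpoint \<Rightarrow> dpoint set \<Rightarrow> bool" where
  "cutting_segment ps R c u v X \<longleftrightarrow>
     u \<in> B1 ps R c \<and> v \<in> B2 ps R c \<and> is_segment ps R c u v X \<and>
     X - {u, v} \<subseteq> poly_interior ps R c (cut_domain ps R c) \<and>
     strictly_separates ps R c X (b_tilde ps) (b_pt ps)"

text \<open>
  A sub-polygon is the closure of its connected interior; what is left when the interior
  is removed is its boundary.
\<close>

definition is_subpolygon ::
    "complex list \<Rightarrow> complex set \<Rightarrow> complex \<Rightarrow> dpoint set \<Rightarrow> bool" where
  "is_subpolygon ps R c A \<longleftrightarrow>
     cut_top ps R c closure_of (poly_interior ps R c A) = A \<and>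
     connectedin (cut_top ps R c) (poly_interior ps R c A)"

definition cut_partition ::
    "complex list \<Rightarrow> complex set \<Rightarrow> complex \<Rightarrow> nat \<Rightarrow> (nat \<Rightarrow> dpoint) \<Rightarrow> (nat \<Rightarrow> dpoint) \<Rightarrow>
     (nat \<Rightarrow> dpoint set) \<Rightarrow> (nat \<Rightarrow> dpoint set) \<Rightarrow> bool" where
  "cut_partition ps R c N u v \<xi> D \<longleftrightarrow>
     N \<ge> 1 \<and>
     \<xi> 0 = {b_tilde ps} \<and> \<xi> (N + 1) = {b_pt ps} \<and>
     (\<forall>i\<in>{1..N}. cutting_segment ps R c (u i) (v i) (\<xi> i)) \<and>
     (\<forall>i\<in>{1..N}. \<forall>j\<in>{1..N}. i \<noteq> j \<longrightarrow> \<xi> i \<inter> \<xi> j = {}) \<and>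
     (\<forall>i\<le>N. is_subpolygon ps R c (D i) \<and>
        \<xi> i \<union> \<xi> (i + 1) \<subseteq> D i - poly_interior ps R c (D i) \<and>
        D i - poly_interior ps R c (D i) \<subseteq> B1 ps R c \<union> B2 ps R c \<union> \<xi> i \<union> \<xi> (i + 1)) \<and>
     (\<forall>i\<le>N. \<forall>j\<le>N. i \<noteq> j \<longrightarrow> poly_interior ps R c (D i) \<inter> poly_interior ps R c (D j) = {}) \<and>
     cut_domain ps R c = (\<Union>i\<le>N. D i)"


subsection \<open>Upper angles and the collinear condition\<close>

text \<open>
  \<open>leaves_along X p w\<close>: the polyline \<open>X\<close>, one of whose end points is \<open>p\<close>, starts at \<open>p\<close> with a
  straight piece in the unit direction \<open>w\<close>. It is only used for \<open>p\<close> off the slit, where planar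
  balls are neighbourhoods: apart from \<open>u\<close>, no point of a cutting segment lies on the slit.
\<close>

definition leaves_along :: "dpoint set \<Rightarrow> dpoint \<Rightarrow> complex \<Rightarrow> bool" where
  "leaves_along X p w \<longleftrightarrow> norm w = 1 \<and>
     (\<exists>r>0. fst ` X \<inter> ball (fst p) r = {fst p + t *\<^sub>R w | t. 0 \<le> t \<and> t < r})"

text \<open>
  Measuring arguments from the direction \<open>e\<close> of the ray from \<open>p\<close> through \<open>u\<close>, the directions
  \<open>w1\<close>, \<open>w2\<close> bound one sector of size \<open>\<bar>Arg2pi (w1 / e) - Arg2pi (w2 / e)\<bar>\<close> that avoids \<open>e\<close>; the
  upper angle is the size of the complementary sector, the one containing \<open>e\<close>.
\<close>

definition upper_angle :: "complex \<Rightarrow> complex \<Rightarrow> complex \<Rightarrow> real" where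
  "upper_angle e w1 w2 = 2 * pi - \<bar>Arg2pi (w1 / e) - Arg2pi (w2 / e)\<bar>"

definition has_upper_angle ::
    "dpoint \<Rightarrow> dpoint set \<Rightarrow> dpoint set \<Rightarrow> dpoint \<Rightarrow> real \<Rightarrow> bool" where
  "has_upper_angle u X Y p \<theta> \<longleftrightarrow>
     (\<exists>w1 w2. leaves_along X p w1 \<and> leaves_along Y p w2 \<and>
        \<theta> = upper_angle (fst u - fst p) w1 w2)"

definition collinear_condition_B ::
    "dpoint \<Rightarrow> dpoint \<Rightarrow> dpoint set \<Rightarrow> dpoint set \<Rightarrow> dpoint set \<Rightarrow> dpoint \<Rightarrow> bool" where
  "collinear_condition_B u v \<xi> X Y p \<longleftrightarrow>
     (p \<in> \<xi> - {u, v} \<and> has_upper_angle u X Y p pi) \<or>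
     (p = v \<and> (\<exists>\<theta>\<ge>pi. has_upper_angle u X Y p \<theta>))"

end

theory Submission
  imports Defs "HOL-Complex_Analysis.Complex_Analysis"
begin

text \<open>
  The proof replaces length by a local property of paths. A path in the slit domain is called taut if it
  is locally injective, runs straight at unit speed before and after every interior time, and at such a
  time either does not change its direction or turns around the polygon: some direction strictly between
  the two leaving directions points into the inside of the polygon. The last condition is not imposed at
  the planar point \<open>b\<close>. Cutting off a corner that the polygon does not obstruct shortens a
  path, so shortest paths are taut (\<open>unobstructed_corner\<close>, \<open>geodesic_taut\<close>).

  Tautness determines a path up to its parametrization: two taut paths from \<open>b\<close> tilde to
  \<open>b\<close> have the same image (\<open>taut_image_subset\<close>). If not, some piece of one
  path leaves the other and meets it again, and together with the piece of the other path it forms a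
  loop in the slit domain. Take an extreme point of the convex hull of this loop that is different from
  the two meeting points; if there is none, both pieces run along one segment and coincide. The path
  that passes it has a proper corner there, so inside points of the polygon lie in the angle of this
  corner. On one hand, the loop has nonzero winding number about such points, because an extreme corner
  that is passed only once contributes one turn (\<open>corner_winding\<close>). On the other hand the
  slit prevents loops from winding around the polygon: for a point \<open>w\<close> inside, \<open>z -
  w\<close> has a continuous logarithm on the slit domain (\<open>continuous_log\<close>,
  \<open>loop_winding_zero\<close>). The same argument, applied to a shortest loop of a single path,
  shows that taut paths are injective (\<open>taut_inj\<close>).

  It remains to see that the path through the shooting points is taut at a shooting point \<open>a
  i\<close>. If the upper angle is \<open>pi\<close>, the path is straight there. Otherwise \<open>a i =
  v i\<close> and the smaller angle lies on the side away from \<open>\<xi> i\<close>. If the polygon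
  did not obstruct this corner, a short segment across it would lead from one piece to the other without
  touching \<open>\<xi> i\<close>. The two pieces themselves meet \<open>\<xi> i\<close> only in
  \<open>a i\<close> (\<open>geodesic_meets_cut_only_at_polygon\<close>), so \<open>a (i - 1)\<close>
  and \<open>a (i + 1)\<close> would be joined off \<open>\<xi> i\<close>. This is impossible since the
  sub-polygons before and after \<open>\<xi> i\<close> are chained together and connect these points to
  \<open>b\<close> tilde and \<open>b\<close> (\<open>partition_separates\<close>,
  \<open>taut_joint\<close>).

  So the path through the shooting points has the image of any shortest path from \<open>b\<close> tilde
  to \<open>b\<close>. A shortest path exists because the domain with its length metric is compact and
  has approximate intermediate points (\<open>metric_geodesic_exists\<close>), which gives the other
  half of the equivalence.
\<close>

section \<open>Sets that are conical near a point\<close>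

text \<open>
  Near \<open>z\<close>, membership in \<open>S\<close> depends only on the direction from
  \<open>z\<close>. Finite unions of segments have this property at every point, and so does the inside
  of a polygon.
\<close>

definition radial_at :: "complex set \<Rightarrow> complex \<Rightarrow> bool" where
  "radial_at S z \<longleftrightarrow> (\<exists>r>0. \<forall>w \<tau>. dist w z < r \<longrightarrow> 0 < \<tau> \<longrightarrow> \<tau> \<le> 1 \<longrightarrow>
     (z + \<tau> *\<^sub>R (w - z) \<in> S \<longleftrightarrow> w \<in> S))"

lemma dist_radial: "dist (z + \<tau> *\<^sub>R (w - z)) z = \<bar>\<tau>\<bar> * dist w (z::complex)"
  by (simp add: dist_norm)

lemma radial_at_Un:
  assumes "radial_at S z" "radial_at T z" shows "radial_at (S \<union> T) z"
proof -
  obtain r q where "r > 0" "\<forall>w \<tau>. dist w z < r \<longrightarrow> 0 < \<tau> \<longrightarrow> \<tau> \<le> 1 \<longrightarrow>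
     (z + \<tau> *\<^sub>R (w - z) \<in> S \<longleftrightarrow> w \<in> S)" "q > 0" "\<forall>w \<tau>. dist w z < q \<longrightarrow> 0 < \<tau> \<longrightarrow> \<tau> \<le> 1 \<longrightarrow>
     (z + \<tau> *\<^sub>R (w - z) \<in> T \<longleftrightarrow> w \<in> T)"
    using assms unfolding radial_at_def by blast
  then show ?thesis unfolding radial_at_def by (intro exI[of _ "min r q"]) auto
qed

lemma radial_at_closed_segment: "radial_at (closed_segment a b) z"
proof (cases "z \<in> closed_segment a b")
  case False
  then obtain r where r: "r > 0" "ball z r \<inter> closed_segment a b = {}"
    by (metis Compl_iff closed_segment disjoint_eq_subset_Compl open_Compl open_contains_ball)
  show ?thesis unfolding radial_at_def
  proof (intro exI[of _ r] conjI allI impI)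
    fix w \<tau> assume w: "dist w z < r" "0 < (\<tau>::real)" "\<tau> \<le> 1"
    have "\<tau> * dist w z \<le> 1 * dist w z" using w by (intro mult_right_mono) auto
    then have "z + \<tau> *\<^sub>R (w - z) \<in> ball z r" "w \<in> ball z r"
      using w dist_radial[of z \<tau> w] by (auto simp: dist_commute)
    then show "z + \<tau> *\<^sub>R (w - z) \<in> closed_segment a b \<longleftrightarrow> w \<in> closed_segment a b" using r by blast
  qed (rule r)
next
  case True
  then obtain m where m: "0 \<le> m" "m \<le> 1" "z = a + m *\<^sub>R (b - a)"
    by (auto simp: in_segment algebra_simps)
  define r where "r = min (if z = a then 1 else dist a z) (if z = b then 1 else dist b z)"
  have r0: "r > 0" by (auto simp: r_def)
  have da: "dist a z = m * norm (b - a)" using m by (simp add: dist_norm)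
  have "b - z = (1 - m) *\<^sub>R (b - a)" using m by (simp add: algebra_simps)
  then have db: "dist b z = (1 - m) * norm (b - a)" using m by (simp add: dist_norm)
  show ?thesis unfolding radial_at_def
  proof (intro exI[of _ r] conjI allI impI iffI)
    fix w \<tau> assume w: "dist w z < r" "0 < (\<tau>::real)" "\<tau> \<le> 1"
    { assume "w \<in> closed_segment a b"
      moreover have "z + \<tau> *\<^sub>R (w - z) = (1 - \<tau>) *\<^sub>R z + \<tau> *\<^sub>R w" by (simp add: algebra_simps)
      ultimately show "z + \<tau> *\<^sub>R (w - z) \<in> closed_segment a b"
        using True w by (simp add: convexD_alt) }
    assume "z + \<tau> *\<^sub>R (w - z) \<in> closed_segment a b"
    then obtain n where n: "0 \<le> n" "n \<le> 1" "z + \<tau> *\<^sub>R (w - z) = a + n *\<^sub>R (b - a)"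
      by (auto simp: in_segment algebra_simps)
    define k where "k = (n - m) / \<tau>"
    have "\<tau> *\<^sub>R (w - z) = (a + n *\<^sub>R (b - a)) - z" using n(3) by (metis add_diff_cancel_left')
    also have "\<dots> = (n - m) *\<^sub>R (b - a)" using m(3) by (simp add: algebra_simps)
    finally have "\<tau> *\<^sub>R (w - z) = (n - m) *\<^sub>R (b - a)" .
    then have "\<tau> *\<^sub>R (w - z) = \<tau> *\<^sub>R (k *\<^sub>R (b - a))" using w by (simp add: k_def)
    then have wz: "w - z = k *\<^sub>R (b - a)" using w by (metis real_vector.scale_left_imp_eq less_irrefl)
    have wk: "w = a + (m + k) *\<^sub>R (b - a)" using wz m(3) by (simp add: algebra_simps)
    show "w \<in> closed_segment a b"
    proof (cases "a = b")
      case True then show ?thesis using wk by simp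
    next
      case ab: False
      then have nz: "norm (b - a) > 0" by simp
      have dk: "\<bar>k\<bar> * norm (b - a) < r" using w(1) wz by (simp add: dist_norm)
      have up: "m + k \<le> 1"
      proof (rule ccontr)
        assume h: "\<not> m + k \<le> 1"
        then have kp: "k > 1 - m" by simp
        then have "k > 0" using m by simp
        then have "n > m" using w by (simp add: k_def zero_less_divide_iff)
        then have "m < 1" using n by simp
        then have "z \<noteq> b" using db nz by auto
        then have "r \<le> dist b z" by (simp add: r_def)
        with dk db have "\<bar>k\<bar> * norm (b - a) < (1 - m) * norm (b - a)" by simp
        then show False using nz kp m by (simp add: mult_less_cancel_right_disj)
      qed
      have lo: "0 \<le> m + k"
      proof (rule ccontr)
        assume h: "\<not> 0 \<le> m + k"
        then have kp: "k < - m" by simp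
        then have "k < 0" using m by simp
        then have "n < m" using w by (simp add: k_def divide_less_0_iff)
        then have "m > 0" using n by simp
        then have "z \<noteq> a" using da nz by auto
        then have "r \<le> dist a z" by (simp add: r_def)
        with dk da have "\<bar>k\<bar> * norm (b - a) < m * norm (b - a)" by simp
        moreover have "m * norm (b - a) < (- k) * norm (b - a)" using kp nz by (intro mult_strict_right_mono) auto
        ultimately show False using kp m by simp
      qed
      have "w = (1 - (m + k)) *\<^sub>R a + (m + k) *\<^sub>R b" using wk by (simp add: algebra_simps)
      then show ?thesis unfolding in_segment using lo up by blast
    qed
  qed (rule r0)
qed

text \<open>
  Moving \<open>w\<close> straight towards \<open>z\<close> one stays in \<open>P\<close>, or in one
  component of its complement.
\<close>

lemma radial_at_inside:
  assumes "radial_at P z" shows "radial_at (inside P) z"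
proof -
  obtain r where r: "r > 0" "\<And>w \<tau>. dist w z < r \<Longrightarrow> 0 < \<tau> \<Longrightarrow> \<tau> \<le> 1 \<Longrightarrow>
     (z + \<tau> *\<^sub>R (w - z) \<in> P \<longleftrightarrow> w \<in> P)" using assms unfolding radial_at_def by blast
  show ?thesis unfolding radial_at_def
  proof (intro exI[of _ r] conjI allI impI)
    fix w \<tau> assume w: "dist w z < r" "0 < (\<tau>::real)" "\<tau> \<le> 1"
    let ?y = "z + \<tau> *\<^sub>R (w - z)"
    show "?y \<in> inside P \<longleftrightarrow> w \<in> inside P"
    proof (cases "w \<in> P")
      case True
      then have "?y \<in> P" using r(2)[OF w] by simp
      then show ?thesis using True inside_no_overlap by blast
    next
      case False
      have "closed_segment ?y w \<subseteq> - P"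
      proof
        fix x assume "x \<in> closed_segment ?y w"
        then obtain m where m: "0 \<le> m" "m \<le> 1" "x = (1 - m) *\<^sub>R ?y + m *\<^sub>R w" by (auto simp: in_segment)
        define s where "s = \<tau> + m * (1 - \<tau>)"
        have "x = z + s *\<^sub>R (w - z)" using m(3) by (simp add: s_def algebra_simps)
        moreover have "0 < s" using m w by (simp add: s_def add_pos_nonneg)
        moreover have "m * (1 - \<tau>) \<le> 1 * (1 - \<tau>)" using m w by (intro mult_right_mono) auto
        then have "s \<le> 1" by (simp add: s_def)
        ultimately show "x \<in> - P" using r(2)[of w s] w(1) False by simp
      qed
      then have "connected_component (- P) ?y w"
        unfolding connected_component_def by (intro exI[of _ "closed_segment ?y w"]) auto
      then show ?thesis using inside_same_component[of P w ?y] inside_same_component[of P ?y w]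
        by (meson connected_component_sym)
    qed
  qed (rule r)
qed

lemma pathstart_polyline [simp]: "pathstart (polyline (x # xs)) = x"
  by (cases xs rule: polyline.cases) auto

lemma path_image_polyline_Cons:
  "path_image (polyline (x # y # zs)) = closed_segment x y \<union> path_image (polyline (y # zs))"
  by (cases zs) (auto simp: path_image_join)

lemma pathfinish_polyline: "xs \<noteq> [] \<Longrightarrow> pathfinish (polyline xs) = last xs"
  by (induction xs rule: polyline.induct) auto

lemma path_polyline: "path (polyline xs)"
  by (induction xs rule: polyline.induct) (auto simp: path_def[of "\<lambda>_. _"])

lemma radial_at_polyline: "radial_at (path_image (polyline xs)) z"
proof (induction xs rule: induct_list012)
  case 1 show ?case using radial_at_closed_segment[of 0 0 z] by simp
next
  case (2 x) show ?case using radial_at_closed_segment[of x x z] by simp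
next
  case (3 x y zs)
  then show ?case by (simp only: path_image_polyline_Cons radial_at_Un radial_at_closed_segment)
qed

lemma path_image_polyline_snoc:
  "xs \<noteq> [] \<Longrightarrow> path_image (polyline (xs @ [y])) = path_image (polyline xs) \<union> closed_segment (last xs) y"
proof (induction xs rule: induct_list012)
  case (3 x z zs)
  then show ?case using path_image_polyline_Cons[of x z "zs @ [y]"] path_image_polyline_Cons[of x z zs]
    by auto
qed auto

text \<open>
  Applied to the polygon without its first edge, this shows that the vertex \<open>b\<close> lies on no
  edges other than the first and the last.
\<close>

lemma arc_polyline_last_notin:
  "xs \<noteq> [] \<Longrightarrow> arc (polyline (xs @ [b])) \<Longrightarrow> b \<notin> path_image (polyline xs)"
proof (induction xs rule: induct_list012)
  case (2 x)
  then show ?case using arc_distinct_ends[of "linepath x b"] by auto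
next
  case (3 x y zs)
  have a: "arc (linepath x y +++ polyline (y # zs @ [b]))"
    using 3(4) by (cases "zs @ [b]") auto
  have a2: "arc (polyline ((y # zs) @ [b]))" and
    int: "closed_segment x y \<inter> path_image (polyline (y # zs @ [b])) \<subseteq> {y}"
    using a arc_join_eq[of "linepath x y" "polyline (y # zs @ [b])"] by auto
  have nb: "b \<notin> path_image (polyline (y # zs))" using 3(2) a2 by simp
  have "b \<in> path_image (polyline (y # zs @ [b]))"
    using pathfinish_polyline[of "y # zs @ [b]"] pathfinish_in_path_image[of "polyline (y # zs @ [b])"] by auto
  moreover have "y \<in> path_image (polyline (y # zs))"
    using pathstart_in_path_image[of "polyline (y # zs)"] by simp
  ultimately have "b \<notin> closed_segment x y" using int nb by auto
  then show ?case using nb by (simp only: path_image_polyline_Cons) auto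
qed simp

section \<open>Winding numbers at an extreme corner\<close>

lemma open_cone_interior:
  fixes v1 v2 z :: complex
  assumes np: "Im (cnj v1 * v2) \<noteq> 0" and ab: "0 < \<alpha>" "0 < \<beta>" "\<alpha> + \<beta> < e"
  shows "z + \<alpha> *\<^sub>R v1 + \<beta> *\<^sub>R v2 \<in> interior (convex hull {z + e *\<^sub>R v1, z, z + e *\<^sub>R v2})"
proof -
  define D where "D = Im (cnj v1 * v2)"
  define A where "A x = Im (cnj (x - z) * v2) / D" for x
  define B where "B x = Im (cnj v1 * (x - z)) / D" for x
  define W where "W = {x. 0 < A x} \<inter> {x. 0 < B x} \<inter> {x. A x + B x < e}"
  have D0: "D \<noteq> 0" using np by (simp add: D_def)
  have cA: "continuous_on UNIV A" "continuous_on UNIV B" unfolding A_def B_def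
    by (intro continuous_intros D0 ballI)+
  have "open W" unfolding W_def
    by (intro open_Int open_Collect_less continuous_intros cA)
  have rep: "x = z + A x *\<^sub>R v1 + B x *\<^sub>R v2" for x
  proof -
    have "D *\<^sub>R (x - z) = (D * A x) *\<^sub>R v1 + (D * B x) *\<^sub>R v2"
      using D0 by (simp add: A_def B_def) (simp add: D_def complex_eq_iff algebra_simps)
    then have "D *\<^sub>R (x - z) = D *\<^sub>R (A x *\<^sub>R v1 + B x *\<^sub>R v2)" by (simp add: scaleR_add_right)
    then have "x - z = A x *\<^sub>R v1 + B x *\<^sub>R v2" using D0 real_vector.scale_left_imp_eq by blast
    then show ?thesis by (simp add: algebra_simps)
  qed
  have "W \<subseteq> convex hull {z + e *\<^sub>R v1, z, z + e *\<^sub>R v2}"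
  proof
    fix x assume x: "x \<in> W"
    have e: "0 < e" using ab by simp
    have "x = (A x / e) *\<^sub>R (z + e *\<^sub>R v1) + (1 - A x / e - B x / e) *\<^sub>R z + (B x / e) *\<^sub>R (z + e *\<^sub>R v2)"
      using e by (subst rep[of x]) (simp add: algebra_simps add_divide_distrib)
    moreover have "0 \<le> A x / e" "0 \<le> B x / e" using x e by (auto simp: W_def)
    moreover have "(A x + B x) / e \<le> 1" using x e by (simp add: W_def)
    then have "0 \<le> 1 - A x / e - B x / e" by (simp add: add_divide_distrib)
    ultimately show "x \<in> convex hull {z + e *\<^sub>R v1, z, z + e *\<^sub>R v2}"
      unfolding convex_hull_3 by (intro CollectI exI[of _ "A x / e"] exI[of _ "1 - A x / e - B x / e"] exI[of _ "B x / e"]) auto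
  qed
  moreover have "z + \<alpha> *\<^sub>R v1 + \<beta> *\<^sub>R v2 \<in> W"
  proof -
    let ?x = "z + \<alpha> *\<^sub>R v1 + \<beta> *\<^sub>R v2"
    have "A ?x = \<alpha>" "B ?x = \<beta>" using D0
      by (simp_all add: A_def B_def field_simps) (simp_all add: D_def algebra_simps)
    then show ?thesis using ab by (simp add: W_def)
  qed
  ultimately show ?thesis using \<open>open W\<close> interior_maximal by blast
qed

text \<open>
  Replace the two sides \<open>A z\<close> and \<open>z B\<close> of the corner by the chord \<open>A
  B\<close>. The winding number of \<open>j\<close> is that of the shortened loop \<open>J\<close> plus
  that of the triangle \<open>A z B\<close>. As \<open>z\<close> is passed only once, \<open>J\<close>
  avoids a ball around \<open>z\<close>, and its winding number is constant there. It is zero, because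
  beyond the extreme point \<open>z\<close> there is a point \<open>q'\<close> of the ball outside the
  convex hull, where the loop and the triangle have winding number zero. At points in the angle of the
  corner the triangle remains.
\<close>

lemma corner_winding:
  fixes j :: "real \<Rightarrow> complex"
  assumes j: "path j" "pathfinish j = pathstart j"
    and e: "e > 0" "e \<le> t0" "t0 + e \<le> 1"
    and fw: "\<And>s. 0 \<le> s \<Longrightarrow> s \<le> e \<Longrightarrow> j (t0 + s) = z + s *\<^sub>R v2"
    and bw: "\<And>s. 0 \<le> s \<Longrightarrow> s \<le> e \<Longrightarrow> j (t0 - s) = z + s *\<^sub>R v1"
    and uniq: "\<And>t. t \<in> {0..1} \<Longrightarrow> t \<noteq> t0 \<Longrightarrow> j t \<noteq> z"
    and ext: "z extreme_point_of (convex hull path_image j)"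
    and np: "Im (cnj v1 * v2) \<noteq> 0"
  shows "\<exists>\<delta>>0. \<forall>\<alpha> \<beta>. 0 < \<alpha> \<longrightarrow> \<alpha> < \<delta> \<longrightarrow> 0 < \<beta> \<longrightarrow> \<beta> < \<delta> \<longrightarrow>
    z + \<alpha> *\<^sub>R v1 + \<beta> *\<^sub>R v2 \<notin> path_image j \<longrightarrow>
    winding_number j (z + \<alpha> *\<^sub>R v1 + \<beta> *\<^sub>R v2) \<noteq> 0"
proof -
  define A where "A = z + e *\<^sub>R v1"
  define B where "B = z + e *\<^sub>R v2"
  define p0 where "p0 = subpath 0 (t0 - e) j"
  define p1 where "p1 = subpath (t0 - e) t0 j"
  define p2 where "p2 = subpath t0 (t0 + e) j"
  define p3 where "p3 = subpath (t0 + e) 1 j"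
  define J where "J = (p0 +++ linepath A B) +++ p3"
  define T where "T = linepath A z +++ linepath z B +++ linepath B A"
  define K where "K = path_image p0 \<union> path_image p3 \<union> closed_segment A B"
  have jA: "j (t0 - e) = A" and jB: "j (t0 + e) = B"
    using bw[of e] fw[of e] e by (auto simp: A_def B_def)
  have pp: "path p0" "path p1" "path p2" "path p3"
    unfolding p0_def p1_def p2_def p3_def using e j by (auto intro!: path_subpath)
  have img: "path_image p0 = j ` {0..t0 - e}" "path_image p3 = j ` {t0 + e..1}"
    unfolding p0_def p3_def using e by (auto simp: path_image_subpath)
  have zAB: "z \<notin> closed_segment A B"
  proof
    assume "z \<in> closed_segment A B"
    then obtain u where u: "z = (1 - u) *\<^sub>R A + u *\<^sub>R B" by (auto simp: in_segment)
    then have 0: "((1 - u) * e) *\<^sub>R v1 + (u * e) *\<^sub>R v2 = 0"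
      by (simp add: A_def B_def algebra_simps)
    have "Im (cnj v1 * (((1 - u) * e) *\<^sub>R v1 + (u * e) *\<^sub>R v2)) = (u * e) * Im (cnj v1 * v2)"
      by (simp add: algebra_simps)
    then have "u = 0" using 0 np e by simp
    then have "v1 = 0" using 0 e by simp
    then show False using np by simp
  qed
  have "z \<noteq> j t" if "t \<in> {0..t0 - e} \<union> {t0 + e..1}" for t using uniq[of t] that e by auto
  then have "z \<notin> K" using zAB unfolding K_def img by blast
  moreover have "compact K" unfolding K_def using pp by (intro compact_Un compact_path_image) auto
  ultimately obtain \<rho> where \<rho>: "\<rho> > 0" "ball z \<rho> \<inter> K = {}"
    by (metis Compl_iff compact_imp_closed disjoint_eq_subset_Compl open_Compl open_contains_ball)
  have v12: "v1 + v2 \<noteq> 0" using np by (auto simp: add_eq_0_iff)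
  define \<kappa> where "\<kappa> = \<rho> / (2 * norm (v1 + v2))"
  have \<kappa>: "\<kappa> > 0" using \<rho> v12 by (simp add: \<kappa>_def)
  \<comment> \<open>just beyond \<open>z\<close>, seen from the midpoint \<open>m\<close> of the chord\<close>
  define q' where "q' = z - \<kappa> *\<^sub>R (v1 + v2)"
  have q'b: "q' \<in> ball z \<rho>" using v12 \<rho> by (simp add: q'_def dist_norm \<kappa>_def)
  have AB: "A \<in> path_image j" "B \<in> path_image j"
    using e jA jB unfolding path_image_def by (auto intro!: imageI simp flip: jA jB)
  have q'h: "q' \<notin> convex hull path_image j"
  proof
    assume q: "q' \<in> convex hull path_image j"
    define m where "m = (1/2) *\<^sub>R A + (1/2) *\<^sub>R B"
    have "m \<in> convex hull path_image j" unfolding m_def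
      using AB by (intro convexD[OF convex_convex_hull]) (auto intro: hull_inc)
    have m: "m = z + (e/2) *\<^sub>R (v1 + v2)" by (simp add: m_def A_def B_def complex_eq_iff field_simps)
    define u where "u = \<kappa> / (\<kappa> + e/2)"
    have u: "0 < u" "u < 1" using \<kappa> e by (auto simp: u_def field_simps)
    have "(1 - u) * \<kappa> = u * (e / 2)" using \<kappa> e by (simp add: u_def field_simps)
    moreover have "(1 - u) *\<^sub>R q' + u *\<^sub>R m = z + (u * (e/2) - (1 - u) * \<kappa>) *\<^sub>R (v1 + v2)"
      by (simp add: q'_def m algebra_simps)
    ultimately have "z = (1 - u) *\<^sub>R q' + u *\<^sub>R m" by simp
    moreover have "m - q' = (\<kappa> + e/2) *\<^sub>R (v1 + v2)" by (simp add: m q'_def scaleR_add_left)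
    then have "q' \<noteq> m" using \<kappa> e v12 by auto
    ultimately have "z \<in> open_segment q' m" using u by (auto simp: in_segment)
    then show False using ext q \<open>m \<in> _\<close> by (auto simp: extreme_point_of_def)
  qed
  have hullsub: "path_image j \<subseteq> convex hull path_image j" by (rule hull_subset)
  have segj: "closed_segment A z \<subseteq> path_image j" "closed_segment z B \<subseteq> path_image j"
  proof -
    show "closed_segment A z \<subseteq> path_image j"
    proof
      fix x assume "x \<in> closed_segment A z"
      then obtain u where u: "0 \<le> u" "u \<le> 1" "x = (1 - u) *\<^sub>R A + u *\<^sub>R z" by (auto simp: in_segment)
      have "e * (1 - u) \<le> e * 1" using u e by (intro mult_left_mono) auto
      moreover have "0 \<le> e * (1 - u)" using u e by simp
      moreover have "x = z + (e * (1 - u)) *\<^sub>R v1" unfolding u(3) A_def by (simp add: algebra_simps)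
      ultimately have "j (t0 - e * (1 - u)) = x" "t0 - e * (1 - u) \<in> {0..1}"
        using bw[of "e * (1 - u)"] e by (simp, simp only: atLeastAtMost_iff, linarith)
      then show "x \<in> path_image j" unfolding path_image_def by blast
    qed
    show "closed_segment z B \<subseteq> path_image j"
    proof
      fix x assume "x \<in> closed_segment z B"
      then obtain u where u: "0 \<le> u" "u \<le> 1" "x = (1 - u) *\<^sub>R z + u *\<^sub>R B" by (auto simp: in_segment)
      have "e * u \<le> e * 1" using u e by (intro mult_left_mono) auto
      moreover have "0 \<le> e * u" using u e by simp
      moreover have "x = z + (e * u) *\<^sub>R v2" unfolding u(3) B_def by (simp add: algebra_simps)
      ultimately have "j (t0 + e * u) = x" "t0 + e * u \<in> {0..1}"
        using fw[of "e * u"] e by (simp, simp only: atLeastAtMost_iff, linarith)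
      then show "x \<in> path_image j" unfolding path_image_def by blast
    qed
  qed
  have ends: "pathstart p0 = pathfinish p3" "pathfinish p0 = A" "pathstart p3 = B"
    using j jA jB by (auto simp: p0_def p3_def pathstart_def pathfinish_def subpath_def)
  have Jp: "path J" "pathfinish J = pathstart J" "path_image J = K"
    unfolding J_def K_def using pp ends by (auto simp: path_image_join)
  have wn: "winding_number j q = winding_number J q + winding_number T q"
    if q: "q \<notin> path_image j" "q \<notin> closed_segment A B" for q
  proof -
    have "winding_number p1 q = winding_number (linepath A z) q"
    proof (rule winding_number_cong)
      fix x :: real assume x: "0 \<le> x" "x \<le> 1"
      have "e * (1 - x) \<le> e * 1" using x e by (intro mult_left_mono) auto
      moreover have eq: "(t0 - (t0 - e)) * x + (t0 - e) = t0 - e * (1 - x)" by (simp add: algebra_simps)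
      moreover have "0 \<le> e * (1 - x)" using x e by simp
      moreover have "linepath A z x = z + (e * (1 - x)) *\<^sub>R v1"
        unfolding linepath_def A_def by (simp add: algebra_simps)
      ultimately show "p1 x = linepath A z x" using bw[of "e * (1 - x)"]
        unfolding p1_def subpath_def eq by simp
    qed
    moreover have "winding_number p2 q = winding_number (linepath z B) q"
    proof (rule winding_number_cong)
      fix x :: real assume x: "0 \<le> x" "x \<le> 1"
      have "e * x \<le> e * 1" using x e by (intro mult_left_mono) auto
      moreover have "0 \<le> e * x" using x e by simp
      moreover have "linepath z B x = z + (e * x) *\<^sub>R v2"
        unfolding linepath_def B_def by (simp add: algebra_simps)
      moreover have eq: "(t0 + e - t0) * x + t0 = t0 + e * x" by simp
      ultimately show "p2 x = linepath z B x" using fw[of "e * x"]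
        unfolding p2_def subpath_def eq by simp
    qed
    moreover have "winding_number (subpath 0 t0 j) q = winding_number p0 q + winding_number p1 q"
      unfolding p0_def p1_def using q j e by (intro winding_number_subpath_combine[symmetric]) auto
    moreover have "winding_number (subpath 0 (t0 + e) j) q = winding_number (subpath 0 t0 j) q + winding_number p2 q"
      unfolding p2_def using q j e by (intro winding_number_subpath_combine[symmetric]) auto
    moreover have "winding_number (subpath 0 1 j) q = winding_number (subpath 0 (t0 + e) j) q + winding_number p3 q"
      unfolding p3_def using q j e by (intro winding_number_subpath_combine[symmetric]) auto
    moreover have sub: "path_image p0 \<subseteq> path_image j" "path_image p3 \<subseteq> path_image j"
      unfolding p0_def p3_def by (rule path_image_subpath_subset; use e j in simp)+
    moreover have "winding_number J q = winding_number p0 q + winding_number (linepath A B) q + winding_number p3 q"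
    proof -
      have a: "q \<notin> path_image p0" "q \<notin> path_image p3" using sub q by auto
      have b: "q \<notin> path_image (p0 +++ linepath A B)" using a q ends by (simp add: path_image_join)
      have "winding_number J q = winding_number (p0 +++ linepath A B) q + winding_number p3 q"
        unfolding J_def using winding_number_join[of "p0 +++ linepath A B" q p3] pp a b ends by simp
      also have "winding_number (p0 +++ linepath A B) q = winding_number p0 q + winding_number (linepath A B) q"
        using winding_number_join[of p0 q "linepath A B"] pp a q ends by simp
      finally show ?thesis .
    qed
    moreover have "winding_number T q = winding_number (linepath A z) q + (winding_number (linepath z B) q + winding_number (linepath B A) q)"
    proof -
      have a: "q \<notin> closed_segment A z" "q \<notin> closed_segment z B" "q \<notin> closed_segment B A"
        using q segj by (auto simp: closed_segment_commute)
      have "winding_number T q = winding_number (linepath A z) q + winding_number (linepath z B +++ linepath B A) q"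
        unfolding T_def using a by (intro winding_number_join) (auto simp: path_image_join)
      also have "winding_number (linepath z B +++ linepath B A) q = winding_number (linepath z B) q + winding_number (linepath B A) q"
        using a by (intro winding_number_join) auto
      finally show ?thesis .
    qed
    moreover have "winding_number (linepath B A) q = - winding_number (linepath A B) q"
      using winding_number_reversepath[of "linepath A B" q] q by simp
    ultimately show ?thesis by (simp del: add_right_cancel add_left_cancel)
  qed
  have hAB: "closed_segment A B \<subseteq> convex hull path_image j"
    using AB by (intro closed_segment_subset hull_inc convex_convex_hull)
  have "winding_number j q' = 0"
    by (rule winding_number_zero_outside[OF j(1) convex_convex_hull j(2) q'h hullsub])
  moreover have "winding_number T q' = 0"
  proof (rule winding_number_zero_outside[of _ "convex hull path_image j"])
    have "path_image T = closed_segment A z \<union> (closed_segment z B \<union> closed_segment A B)"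
      unfolding T_def by (simp add: path_image_join closed_segment_commute)
    then show "path_image T \<subseteq> convex hull path_image j" using segj hAB hullsub by blast
  qed (use q'h in \<open>simp_all add: T_def\<close>)
  ultimately have Jq': "winding_number J q' = 0"
    using wn[of q'] q'h hullsub hAB by (metis add.right_neutral subsetD)
  \<comment> \<open>\<open>\<rho> / M\<close> keeps the points in the ball, \<open>e / 2\<close> keeps them in the triangle\<close>
  define M where "M = norm v1 + norm v2 + 1"
  have M: "M > 0" by (simp add: M_def add_nonneg_pos)
  define \<delta> where "\<delta> = min (e/2) (\<rho> / M)"
  show ?thesis
  proof (intro exI[of _ \<delta>] conjI allI impI)
    show "\<delta> > 0" using e \<rho> M by (simp add: \<delta>_def)
    fix \<alpha> \<beta> :: real assume ab: "0 < \<alpha>" "\<alpha> < \<delta>" "0 < \<beta>" "\<beta> < \<delta>"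
    let ?q = "z + \<alpha> *\<^sub>R v1 + \<beta> *\<^sub>R v2"
    assume qj: "?q \<notin> path_image j"
    have "norm (\<alpha> *\<^sub>R v1 + \<beta> *\<^sub>R v2) \<le> \<alpha> * norm v1 + \<beta> * norm v2"
      using norm_triangle_ineq[of "\<alpha> *\<^sub>R v1" "\<beta> *\<^sub>R v2"] ab by simp
    also have "\<dots> \<le> \<delta> * norm v1 + \<delta> * norm v2" using ab by (intro add_mono mult_right_mono) auto
    also have "\<dots> < \<delta> * M" using ab by (simp add: M_def algebra_simps)
    also have "\<dots> \<le> \<rho> / M * M" using M by (intro mult_right_mono) (auto simp: \<delta>_def)
    finally have "norm (\<alpha> *\<^sub>R v1 + \<beta> *\<^sub>R v2) < \<rho>" using M by simp
    moreover have "dist z ?q = norm (\<alpha> *\<^sub>R v1 + \<beta> *\<^sub>R v2)"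
      by (metis add.assoc add_diff_cancel_left' dist_commute dist_norm)
    ultimately have qb: "?q \<in> ball z \<rho>" by simp
    have "winding_number J ?q = winding_number J q'"
      using Jp \<rho> qb q'b by (intro winding_number_eq[of _ _ "ball z \<rho>"]) auto
    moreover have "?q \<notin> closed_segment A B" using qb \<rho> by (auto simp: K_def)
    moreover have "?q \<in> interior (convex hull {A, z, B})"
      unfolding A_def B_def using ab by (intro open_cone_interior np) (auto simp: \<delta>_def)
    then have "winding_number T ?q \<noteq> 0" unfolding T_def by (subst winding_number_triangle) auto
    ultimately show "winding_number j ?q \<noteq> 0" using wn[OF qj] Jq' by simp
  qed
qed

lemma extreme_point_not_between:
  fixes z w :: "'a::euclidean_space"
  assumes "z extreme_point_of (convex hull Q)" "z + w \<in> Q" "z - w \<in> Q"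
  shows "w = 0"
proof (rule ccontr)
  assume w: "w \<noteq> 0"
  have "(1 - 1/2) *\<^sub>R (z + w) + (1/2) *\<^sub>R (z - w) = (1/2 + 1/2 :: real) *\<^sub>R z"
    unfolding scaleR_add_left by (simp add: scaleR_add_right scaleR_diff_right)
  then have "z = (1 - 1/2) *\<^sub>R (z + w) + (1/2) *\<^sub>R (z - w)" by simp
  moreover have "(z + w) - (z - w) = 2 *\<^sub>R w" by (simp add: scaleR_2)
  then have "z + w \<noteq> z - w" using w by (metis diff_self scaleR_eq_0_iff zero_neq_numeral)
  ultimately have "z \<in> open_segment (z + w) (z - w)"
    unfolding in_segment by (intro conjI exI[of _ "1/2"]) auto
  then show False using assms by (auto simp: extreme_point_of_def hull_inc)
qed

text \<open>
  By Krein and Milman a convex hull with no extreme points besides \<open>k1\<close> and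
  \<open>k2\<close> is contained in the segment between them.
\<close>

lemma extreme_point_outside:
  fixes Q :: "complex set"
  assumes "compact Q"
  obtains z where "z extreme_point_of (convex hull Q)" "z \<in> Q" "z \<noteq> k1" "z \<noteq> k2"
   | "Q \<subseteq> closed_segment k1 k2"
proof (cases "\<exists>z. z extreme_point_of (convex hull Q) \<and> z \<noteq> k1 \<and> z \<noteq> k2")
  case True then show ?thesis using that(1) extreme_point_of_convex_hull by blast
next
  case False
  then have "{z. z extreme_point_of (convex hull Q)} \<subseteq> {k1, k2}" by blast
  then have "convex hull {z. z extreme_point_of (convex hull Q)} \<subseteq> convex hull {k1, k2}" by (rule hull_mono)
  then have "convex hull Q \<subseteq> closed_segment k1 k2"
    using Krein_Milman_Minkowski[of "convex hull Q"] assms compact_convex_hull convex_convex_hull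
    by (metis segment_convex_hull)
  then show ?thesis using that(2) hull_subset[of Q convex] by (meson subset_trans)
qed

section \<open>Geodesics in compact metric spaces\<close>

lemma sup_limit_sequence:
  fixes f :: "'a \<Rightarrow> real"
  assumes "C \<noteq> {}" "bdd_above (f ` C)"
  obtains p where "\<And>n. p n \<in> C" "(\<lambda>n. f (p n)) \<longlonglongrightarrow> Sup (f ` C)"
proof -
  have "\<exists>q\<in>C. Sup (f ` C) - 1 / real (Suc n) < f q" for n
    using less_cSup_iff[of "f ` C" "Sup (f ` C) - 1 / real (Suc n)"] assms by auto
  then obtain p where p: "\<And>n. p n \<in> C" "\<And>n. Sup (f ` C) - 1 / real (Suc n) < f (p n)" by metis
  have "(\<lambda>n. f (p n)) \<longlonglongrightarrow> Sup (f ` C)"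
  proof (rule tendsto_sandwich)
    show "\<forall>\<^sub>F n in sequentially. Sup (f ` C) - 1 / real (Suc n) \<le> f (p n)"
      using p(2) by (simp add: less_imp_le)
    show "\<forall>\<^sub>F n in sequentially. f (p n) \<le> Sup (f ` C)"
      using p(1) assms by (auto intro!: always_eventually cSup_upper)
    show "(\<lambda>n. Sup (f ` C) - 1 / real (Suc n)) \<longlonglongrightarrow> Sup (f ` C)"
      using tendsto_diff[OF tendsto_const LIMSEQ_inverse_real_of_nat, of "Sup (f ` C)"]
      by (simp add: inverse_eq_divide)
  qed simp
  then show ?thesis using that p(1) by blast
qed

text \<open>
  Zorn's lemma replaces the usual limit argument on parametrizations. Consider sets \<open>C\<close> of
  points between \<open>x\<close> and \<open>y\<close> on which \<open>d\<close> is the difference of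
  the distances from \<open>x\<close>. A maximal one is closed under limits. If it missed the distance
  \<open>s\<close>, it would have a last point \<open>a\<close> before and a first point
  \<open>b\<close> after the gap, and a point between them at distance \<open>s\<close> from
  \<open>x\<close>, which exists by compactness, could be added. So the distance from \<open>x\<close>
  maps \<open>C\<close> isometrically onto the whole interval.
\<close>

lemma metric_geodesic_exists:
  fixes d :: "'a \<Rightarrow> 'a \<Rightarrow> real" and M :: "'a set"
  assumes nonneg: "\<And>p q. p \<in> M \<Longrightarrow> q \<in> M \<Longrightarrow> 0 \<le> d p q"
    and sym: "\<And>p q. p \<in> M \<Longrightarrow> q \<in> M \<Longrightarrow> d p q = d q p"
    and tri: "\<And>p q r. p \<in> M \<Longrightarrow> q \<in> M \<Longrightarrow> r \<in> M \<Longrightarrow> d p r \<le> d p q + d q r"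
    and zero: "\<And>p q. p \<in> M \<Longrightarrow> q \<in> M \<Longrightarrow> d p q = 0 \<longleftrightarrow> p = q"
    and comp: "\<And>f::nat \<Rightarrow> 'a. (\<And>n. f n \<in> M) \<Longrightarrow>
        \<exists>l\<in>M. \<exists>r. strict_mono r \<and> (\<lambda>n. d (f (r n)) l) \<longlonglongrightarrow> 0"
    and btw: "\<And>p q s \<epsilon>. p \<in> M \<Longrightarrow> q \<in> M \<Longrightarrow> 0 \<le> s \<Longrightarrow> s \<le> d p q \<Longrightarrow> 0 < \<epsilon> \<Longrightarrow>
        \<exists>z\<in>M. d p z \<le> s + \<epsilon> \<and> d z q \<le> d p q - s + \<epsilon>"
    and xy: "x \<in> M" "y \<in> M"
  obtains \<sigma> where "\<sigma> 0 = x" "\<sigma> (d x y) = y" "\<And>s. s \<in> {0..d x y} \<Longrightarrow> \<sigma> s \<in> M"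
    "\<And>s t. s \<in> {0..d x y} \<Longrightarrow> t \<in> {0..d x y} \<Longrightarrow> d (\<sigma> s) (\<sigma> t) = \<bar>s - t\<bar>"
proof -
  define len where "len = d x y"
  \<comment> \<open>by compactness, approximate intermediate points give exact ones\<close>
  have exact: "\<exists>z\<in>M. d p z = s \<and> d z q = d p q - s"
    if pq: "p \<in> M" "q \<in> M" and s: "0 \<le> s" "s \<le> d p q" for p q s
  proof -
    have "\<forall>n. \<exists>z. z \<in> M \<and> d p z \<le> s + 1 / real (Suc n) \<and> d z q \<le> d p q - s + 1 / real (Suc n)"
    proof
      fix n show "\<exists>z. z \<in> M \<and> d p z \<le> s + 1 / real (Suc n) \<and> d z q \<le> d p q - s + 1 / real (Suc n)"
        using btw[OF pq s, of "1 / real (Suc n)"] by (auto simp del: of_nat_Suc)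
    qed
    from choice[OF this] obtain f where f: "\<And>n. f n \<in> M" "\<And>n. d p (f n) \<le> s + 1 / real (Suc n)"
      "\<And>n. d (f n) q \<le> d p q - s + 1 / real (Suc n)" by blast
    obtain l r where l: "l \<in> M" "strict_mono r" "(\<lambda>n. d (f (r n)) l) \<longlonglongrightarrow> 0" using comp[of f, OF f(1)] by (elim bexE exE conjE)
    have inv: "(\<lambda>n. 1 / real (Suc (r n))) \<longlonglongrightarrow> 0"
      using LIMSEQ_subseq_LIMSEQ[OF LIMSEQ_inverse_real_of_nat l(2)]
      by (simp add: inverse_eq_divide o_def)
    have "d p l \<le> s"
    proof (rule LIMSEQ_le_const)
      show "(\<lambda>n. s + 1 / real (Suc (r n)) + d (f (r n)) l) \<longlonglongrightarrow> s"
        using tendsto_add[OF tendsto_add[OF tendsto_const inv] l(3), of s] by simp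
      have "d p l \<le> s + 1 / real (Suc (r n)) + d (f (r n)) l" for n
        using tri[of p "f (r n)" l] f(1,2)[of "r n"] pq l(1) by simp
      then show "\<exists>N. \<forall>n\<ge>N. d p l \<le> s + 1 / real (Suc (r n)) + d (f (r n)) l" by blast
    qed
    moreover have "d l q \<le> d p q - s"
    proof (rule LIMSEQ_le_const)
      show "(\<lambda>n. d p q - s + 1 / real (Suc (r n)) + d (f (r n)) l) \<longlonglongrightarrow> d p q - s"
        using tendsto_add[OF tendsto_add[OF tendsto_const inv] l(3), of "d p q - s"] by simp
      have "d l q \<le> d p q - s + 1 / real (Suc (r n)) + d (f (r n)) l" for n
        using tri[of l "f (r n)" q] f(1,3)[of "r n"] pq l(1) sym[of "f (r n)" l] by simp
      then show "\<exists>N. \<forall>n\<ge>N. d l q \<le> d p q - s + 1 / real (Suc (r n)) + d (f (r n)) l" by blast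
    qed
    moreover have "d p q \<le> d p l + d l q" using tri pq l(1) by blast
    ultimately show ?thesis using l(1) by (intro bexI[of _ l]) auto
  qed
  define Ch where "Ch = {C. C \<subseteq> M \<and> (\<forall>p\<in>C. d x p + d p y = len) \<and> (\<forall>p\<in>C. \<forall>q\<in>C. d p q = \<bar>d x p - d x q\<bar>)}"
  have "\<exists>C\<in>Ch. \<forall>X\<in>Ch. C \<subseteq> X \<longrightarrow> X = C"
  proof (rule subset_Zorn')
    fix K assume K: "subset.chain Ch K"
    have sub: "X \<in> Ch" if "X \<in> K" for X using K that by (auto simp: subset_chain_def)
    have "d p q = \<bar>d x p - d x q\<bar>" if "p \<in> X" "X \<in> K" "q \<in> Y" "Y \<in> K" for p q X Y
    proof -
      have "X \<subseteq> Y \<or> Y \<subseteq> X" using K that by (auto simp: subset_chain_def)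
      then show ?thesis using that sub[of X] sub[of Y] by (auto simp: Ch_def)
    qed
    then show "\<Union>K \<in> Ch" using sub by (fastforce simp: Ch_def)
  qed
  then obtain C where C: "C \<in> Ch" and maxC: "\<And>X. X \<in> Ch \<Longrightarrow> C \<subseteq> X \<Longrightarrow> X = C" by blast
  have CM: "C \<subseteq> M" and C1: "\<And>p. p \<in> C \<Longrightarrow> d x p + d p y = len"
    and C2: "\<And>p q. p \<in> C \<Longrightarrow> q \<in> C \<Longrightarrow> d p q = \<bar>d x p - d x q\<bar>" using C by (auto simp: Ch_def)
  have add: "z \<in> C" if z: "z \<in> M" "d x z + d z y = len" "\<And>q. q \<in> C \<Longrightarrow> d z q = \<bar>d x z - d x q\<bar>" for z
  proof -
    have "d p q = \<bar>d x p - d x q\<bar>" if "p \<in> insert z C" "q \<in> insert z C" for p q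
    proof (cases "p = z")
      case True
      then show ?thesis using that z zero[of z z] by auto
    next
      case False
      then show ?thesis using that z(3)[of p] C2[of p q] sym[of p z] z(1) CM by (auto simp: abs_minus_commute)
    qed
    then have "insert z C \<in> Ch" using z CM C1 by (auto simp: Ch_def)
    then show ?thesis using maxC by blast
  qed
  have xx: "d x x = 0" "d y y = 0" using zero xy by auto
  have xC: "x \<in> C"
  proof (rule add)
    fix q assume "q \<in> C"
    then show "d x q = \<bar>d x x - d x q\<bar>" using xx nonneg xy CM by auto
  qed (use xy xx len_def in auto)
  have yC: "y \<in> C"
  proof (rule add)
    fix q assume "q \<in> C"
    then show "d y q = \<bar>d x y - d x q\<bar>" using C1[of q] nonneg[of q y] sym[of y q] xy CM by (auto simp: len_def)
  qed (use xy xx len_def in auto)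
  have cont: "(\<lambda>n. d x (p n)) \<longlonglongrightarrow> d x l" if p: "\<And>n. p n \<in> M" and l: "l \<in> M" "(\<lambda>n. d (p n) l) \<longlonglongrightarrow> 0"
    for p :: "nat \<Rightarrow> 'a" and l
  proof -
    have "\<bar>d x (p n) - d x l\<bar> \<le> d (p n) l" for n
      using tri[of x l "p n"] tri[of x "p n" l] sym[of l "p n"] l(1) p[of n] xy by auto
    then have "(\<lambda>n. d x (p n) - d x l) \<longlonglongrightarrow> 0"
      by (intro Lim_null_comparison[OF _ l(2)]) auto
    then show ?thesis by (rule LIM_zero_cancel)
  qed
  have lim: "l \<in> C" if p: "\<And>n. p n \<in> C" and l: "l \<in> M" "(\<lambda>n. d (p n) l) \<longlonglongrightarrow> 0" for p :: "nat \<Rightarrow> 'a" and l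
  proof -
    have conv: "(\<lambda>n. d (p n) q) \<longlonglongrightarrow> d l q" if q: "q \<in> M" for q
    proof -
      have "\<bar>d (p n) q - d l q\<bar> \<le> d (p n) l" for n
        using tri[of "p n" l q] tri[of l "p n" q] sym[of l "p n"] q l(1) p[of n] CM by auto
      then have "(\<lambda>n. d (p n) q - d l q) \<longlonglongrightarrow> 0"
        by (intro Lim_null_comparison[OF _ l(2)]) auto
      then show ?thesis by (rule LIM_zero_cancel)
    qed
    have cx: "(\<lambda>n. d x (p n)) \<longlonglongrightarrow> d x l" by (rule cont[OF _ l]) (use p CM in auto)
    show ?thesis
    proof (rule add)
      have "(\<lambda>n. d x (p n) + d (p n) y) \<longlonglongrightarrow> d x l + d l y" by (intro tendsto_add cx conv xy)
      moreover have "(\<lambda>n. d x (p n) + d (p n) y) = (\<lambda>n. len)" using C1 p by auto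
      ultimately show "d x l + d l y = len" by (simp add: LIMSEQ_const_iff)
      fix q assume q: "q \<in> C"
      have "(\<lambda>n. \<bar>d x (p n) - d x q\<bar>) \<longlonglongrightarrow> \<bar>d x l - d x q\<bar>" by (intro tendsto_intros cx)
      moreover have "(\<lambda>n. d (p n) q) = (\<lambda>n. \<bar>d x (p n) - d x q\<bar>)" using C2 p q by auto
      moreover have "(\<lambda>n. d (p n) q) \<longlonglongrightarrow> d l q" using conv q CM by blast
      ultimately show "d l q = \<bar>d x l - d x q\<bar>" by (simp add: LIMSEQ_unique)
    qed (rule l)
  qed
  have surj: "\<exists>z\<in>C. d x z = s" if s: "0 \<le> s" "s \<le> len" for s
  proof (rule ccontr)
    assume no: "\<not> (\<exists>z\<in>C. d x z = s)"
    define L where "L = {p \<in> C. d x p < s}"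
    define U where "U = {p \<in> C. d x p > s}"
    have s': "0 < s" "s < len" using no xC yC xx s len_def by (metis order_less_le)+
    have LU: "x \<in> L" "y \<in> U" using s' xC yC xx by (auto simp: L_def U_def len_def)
    have bL: "bdd_above (d x ` L)" by (intro bdd_aboveI[of _ s]) (auto simp: L_def)
    have bU: "bdd_above ((\<lambda>p. - d x p) ` U)" by (intro bdd_aboveI[of _ "- s"]) (auto simp: U_def)
    obtain p where p: "\<And>n. p n \<in> L" "(\<lambda>n. d x (p n)) \<longlonglongrightarrow> Sup (d x ` L)"
      using sup_limit_sequence[of L "d x"] LU bL by blast
    obtain q where q: "\<And>n. q n \<in> U" "(\<lambda>n. - d x (q n)) \<longlonglongrightarrow> Sup ((\<lambda>p. - d x p) ` U)"
      using sup_limit_sequence[of U "\<lambda>p. - d x p"] LU bU by blast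
    have pM: "p n \<in> M" "q n \<in> M" for n using p q CM by (auto simp: L_def U_def)
    obtain a r where a: "a \<in> M" "strict_mono r" "(\<lambda>n. d (p (r n)) a) \<longlonglongrightarrow> 0" using comp[of p, OF pM(1)] by (elim bexE exE conjE)
    obtain b r' where b: "b \<in> M" "strict_mono r'" "(\<lambda>n. d (q (r' n)) b) \<longlonglongrightarrow> 0" using comp[of q, OF pM(2)] by (elim bexE exE conjE)
    have aC: "a \<in> C" by (rule lim[OF _ a(1) a(3)]) (use p in \<open>auto simp: L_def\<close>)
    have bC: "b \<in> C" by (rule lim[OF _ b(1) b(3)]) (use q in \<open>auto simp: U_def\<close>)
    have "(\<lambda>n. d x (p (r n))) \<longlonglongrightarrow> d x a" by (rule cont[OF pM(1) a(1,3)])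
    moreover have "(\<lambda>n. d x (p (r n))) \<longlonglongrightarrow> Sup (d x ` L)"
      using LIMSEQ_subseq_LIMSEQ[OF p(2) a(2)] by (simp add: o_def)
    ultimately have fa: "d x a = Sup (d x ` L)" by (rule LIMSEQ_unique)
    have "(\<lambda>n. d x (q (r' n))) \<longlonglongrightarrow> d x b" by (rule cont[OF pM(2) b(1,3)])
    then have "(\<lambda>n. - d x (q (r' n))) \<longlonglongrightarrow> - d x b" by (rule tendsto_minus)
    moreover have "(\<lambda>n. - d x (q (r' n))) \<longlonglongrightarrow> Sup ((\<lambda>p. - d x p) ` U)"
      using LIMSEQ_subseq_LIMSEQ[OF q(2) b(2)] by (simp add: o_def)
    ultimately have fb: "- d x b = Sup ((\<lambda>p. - d x p) ` U)" by (rule LIMSEQ_unique)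
    have "d x a \<le> s" unfolding fa using LU by (intro cSup_least) (auto simp: L_def)
    then have as: "d x a < s" using no aC by force
    have "- d x b \<le> - s" unfolding fb using LU by (intro cSup_least) (auto simp: U_def)
    then have bs: "d x b > s" using no bC by force
    have dab: "d a b = d x b - d x a" using C2[OF aC bC] as bs by simp
    obtain z where z: "z \<in> M" "d a z = s - d x a" "d z b = d a b - (s - d x a)"
      using exact[OF a(1) b(1), of "s - d x a"] as bs dab by auto
    have zb: "d z b = d x b - s" using z dab by simp
    have xz: "d x z = s" and zl: "d x z + d z y = len"
    proof -
      have "d x z \<le> s" using tri[OF xy(1) a(1) z(1)] z by simp
      moreover have "d z y \<le> len - s" using tri[OF z(1) b(1) xy(2)] zb C1[OF bC] by simp
      moreover have "len \<le> d x z + d z y" using tri[OF xy(1) z(1) xy(2)] by (simp add: len_def)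
      ultimately show "d x z = s" "d x z + d z y = len" by auto
    qed
    have "z \<in> C"
    proof (rule add[OF z(1) zl])
      fix r assume r: "r \<in> C"
      then have rM: "r \<in> M" using CM by blast
      have lower: "\<bar>d x z - d x r\<bar> \<le> d z r"
        using tri[OF xy(1) z(1) rM] tri[OF xy(1) rM z(1)] sym[OF z(1) rM] by auto
      have "d x r < s \<or> d x r > s" using no r by force
      then have "d z r \<le> \<bar>d x z - d x r\<bar>"
      proof
        assume "d x r < s"
        then have "r \<in> L" using r by (simp add: L_def)
        then have "d x r \<le> d x a" unfolding fa using bL by (intro cSup_upper) auto
        then have "d r a = d x a - d x r" using C2[OF r aC] by simp
        then show ?thesis using tri[OF rM a(1) z(1)] z xz sym[OF z(1) rM] \<open>d x r < s\<close> by simp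
      next
        assume "d x r > s"
        then have "r \<in> U" using r by (simp add: U_def)
        then have "- d x r \<le> - d x b" unfolding fb using bU by (intro cSup_upper) auto
        then have "d b r = d x r - d x b" using C2[OF bC r] by simp
        then show ?thesis using tri[OF z(1) b(1) rM] zb xz \<open>d x r > s\<close> by simp
      qed
      then show "d z r = \<bar>d x z - d x r\<bar>" using lower by simp
    qed
    then show False using no xz by blast
  qed
  define \<sigma> where "\<sigma> s = (SOME z. z \<in> C \<and> d x z = s)" for s
  have \<sigma>: "\<sigma> s \<in> C" "d x (\<sigma> s) = s" if "s \<in> {0..len}" for s
  proof -
    have "\<exists>z. z \<in> C \<and> d x z = s" using surj[of s] that by auto
    from someI_ex[OF this] show "\<sigma> s \<in> C" "d x (\<sigma> s) = s" by (auto simp: \<sigma>_def)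
  qed
  have l0: "0 \<le> len" using nonneg xy by (simp add: len_def)
  show ?thesis
  proof (rule that[of \<sigma>])
    show "\<sigma> 0 = x" using \<sigma>[of 0] l0 zero[OF xy(1), of "\<sigma> 0"] CM by auto
    show "\<sigma> (d x y) = y"
      using \<sigma>[of len] l0 C2[of "\<sigma> len" y] yC zero[of "\<sigma> len" y] CM xy by (auto simp: len_def)
    show "\<sigma> s \<in> M" if "s \<in> {0..d x y}" for s using \<sigma>[of s] that CM by (auto simp: len_def)
    show "d (\<sigma> s) (\<sigma> t) = \<bar>s - t\<bar>" if "s \<in> {0..d x y}" "t \<in> {0..d x y}" for s t
      using \<sigma>[of s] \<sigma>[of t] C2[of "\<sigma> s" "\<sigma> t"] that by (simp add: len_def)
  qed
qed

section \<open>The slit, the rectangle and the polygon\<close>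

locale slit_domain =
  fixes ps :: "complex list" and R :: "complex set" and c :: complex
  assumes slit_data: "slit_data ps R c"
begin

abbreviation "b \<equiv> hd ps"
abbreviation "P \<equiv> poly_boundary ps"
abbreviation "D \<equiv> cut_domain ps R c"
abbreviation "S \<equiv> slit ps c"

text \<open>
  The affine coordinate in which the slit is the unit interval of the real axis.
\<close>

definition H :: "complex \<Rightarrow> complex" where "H z = (z - b) / (c - b)"

lemma rectangle_props: "compact R" "convex R"
proof -
  obtain p e f where R: "R = {p + s *\<^sub>R e + t *\<^sub>R f | s t. s \<in> {0..1} \<and> t \<in> {0..1::real}}"
    using slit_data unfolding slit_data_def is_rectangle_def by blast
  let ?g = "\<lambda>(s::real, t::real). p + s *\<^sub>R e + t *\<^sub>R f"
  have R': "R = ?g ` ({0..1} \<times> {0..1})" unfolding R by force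
  have "continuous_on ({0..1} \<times> {0..1}) ?g" unfolding case_prod_beta by (intro continuous_intros)
  then show "compact R" unfolding R' by (intro compact_continuous_image compact_Times compact_Icc)
  show "convex R"
  proof (rule convexI)
    fix x y and u v :: real assume h: "x \<in> R" "y \<in> R" "0 \<le> u" "0 \<le> v" "u + v = 1"
    obtain s t s' t' where x: "x = p + s *\<^sub>R e + t *\<^sub>R f" "s \<in> {0..1}" "t \<in> {0..1}"
      and y: "y = p + s' *\<^sub>R e + t' *\<^sub>R f" "s' \<in> {0..1}" "t' \<in> {0..1}" using h(1,2) unfolding R by blast
    have "p = u *\<^sub>R p + v *\<^sub>R p" using h(5) by (metis scaleR_add_left scaleR_one)
    then have "u *\<^sub>R x + v *\<^sub>R y = p + (u * s + v * s') *\<^sub>R e + (u * t + v * t') *\<^sub>R f"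
      by (simp add: x y algebra_simps)
    moreover have "u * s + v * s' \<in> {0..1}" "u * t + v * t' \<in> {0..1}"
      using convexD[OF convex_real_interval(5)[of 0 1], of _ _ u v] x y h by auto
    ultimately show "u *\<^sub>R x + v *\<^sub>R y \<in> R" unfolding R by blast
  qed
qed

lemma closed_R: "closed R" using rectangle_props compact_imp_closed by blast

lemma polygon_facts: "3 \<le> length ps" "simple_path (boundary_loop ps)"
  "pathstart (boundary_loop ps) = b" "pathfinish (boundary_loop ps) = b"
proof -
  show l: "3 \<le> length ps" and "simple_path (boundary_loop ps)"
    using slit_data by (auto simp: slit_data_def simple_polygon_def)
  obtain x xs where "ps = x # xs" using l by (cases ps) auto
  then show "pathstart (boundary_loop ps) = b" "pathfinish (boundary_loop ps) = b"
    using pathfinish_polyline[of "ps @ [hd ps]"] by (auto simp: boundary_loop_def)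
qed

lemma jordan: "open (inside P)" "connected (inside P)" "frontier (inside P) = P" "closed P"
  "inside P \<inter> P = {}" "inside P \<noteq> {}"
  using Jordan_inside_outside[OF polygon_facts(2)] polygon_facts closed_simple_path_image[of "boundary_loop ps"]
  by (auto simp: poly_boundary_def)

lemma b_in_P: "b \<in> P" using polygon_facts(3) pathstart_in_path_image unfolding poly_boundary_def by metis

lemma radial_P: "radial_at P z" unfolding poly_boundary_def boundary_loop_def by (rule radial_at_polyline)

lemma radial_inside: "radial_at (inside P) z" by (rule radial_at_inside[OF radial_P])

lemma region_R: "P \<subseteq> R" "inside P \<subseteq> R" "P \<inter> frontier R = {}" "inside P \<inter> frontier R = {}"
  using slit_data by (auto simp: slit_data_def poly_region_def)

lemma interior_R: "P \<union> inside P \<subseteq> interior R"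
  using region_R closed_R by (auto simp: frontier_def)

lemma ray_facts:
  shows c_frontier: "c \<in> frontier R" and bc: "b \<noteq> c"
    and ray_region: "\<And>z t. z = b + t *\<^sub>R (c - b) \<Longrightarrow> 0 \<le> t \<Longrightarrow> z \<in> P \<union> inside P \<Longrightarrow> z = b"
proof -
  obtain d where d: "ray b d \<inter> poly_region ps = {b}" "ray b d \<inter> frontier R = {c}"
    using slit_data unfolding slit_data_def by blast
  show cf: "c \<in> frontier R" using d by auto
  show "b \<noteq> c" using cf b_in_P region_R by auto
  obtain t0 where t0: "0 \<le> t0" "c = b + t0 *\<^sub>R d" using d(2) unfolding ray_def by blast
  have on: "z \<in> ray b d" if "z = b + t *\<^sub>R (c - b)" "0 \<le> t" for z t
    unfolding ray_def using that t0 by (intro CollectI exI[of _ "t * t0"]) simp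
  show "z = b" if "z = b + t *\<^sub>R (c - b)" "0 \<le> t" "z \<in> P \<union> inside P" for z t
    using on[OF that(1,2)] d(1) that(3) by (auto simp: poly_region_def)
qed

lemma H_eq: "z = b + H z * (c - b)" using bc by (simp add: H_def)

lemma H_real: "Im (H z) = 0 \<Longrightarrow> z = b + Re (H z) *\<^sub>R (c - b)"
  by (subst H_eq) (simp add: complex_eq_iff)

lemma H_inj: "H z = H w \<longleftrightarrow> z = w" using bc by (auto simp: H_def)

lemma H_b [simp]: "H b = 0" by (simp add: H_def)

lemma H_zero [simp]: "H z = 0 \<longleftrightarrow> z = b" using H_inj[of z b] by simp

lemma H_norm: "norm (H z) * norm (c - b) = norm (z - b)" using bc by (simp add: H_def norm_divide)

lemma H_dist: "dist (H z) (H w) * norm (c - b) = dist z w"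
  using bc by (simp add: H_def dist_norm norm_divide flip: diff_divide_distrib)

lemma slit_iff: "z \<in> S \<longleftrightarrow> Im (H z) = 0 \<and> 0 \<le> Re (H z) \<and> Re (H z) \<le> 1"
proof
  assume "z \<in> S"
  then obtain u where u: "0 \<le> u" "u \<le> 1" "z = (1 - u) *\<^sub>R b + u *\<^sub>R c" by (auto simp: slit_def in_segment)
  have "z - b = of_real u * (c - b)" using u by (simp add: scaleR_conv_of_real algebra_simps)
  then have "H z = of_real u" using bc by (simp add: H_def)
  then show "Im (H z) = 0 \<and> 0 \<le> Re (H z) \<and> Re (H z) \<le> 1" using u by simp
next
  assume h: "Im (H z) = 0 \<and> 0 \<le> Re (H z) \<and> Re (H z) \<le> 1"
  then have "z = (1 - Re (H z)) *\<^sub>R b + Re (H z) *\<^sub>R c"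
    using H_real[of z] by (simp add: algebra_simps)
  then show "z \<in> S" unfolding slit_def in_segment using h by blast
qed

lemma b_slit: "b \<in> S" by (simp add: slit_iff)

lemma closed_slit: "closed S" by (simp add: slit_def)

text \<open>
  Starting at the interior point \<open>b\<close>, a ray leaves the convex set \<open>R\<close> at its
  boundary point \<open>c\<close> for good.
\<close>

lemma ray_R:
  assumes "z \<in> R" "Im (H z) = 0" "0 \<le> Re (H z)" shows "z \<in> S"
proof (rule ccontr)
  assume n: "z \<notin> S"
  then have h: "Re (H z) > 1" using assms by (auto simp: slit_iff)
  have bi: "b \<in> interior R" using interior_R b_in_P by blast
  have "c = (1 - (1 - 1 / Re (H z))) *\<^sub>R z + (1 - 1 / Re (H z)) *\<^sub>R b"
    using h by (subst (2) H_real[OF assms(2)]) (simp add: algebra_simps)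
  then have "c = z - (1 - 1 / Re (H z)) *\<^sub>R (z - b)" by (simp add: algebra_simps)
  moreover have "0 < 1 - 1 / Re (H z)" "1 - 1 / Re (H z) \<le> 1" using h by auto
  ultimately have "c \<in> interior R"
    using mem_interior_closure_convex_shrink[OF rectangle_props(2) bi, of z "1 - 1 / Re (H z)"]
      assms(1) closure_subset by auto
  then show False using c_frontier by (simp add: frontier_def)
qed

lemma slit_region: "z \<in> S \<Longrightarrow> z \<in> P \<union> inside P \<Longrightarrow> z = b"
  using ray_region[of z "Re (H z)"] H_real[of z] by (auto simp: slit_iff)

lemma cut_domain_iff: "x \<in> D \<longleftrightarrow> fst x \<in> R \<and> fst x \<notin> inside P \<and>
    (fst x \<notin> S \<longrightarrow> snd x = tilde_side ps c (fst x))"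
  by (auto simp: cut_domain_def)

section \<open>The sectors at the slit vertex\<close>

text \<open>
  The two polygon edges at \<open>b\<close> end in \<open>e1\<close> and \<open>e2\<close>. They are
  seen from \<open>b\<close> under the angles \<open>\<theta>l\<close> and \<open>\<theta>u\<close>, in
  increasing order, from the slit.
\<close>

definition "e1 = ps ! 1"
definition "e2 = last ps"
definition "\<theta>l = min (turn ps c e1) (turn ps c e2)"
definition "\<theta>u = max (turn ps c e1) (turn ps c e2)"

lemma turn_H: "turn ps c z = Arg2pi (H z)" by (simp add: turn_def H_def)

lemma tilde_side_iff: "tilde_side ps c z \<longleftrightarrow> turn ps c z \<le> \<theta>l"
  by (simp add: tilde_side_def \<theta>l_def e1_def e2_def)

lemma edges_at_b:
  obtains Q where "P = closed_segment b e1 \<union> Q \<union> closed_segment b e2" "closed Q" "b \<notin> Q"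
    "e1 \<noteq> b" "e2 \<noteq> b" "e1 \<in> P" "e2 \<in> P"
proof -
  obtain x y z zs where psx: "ps = x # y # z # zs" using polygon_facts(1)
    by (cases ps; cases "tl ps"; cases "tl (tl ps)") auto
  have bl: "boundary_loop ps = linepath b y +++ polyline ((y # z # zs) @ [b])"
    by (simp add: psx boundary_loop_def)
  have "arc (linepath b y)" "arc (polyline ((y # z # zs) @ [b]))"
    using polygon_facts(2) unfolding bl
    by (subst (asm) simple_path_join_loop_eq; use pathfinish_polyline[of "(y # z # zs) @ [b]"] in auto)+
  then have nb: "b \<notin> path_image (polyline (y # z # zs))" and bey: "b \<noteq> y"
    using arc_polyline_last_notin[of "y # z # zs" b] arc_distinct_ends[of "linepath b y"] by auto
  define Q where "Q = path_image (polyline (y # z # zs))"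
  have e: "e1 = y" "e2 = last (y # z # zs)" by (simp_all add: e1_def e2_def) (simp_all add: psx)
  have PQ: "P = closed_segment b e1 \<union> Q \<union> closed_segment b e2"
    unfolding poly_boundary_def bl Q_def e
    using path_image_polyline_snoc[of "y # z # zs" b]
    by (subst path_image_join) (auto simp: closed_segment_commute)
  have e2Q: "e2 \<in> Q" unfolding Q_def e
    using pathfinish_polyline[of "y # z # zs"] pathfinish_in_path_image[of "polyline (y # z # zs)"] by simp
  have bQ: "b \<notin> Q" using nb by (simp add: Q_def)
  show ?thesis
  proof (rule that[OF PQ _ bQ])
    show "closed Q" unfolding Q_def by (intro closed_path_image path_polyline)
    show "e1 \<noteq> b" using bey e by simp
    show "e2 \<noteq> b" using e2Q bQ by metis
    show "e1 \<in> P" "e2 \<in> P" unfolding PQ by simp_all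
  qed
qed

lemma turn_range: "0 \<le> turn ps c z" "turn ps c z < 2 * pi"
  unfolding turn_H using Arg2pi by auto

lemma turn_zero: "turn ps c z = 0 \<longleftrightarrow> Im (H z) = 0 \<and> 0 \<le> Re (H z)"
  unfolding turn_H Arg2pi_eq_0 by (simp add: complex_is_Real_iff)

lemma \<theta>_bounds: "0 < \<theta>l" "\<theta>l \<le> \<theta>u" "\<theta>u < 2 * pi"
proof -
  obtain Q where Q: "e1 \<noteq> b" "e2 \<noteq> b" "e1 \<in> P" "e2 \<in> P" using edges_at_b by blast
  have "turn ps c z \<noteq> 0" if "z \<in> P" "z \<noteq> b" for z
    using ray_region[of z "Re (H z)"] H_real[of z] that by (auto simp: turn_zero)
  then have "turn ps c e1 > 0" "turn ps c e2 > 0" using Q turn_range(1) by (metis order_less_le)+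
  then show "0 < \<theta>l" "\<theta>l \<le> \<theta>u" "\<theta>u < 2 * pi" using turn_range(2) by (auto simp: \<theta>l_def \<theta>u_def)
qed

definition polar :: "real \<Rightarrow> real \<Rightarrow> complex" where
  "polar \<rho> \<theta> = b + of_real \<rho> * exp (\<i> * of_real \<theta>) * (c - b)"

lemma H_polar: "H (polar \<rho> \<theta>) = of_real \<rho> * exp (\<i> * of_real \<theta>)"
  using bc by (simp add: polar_def H_def)

lemma polar_H: "z = polar (norm (H z)) (turn ps c z)"
  using H_inj[of z "polar (norm (H z)) (turn ps c z)"] Arg2pi_eq[of "H z"] unfolding H_polar turn_H by simp

lemma dist_polar: "0 \<le> \<rho> \<Longrightarrow> dist (polar \<rho> \<theta>) b = \<rho> * norm (c - b)"
  by (simp add: polar_def dist_norm norm_mult)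

lemma turn_polar: "0 < \<rho> \<Longrightarrow> 0 \<le> \<theta> \<Longrightarrow> \<theta> < 2 * pi \<Longrightarrow> turn ps c (polar \<rho> \<theta>) = \<theta>"
  unfolding turn_H H_polar by (rule Arg2pi_unique) auto

lemma polar_2pi: "polar \<rho> (2 * pi) = polar \<rho> 0" by (simp add: polar_def exp_eq_1)

lemma segment_turn:
  assumes e: "e \<noteq> b" and z: "z \<noteq> b" "dist z b < dist e b"
  shows "z \<in> closed_segment b e \<longleftrightarrow> turn ps c z = turn ps c e"
proof
  assume "z \<in> closed_segment b e"
  then obtain u where u: "0 \<le> u" "u \<le> 1" "z = (1 - u) *\<^sub>R b + u *\<^sub>R e" by (auto simp: in_segment)
  have u0: "u > 0" using u z by (cases "u = 0") auto
  have "z - b = of_real u * (e - b)" using u by (simp add: scaleR_conv_of_real algebra_simps)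
  then have "H z = of_real u * H e" by (simp add: H_def)
  then show "turn ps c z = turn ps c e" unfolding turn_H using u0 by simp
next
  assume t: "turn ps c z = turn ps c e"
  define u where "u = norm (H z) / norm (H e)"
  have He: "norm (H e) > 0" using e by simp
  have "H z = of_real (norm (H z)) * exp (\<i> * of_real (turn ps c e))"
    using polar_H[of z] H_polar t by metis
  moreover have "H e = of_real (norm (H e)) * exp (\<i> * of_real (turn ps c e))"
    using polar_H[of e] H_polar by metis
  then have "of_real u * H e = of_real u * (of_real (norm (H e)) * exp (\<i> * of_real (turn ps c e)))" by simp
  then have "of_real u * H e = of_real (u * norm (H e)) * exp (\<i> * of_real (turn ps c e))"
    by (simp only: of_real_mult mult.assoc)
  ultimately have "H z = of_real u * H e" using He by (simp add: u_def)
  then have "z - b = of_real u * (e - b)" using bc by (simp add: H_def field_simps)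
  then have "z = (1 - u) *\<^sub>R b + u *\<^sub>R e" by (simp add: scaleR_conv_of_real algebra_simps)
  moreover have "norm (H z) * norm (c - b) < norm (H e) * norm (c - b)"
    unfolding H_norm using z by (simp add: dist_norm)
  then have "norm (H z) < norm (H e)" using bc by (simp add: mult_less_cancel_right_disj)
  then have "0 \<le> u" "u \<le> 1" using He by (auto simp: u_def field_simps)
  ultimately show "z \<in> closed_segment b e" unfolding in_segment by blast
qed

lemma connected_inside:
  assumes "connected X" "X \<inter> P = {}" "x \<in> X" "x \<in> inside P" shows "X \<subseteq> inside P"
proof
  fix y assume "y \<in> X"
  then have "connected_component (- P) x y" unfolding connected_component_def
    using assms by (intro exI[of _ X]) auto
  then show "y \<in> inside P" using inside_same_component assms(4) by blast
qed

lemma connected_sector: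
  assumes "connected T" shows "connected {polar \<rho> \<theta> | \<rho> \<theta>. \<rho> \<in> {0<..<r} \<and> \<theta> \<in> T}"
proof -
  have "{polar \<rho> \<theta> | \<rho> \<theta>. \<rho> \<in> {0<..<r} \<and> \<theta> \<in> T} = (\<lambda>(\<rho>, \<theta>). polar \<rho> \<theta>) ` ({0<..<r} \<times> T)" by force
  moreover have "connected ((\<lambda>(\<rho>, \<theta>). polar \<rho> \<theta>) ` ({0<..<r} \<times> T))"
    unfolding polar_def case_prod_beta
    by (intro connected_continuous_image continuous_intros connected_Times assms) auto
  ultimately show ?thesis by simp
qed

text \<open>
  Near \<open>b\<close> the polygon consists of its two edges at \<open>b\<close>, which cut a small
  disc into connected sectors disjoint from \<open>P\<close>. The sectors before the first and after the
  second edge contain points of the slit, which are outside. Since \<open>b\<close> is a boundary point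
  of the inside, the remaining sector is inside.
\<close>

lemma sectors_at_b:
  obtains r where "r > 0" "\<And>z. z \<noteq> b \<Longrightarrow> dist z b < r \<Longrightarrow>
      (z \<in> inside P \<longleftrightarrow> \<theta>l < turn ps c z \<and> turn ps c z < \<theta>u)" "\<theta>l < \<theta>u"
proof -
  obtain Q where Q: "P = closed_segment b e1 \<union> Q \<union> closed_segment b e2" "closed Q" "b \<notin> Q"
    "e1 \<noteq> b" "e2 \<noteq> b" using edges_at_b by metis
  obtain r1 where r1: "r1 > 0" "ball b r1 \<inter> Q = {}"
    by (metis Compl_iff Q(2,3) disjoint_eq_subset_Compl open_Compl open_contains_ball)
  define r where "r = min r1 (min (norm (c - b)) (min (dist e1 b) (dist e2 b)))"
  have r: "r > 0" using r1 Q bc by (auto simp: r_def)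
  have zP: "z \<in> P \<longleftrightarrow> turn ps c z = turn ps c e1 \<or> turn ps c z = turn ps c e2" if "z \<noteq> b" "dist z b < r" for z
    using segment_turn[of e1 z] segment_turn[of e2 z] that Q r1 by (auto simp: r_def dist_commute)
  define k where "k = r / norm (c - b)"
  have nb: "norm (c - b) > 0" using bc by simp
  have k: "k > 0" using r nb by (simp add: k_def)
  define Sec where "Sec T = {polar \<rho> \<theta> | \<rho> \<theta>. \<rho> \<in> {0<..<k} \<and> \<theta> \<in> T}" for T
  have dp: "polar \<rho> \<theta> \<noteq> b \<and> dist (polar \<rho> \<theta>) b < r" if "\<rho> \<in> {0<..<k}" for \<rho> \<theta>
  proof -
    have "\<rho> * norm (c - b) < k * norm (c - b)" using that nb by (intro mult_strict_right_mono) auto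
    then have "dist (polar \<rho> \<theta>) b < r" using that nb by (simp add: dist_polar k_def)
    moreover have "dist (polar \<rho> \<theta>) b > 0" using that nb by (simp add: dist_polar)
    ultimately show ?thesis by auto
  qed
  have zS: "z \<in> Sec T" if "z \<noteq> b" "dist z b < r" "turn ps c z \<in> T" for z T
  proof -
    have "norm (H z) * norm (c - b) < r" using that H_norm by (simp add: dist_norm)
    then have "norm (H z) < k" using nb by (simp add: k_def field_simps)
    moreover have "0 < norm (H z)" using that by simp
    ultimately show ?thesis unfolding Sec_def using that(3) polar_H[of z]
      by (intro CollectI exI[of _ "norm (H z)"] exI[of _ "turn ps c z"]) auto
  qed
  have SP: "Sec T \<inter> P = {}" if T: "T \<subseteq> {0..2*pi}" "turn ps c e1 \<notin> T" "turn ps c e2 \<notin> T" for T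
  proof (rule equals0I)
    fix z assume z: "z \<in> Sec T \<inter> P"
    then obtain \<rho> \<theta> where h: "z = polar \<rho> \<theta>" "\<rho> \<in> {0<..<k}" "\<theta> \<in> T" unfolding Sec_def by blast
    have zz: "z \<noteq> b" "dist z b < r" using dp h by auto
    show False
    proof (cases "\<theta> = 2 * pi")
      case True
      then have "turn ps c z = 0" using h polar_2pi turn_polar[of \<rho> 0] by simp
      then show False using zP[OF zz] z \<theta>_bounds by (auto simp: \<theta>l_def)
    next
      case False
      then have "turn ps c z = \<theta>" using h T turn_polar[of \<rho> \<theta>] by force
      then show False using zP[OF zz] z T h by auto
    qed
  qed
  have ray: "polar \<rho> 0 \<notin> inside P" if "\<rho> \<in> {0<..<k}" for \<rho>
  proof
    assume "polar \<rho> 0 \<in> inside P"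
    moreover have "polar \<rho> 0 = b + \<rho> *\<^sub>R (c - b)" by (simp add: polar_def scaleR_conv_of_real)
    ultimately have "polar \<rho> 0 = b" using ray_region[of "polar \<rho> 0" \<rho>] that by simp
    then show False using dp that by blast
  qed
  have S13: "Sec T \<inter> inside P = {}" if T: "T \<subseteq> {0..2*pi}" "turn ps c e1 \<notin> T" "turn ps c e2 \<notin> T"
    "connected T" "0 \<in> T \<or> 2 * pi \<in> T" for T
  proof (rule ccontr)
    assume "Sec T \<inter> inside P \<noteq> {}"
    then have "Sec T \<subseteq> inside P"
      using connected_inside[of "Sec T"] connected_sector[OF T(4), of k] SP[OF T(1-3)] unfolding Sec_def by blast
    moreover have ex: "\<exists>\<theta>\<in>T. polar (k/2) 0 = polar (k/2) \<theta>" using T(5) polar_2pi[of "k/2"] by metis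
    from ex have "polar (k/2) 0 \<in> Sec T"
    proof
      fix \<theta> assume "\<theta> \<in> T" "polar (k/2) 0 = polar (k/2) \<theta>"
      then show ?thesis using k unfolding Sec_def by (intro CollectI exI[of _ "k/2"] exI[of _ \<theta>]) auto
    qed
    ultimately show False using ray[of "k/2"] k by auto
  qed
  have l1: "\<theta>l \<le> turn ps c e1" "\<theta>l \<le> turn ps c e2" "turn ps c e1 \<le> \<theta>u" "turn ps c e2 \<le> \<theta>u"
    by (auto simp: \<theta>l_def \<theta>u_def)
  have in13: "z \<notin> inside P" if "z \<noteq> b" "dist z b < r" "turn ps c z < \<theta>l \<or> turn ps c z > \<theta>u" for z
    using that(3)
  proof
    assume "turn ps c z < \<theta>l"
    then have "z \<in> Sec {0..<\<theta>l}" using zS[OF that(1,2)] turn_range[of z] by simp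
    moreover have "Sec {0..<\<theta>l} \<inter> inside P = {}" by (rule S13) (use l1 \<theta>_bounds in auto)
    ultimately show ?thesis by blast
  next
    assume "turn ps c z > \<theta>u"
    then have "z \<in> Sec {\<theta>u<..2*pi}" using zS[OF that(1,2)] turn_range[of z] by simp
    moreover have "Sec {\<theta>u<..2*pi} \<inter> inside P = {}" by (rule S13) (use l1 \<theta>_bounds in auto)
    ultimately show ?thesis by blast
  qed
  have "b \<in> closure (inside P)" using b_in_P jordan(3) by (metis DiffD1 frontier_def)
  then obtain w where w: "w \<in> inside P" "dist w b < r" using r unfolding closure_approachable by blast
  have wb: "w \<noteq> b" using w b_in_P jordan(5) by blast
  have "turn ps c w \<noteq> turn ps c e1" "turn ps c w \<noteq> turn ps c e2" using zP[OF wb w(2)] w(1) jordan(5) by blast+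
  then have "turn ps c w \<noteq> \<theta>l" "turn ps c w \<noteq> \<theta>u" by (auto simp: \<theta>l_def \<theta>u_def min_def max_def)
  moreover have "\<not> turn ps c w < \<theta>l" "\<not> turn ps c w > \<theta>u" using in13[OF wb w(2)] w(1) by blast+
  ultimately have wt: "turn ps c w \<in> {\<theta>l<..<\<theta>u}" by simp
  have "Sec {\<theta>l<..<\<theta>u} \<subseteq> inside P"
  proof (rule connected_inside[OF _ _ zS[OF wb w(2) wt] w(1)])
    show "connected (Sec {\<theta>l<..<\<theta>u})" unfolding Sec_def by (rule connected_sector) auto
    show "Sec {\<theta>l<..<\<theta>u} \<inter> P = {}"
    proof (rule SP)
      show "{\<theta>l<..<\<theta>u} \<subseteq> {0..2*pi}" using \<theta>_bounds by auto
    qed (auto simp: \<theta>l_def \<theta>u_def)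
  qed
  then have in2: "z \<in> inside P" if "z \<noteq> b" "dist z b < r" "turn ps c z \<in> {\<theta>l<..<\<theta>u}" for z
    using zS[OF that] by blast
  show ?thesis
  proof (rule that[OF r])
    show "\<theta>l < \<theta>u" using wt by auto
    fix z assume z: "z \<noteq> b" "dist z b < r"
    have "z \<notin> inside P" if "turn ps c z = \<theta>l \<or> turn ps c z = \<theta>u"
    proof -
      have "turn ps c z = turn ps c e1 \<or> turn ps c z = turn ps c e2"
        using that by (auto simp: \<theta>l_def \<theta>u_def min_def max_def split: if_splits)
      then show ?thesis using zP[OF z] jordan(5) by blast
    qed
    then show "z \<in> inside P \<longleftrightarrow> \<theta>l < turn ps c z \<and> turn ps c z < \<theta>u"
      using in13[OF z] in2[OF z] by (cases "turn ps c z" \<theta>l rule: linorder_cases; cases "turn ps c z" \<theta>u rule: linorder_cases) auto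
  qed
qed

section \<open>Neighbourhoods and paths in the slit domain\<close>

text \<open>
  The basic neighbourhoods of the topology of the slit domain.
\<close>

definition N :: "dpoint \<Rightarrow> real \<Rightarrow> dpoint set" where
  "N x r = {y \<in> D. dist (fst y) (fst x) < r \<and> (fst x \<in> S \<longrightarrow> snd y = snd x)}"

text \<open>
  Continuity into the slit domain on an arbitrary parameter set. On the unit interval it is the path
  property, see \<open>pathin_iff\<close>.
\<close>

definition ncont :: "(real \<Rightarrow> dpoint) \<Rightarrow> real set \<Rightarrow> bool" where
  "ncont g T \<longleftrightarrow> (\<forall>t\<in>T. \<forall>r>0. \<exists>\<delta>>0. \<forall>t'\<in>T. \<bar>t' - t\<bar> < \<delta> \<longrightarrow> g t' \<in> N (g t) r)"

lemma N_mono: "r \<le> q \<Longrightarrow> N x r \<subseteq> N x q" by (auto simp: N_def)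

lemma N_self: "x \<in> D \<Longrightarrow> 0 < r \<Longrightarrow> x \<in> N x r" by (simp add: N_def)

lemma dpoint_eqI: "x \<in> D \<Longrightarrow> y \<in> D \<Longrightarrow> fst x = fst y \<Longrightarrow> fst x \<notin> S \<or> snd x = snd y \<Longrightarrow> x = y"
  by (auto simp: cut_domain_iff prod_eq_iff)

lemma ball_off_slit: assumes "z \<notin> S" obtains r where "r > 0" "ball z r \<inter> S = {}"
  by (metis Compl_iff assms closed_slit disjoint_eq_subset_Compl open_Compl open_contains_ball that)

lemma turn_near_slit:
  assumes "x \<in> S" "x \<noteq> b" "\<epsilon> > 0"
  obtains r where "r > 0" "\<And>z. dist z x < r \<Longrightarrow> 0 < Re (H z)"
    "\<And>z. dist z x < r \<Longrightarrow> 0 \<le> Im (H z) \<Longrightarrow> turn ps c z < \<epsilon>"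
    "\<And>z. dist z x < r \<Longrightarrow> Im (H z) < 0 \<Longrightarrow> 2 * pi - \<epsilon> < turn ps c z"
proof -
  have hx: "Im (H x) = 0" "0 < Re (H x)"
    using assms H_zero[of x] by (auto simp: slit_iff complex_eq_iff order_less_le)
  have ax: "Arg2pi (H x) = 0" using hx by (simp add: Arg2pi_eq_0 complex_is_Real_iff)
  have "continuous (at (H x) within {z. 0 \<le> Im z}) Arg2pi"
    using hx by (intro continuous_within_upperhalf_Arg2pi) auto
  then obtain \<delta> where \<delta>: "\<delta> > 0" "\<And>w. 0 \<le> Im w \<Longrightarrow> dist w (H x) < \<delta> \<Longrightarrow> dist (Arg2pi w) 0 < \<epsilon>"
    using assms(3) unfolding continuous_within_eps_delta ax by (metis mem_Collect_eq)
  have nb: "norm (c - b) > 0" using bc by simp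
  define q where "q = min \<delta> (Re (H x))"
  have q: "q > 0" using \<delta> hx by (simp add: q_def)
  have near: "dist (H z) (H x) < q" if "dist z x < q * norm (c - b)" for z
    using that H_dist[of z x] nb by (metis mult_less_cancel_right_pos)
  show ?thesis
  proof (rule that[of "q * norm (c - b)"])
    show "q * norm (c - b) > 0" using q nb by simp
    fix z assume z: "dist z x < q * norm (c - b)"
    have "\<bar>Re (H z) - Re (H x)\<bar> \<le> dist (H z) (H x)" using abs_Re_le_cmod[of "H z - H x"] by (simp add: dist_norm)
    then show "0 < Re (H z)" using near[OF z] unfolding q_def by linarith
    show "turn ps c z < \<epsilon>" if "0 \<le> Im (H z)"
      using \<delta>(2)[OF that] near[OF z] by (simp add: q_def turn_H dist_real_def)
    show "2 * pi - \<epsilon> < turn ps c z" if i: "Im (H z) < 0"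
    proof -
      have "dist (cnj (H z)) (H x) = norm (cnj (H z - H x))" proof -
        have "cnj (H x) = H x" using hx by (simp add: complex_eq_iff)
        then show ?thesis by (simp add: dist_norm)
      qed
      then have "dist (cnj (H z)) (H x) < \<delta>" using near[OF z] by (simp add: q_def dist_norm del: complex_cnj_diff)
      then have "Arg2pi (cnj (H z)) < \<epsilon>" using \<delta>(2)[of "cnj (H z)"] i by (simp add: dist_real_def)
      moreover have "Arg2pi (cnj (H z)) = 2 * pi - Arg2pi (H z)"
        using i by (simp add: Arg2pi_cnj complex_is_Real_iff)
      ultimately show ?thesis by (simp add: turn_H)
    qed
  qed
qed

text \<open>
  At a point of the slit other than \<open>b\<close> the polygon is far away, and the two sides of the
  slit are the upper and the lower half plane of the coordinate \<open>H\<close>.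
\<close>

lemma half_plane:
  assumes "x \<in> S" "x \<noteq> b"
  obtains r where "r > 0" "\<And>z. z \<in> R \<Longrightarrow> dist z x < r \<Longrightarrow> z \<notin> P \<union> inside P"
    "\<And>z. z \<in> R \<Longrightarrow> dist z x < r \<Longrightarrow> Im (H z) = 0 \<Longrightarrow> z \<in> S"
    "\<And>z. z \<in> R \<Longrightarrow> dist z x < r \<Longrightarrow> 0 < Im (H z) \<Longrightarrow> z \<notin> S \<and> tilde_side ps c z"
    "\<And>z. z \<in> R \<Longrightarrow> dist z x < r \<Longrightarrow> Im (H z) < 0 \<Longrightarrow> z \<notin> S \<and> \<not> tilde_side ps c z"
    "\<And>z. dist z x < r \<Longrightarrow> turn ps c z \<noteq> \<theta>l"
proof -
  have "closure (inside P) = P \<union> inside P"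
    using closure_Un_frontier[of "inside P"] jordan(3) by blast
  then have "closed (P \<union> inside P)" by (metis closed_closure)
  moreover have "x \<notin> P \<union> inside P" using slit_region assms by blast
  ultimately obtain r1 where r1: "r1 > 0" "ball x r1 \<inter> (P \<union> inside P) = {}"
    by (metis Compl_iff disjoint_eq_subset_Compl open_Compl open_contains_ball)
  obtain r2 where r2: "r2 > 0" "\<And>z. dist z x < r2 \<Longrightarrow> 0 < Re (H z)"
    "\<And>z. dist z x < r2 \<Longrightarrow> 0 \<le> Im (H z) \<Longrightarrow> turn ps c z < min \<theta>l (2 * pi - \<theta>u)"
    "\<And>z. dist z x < r2 \<Longrightarrow> Im (H z) < 0 \<Longrightarrow> 2 * pi - min \<theta>l (2 * pi - \<theta>u) < turn ps c z"
    using turn_near_slit[OF assms, of "min \<theta>l (2 * pi - \<theta>u)"] \<theta>_bounds by auto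
  show ?thesis
  proof (rule that[of "min r1 r2"])
    show "min r1 r2 > 0" using r1 r2 by simp
    fix z
    show "turn ps c z \<noteq> \<theta>l" if z: "dist z x < min r1 r2"
    proof (cases "0 \<le> Im (H z)")
      case True then show ?thesis using r2(3)[of z] z by auto
    next
      case False then show ?thesis using r2(4)[of z] z \<theta>_bounds by auto
    qed
    assume z: "z \<in> R" "dist z x < min r1 r2"
    show "z \<notin> P \<union> inside P" using r1 z by (auto simp: dist_commute)
    show "z \<in> S" if "Im (H z) = 0" using ray_R[OF z(1) that] r2(2)[of z] z by auto
    show "z \<notin> S \<and> tilde_side ps c z" if "0 < Im (H z)"
      using r2(3)[of z] z that unfolding tilde_side_iff by (auto simp: slit_iff)
    show "z \<notin> S \<and> \<not> tilde_side ps c z" if "Im (H z) < 0"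
      using r2(4)[of z] z that \<theta>_bounds unfolding tilde_side_iff by (auto simp: slit_iff)
  qed
qed

lemma turn_continuous:
  assumes "z \<in> R" "z \<notin> S" shows "isCont (turn ps c) z"
proof -
  have "H z \<notin> \<real>\<^sub>\<ge>\<^sub>0" using ray_R[OF assms(1)] assms(2) by (auto simp: complex_nonneg_Reals_iff)
  then have "isCont Arg2pi (H z)" by (rule continuous_at_Arg2pi)
  moreover have "isCont H z" unfolding H_def using bc by (intro continuous_intros) auto
  ultimately have "isCont (\<lambda>z. Arg2pi (H z)) z" using isCont_o2 by blast
  then show ?thesis unfolding turn_H .
qed

text \<open>
  Where the flag is determined by the planar point, it can only jump where \<open>turn\<close> passes
  \<open>\<theta>l\<close>. Near \<open>b\<close> the points just beyond \<open>\<theta>l\<close> are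
  inside the polygon, and near the other points of the slit \<open>\<theta>l\<close> is not attained.
\<close>

lemma flag_locally_const:
  assumes "x \<in> S"
  obtains r where "r > 0" "\<And>y. y \<in> D \<Longrightarrow> dist (fst y) x < r \<Longrightarrow> \<exists>\<delta>>0. \<forall>y'\<in>N y \<delta>. snd y' = snd y"
proof -
  obtain rb where rb: "rb > 0" "\<And>z. z \<noteq> b \<Longrightarrow> dist z b < rb \<Longrightarrow>
      (z \<in> inside P \<longleftrightarrow> \<theta>l < turn ps c z \<and> turn ps c z < \<theta>u)" and lu: "\<theta>l < \<theta>u"
    by (rule sectors_at_b, rule that, blast+)
  obtain r where r: "r > 0" "\<And>z. dist z x < r \<Longrightarrow> turn ps c z = \<theta>l \<Longrightarrow> dist z b < rb"
  proof (cases "x = b")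
    case True then show ?thesis using that[of rb] rb by auto
  next
    case False
    obtain r where "r > 0" "\<And>z. dist z x < r \<Longrightarrow> turn ps c z \<noteq> \<theta>l"
      by (rule half_plane[OF assms False], rule that, blast+)
    then show ?thesis using that[of r] by blast
  qed
  show ?thesis
  proof (rule that[OF r(1)])
    fix y assume y: "y \<in> D" "dist (fst y) x < r"
    show "\<exists>\<delta>>0. \<forall>y'\<in>N y \<delta>. snd y' = snd y"
    proof (cases "fst y \<in> S")
      case True then show ?thesis by (intro exI[of _ 1]) (auto simp: N_def)
    next
      case False
      have yR: "fst y \<in> R" "snd y = tilde_side ps c (fst y)" using y False by (auto simp: cut_domain_iff)
      obtain d1 where d1: "d1 > 0" "ball (fst y) d1 \<inter> S = {}" by (rule ball_off_slit[OF False], rule that, blast+)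
      have tc: "\<exists>d>0. \<forall>z. dist z (fst y) < d \<longrightarrow> dist (turn ps c z) (turn ps c (fst y)) < e" if "e > 0" for e
        using turn_continuous[OF yR(1) False] that unfolding continuous_at_eps_delta by blast
      have fl: "snd y' = tilde_side ps c (fst y')" "fst y' \<notin> inside P" "fst y' \<noteq> b" "dist (fst y') (fst y) < d"
        if "y' \<in> N y d" "d \<le> d1" for y' d
      proof -
        have "fst y' \<in> ball (fst y) d1" using that by (simp add: N_def dist_commute)
        then have "fst y' \<notin> S" using d1(2) by blast
        moreover have "fst y' \<noteq> b" using calculation b_slit by metis
        ultimately show "snd y' = tilde_side ps c (fst y')" "fst y' \<notin> inside P" "fst y' \<noteq> b" "dist (fst y') (fst y) < d"
          using that by (simp_all add: N_def cut_domain_iff)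
      qed
      show ?thesis
      proof (cases "turn ps c (fst y) = \<theta>l")
        case False
        obtain d2 where d2: "d2 > 0" "\<And>z. dist z (fst y) < d2 \<Longrightarrow> dist (turn ps c z) (turn ps c (fst y)) < \<bar>turn ps c (fst y) - \<theta>l\<bar>"
          using tc[of "\<bar>turn ps c (fst y) - \<theta>l\<bar>"] False by auto
        have "snd y' = snd y" if "y' \<in> N y (min d1 d2)" for y'
          using fl[OF that] d2(2)[of "fst y'"] unfolding yR(2) tilde_side_iff by (auto simp: dist_real_def)
        then show ?thesis using d1 d2 by (intro exI[of _ "min d1 d2"]) auto
      next
        case True
        have db: "dist (fst y) b < rb" using r(2)[OF y(2) True] .
        obtain d2 where d2: "d2 > 0" "\<And>z. dist z (fst y) < d2 \<Longrightarrow> dist (turn ps c z) (turn ps c (fst y)) < \<theta>u - \<theta>l"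
          using tc[of "\<theta>u - \<theta>l"] lu by auto
        define d where "d = min d1 (min d2 (rb - dist (fst y) b))"
        have "snd y' = snd y" if "y' \<in> N y d" for y'
        proof -
          have f: "snd y' = tilde_side ps c (fst y')" "fst y' \<notin> inside P" "fst y' \<noteq> b" "dist (fst y') (fst y) < d"
            using fl[OF that] by (auto simp: d_def)
          have "dist (fst y') b < rb" using f(4) dist_triangle[of "fst y'" b "fst y"] by (simp add: d_def)
          moreover have "turn ps c (fst y') < \<theta>u" using d2(2)[of "fst y'"] f(4) True by (auto simp: d_def dist_real_def)
          ultimately have "turn ps c (fst y') \<le> \<theta>l" using rb(2)[OF f(3)] f(2) by auto
          then show ?thesis using f(1) yR(2) True unfolding tilde_side_iff by auto
        qed
        moreover have "d > 0" using d1 d2 db by (simp add: d_def)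
        ultimately show ?thesis by blast
      qed
    qed
  qed
qed

lemma N_shrink: "y \<in> N x r \<Longrightarrow> \<exists>\<delta>>0. \<forall>z\<in>N y \<delta>. dist (fst z) (fst x) < r"
proof (intro exI conjI ballI)
  assume y: "y \<in> N x r"
  then show "0 < r - dist (fst y) (fst x)" by (simp add: N_def)
  fix z assume "z \<in> N y (r - dist (fst y) (fst x))"
  then show "dist (fst z) (fst x) < r" using dist_triangle[of "fst z" "fst x" "fst y"] by (simp add: N_def)
qed

lemma cut_open_iff: "cut_open ps R c V \<longleftrightarrow> V \<subseteq> D \<and> (\<forall>x\<in>V. \<exists>r>0. N x r \<subseteq> V)"
  unfolding cut_open_def N_def subset_eq by (simp add: Ball_def imp_conjL)

text \<open>
  Around a point of the slit this needs that the flag is locally constant nearby: a point of \<open>N x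
  r\<close> off the slit has a planar ball as a neighbourhood, in which the flag is not prescribed.
\<close>

lemma N_open:
  assumes "x \<in> D" obtains q where "q > 0" "\<And>r. r \<le> q \<Longrightarrow> cut_open ps R c (N x r)"
proof (cases "fst x \<in> S")
  case False
  show ?thesis
  proof (rule that[of 1])
    fix r
    show "cut_open ps R c (N x r)" unfolding cut_open_iff
    proof (intro conjI ballI)
      show "N x r \<subseteq> D" by (auto simp: N_def)
      fix y assume "y \<in> N x r"
      from N_shrink[OF this] obtain \<delta> where "\<delta> > 0" "\<forall>z\<in>N y \<delta>. dist (fst z) (fst x) < r" by blast
      moreover have "N y \<delta> \<subseteq> D" by (auto simp: N_def)
      ultimately show "\<exists>r'>0. N y r' \<subseteq> N x r" using False by (intro exI[of _ \<delta>]) (simp add: N_def[of x] subset_iff)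
    qed
  qed simp
next
  case True
  obtain q where q: "q > 0" "\<And>y. y \<in> D \<Longrightarrow> dist (fst y) (fst x) < q \<Longrightarrow> \<exists>\<delta>>0. \<forall>y'\<in>N y \<delta>. snd y' = snd y"
    by (rule flag_locally_const[OF True], rule that, blast+)
  show ?thesis
  proof (rule that[OF q(1)])
    fix r assume r: "r \<le> q"
    show "cut_open ps R c (N x r)" unfolding cut_open_iff
    proof (intro conjI ballI)
      show "N x r \<subseteq> D" by (auto simp: N_def)
      fix y assume y: "y \<in> N x r"
      from N_shrink[OF this] obtain \<delta> where d: "\<delta> > 0" "\<forall>z\<in>N y \<delta>. dist (fst z) (fst x) < r" by blast
      obtain \<delta>' where d': "\<delta>' > 0" "\<forall>z\<in>N y \<delta>'. snd z = snd y" using q(2)[of y] y r by (auto simp: N_def)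
      have "N y (min \<delta> \<delta>') \<subseteq> N x r"
      proof
        fix z assume z: "z \<in> N y (min \<delta> \<delta>')"
        then have "z \<in> N y \<delta>" "z \<in> N y \<delta>'" "z \<in> D" by (simp_all add: N_def)
        then have "dist (fst z) (fst x) < r" "snd z = snd y" "z \<in> D" using d(2) d'(2) by simp_all
        then show "z \<in> N x r" using y by (simp add: N_def)
      qed
      then show "\<exists>r'>0. N y r' \<subseteq> N x r" using d d' by (intro exI[of _ "min \<delta> \<delta>'"]) auto
    qed
  qed
qed

lemma pathin_iff: "pathin (cut_top ps R c) g \<longleftrightarrow> (\<forall>t\<in>{0..1}. g t \<in> D) \<and> ncont g {0..1}"
proof
  assume p: "pathin (cut_top ps R c) g"
  have gD: "g t \<in> D" if "t \<in> {0..1}" for t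
    using p that unfolding pathin_def continuous_map_def by (auto simp: topspace_cut_top Pi_iff)
  have "\<exists>\<delta>>0. \<forall>t'\<in>{0..1}. \<bar>t' - t\<bar> < \<delta> \<longrightarrow> g t' \<in> N (g t) r" if t: "t \<in> {0..1}" and r: "r > 0" for t r
  proof -
    obtain q where q: "q > 0" "\<And>r. r \<le> q \<Longrightarrow> cut_open ps R c (N (g t) r)" by (rule N_open[OF gD[OF t]], rule that, blast+)
    have "openin (top_of_set {0..1}) {s \<in> topspace (top_of_set {0..1}). g s \<in> N (g t) (min q r)}"
      using p q(2)[of "min q r"] unfolding pathin_def continuous_map_def by (simp add: openin_cut_top)
    then have "\<exists>e>0. \<forall>x'\<in>{0..1}. dist x' t < e \<longrightarrow> x' \<in> {s \<in> topspace (top_of_set {0..1}). g s \<in> N (g t) (min q r)}"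
      unfolding openin_euclidean_subtopology_iff using t N_self[OF gD[OF t]] q r by simp
    then show ?thesis using N_mono[of "min q r" r "g t"] by (auto simp: dist_real_def)
  qed
  then show "(\<forall>t\<in>{0..1}. g t \<in> D) \<and> ncont g {0..1}" using gD by (simp add: ncont_def)
next
  assume g: "(\<forall>t\<in>{0..1}. g t \<in> D) \<and> ncont g {0..1}"
  show "pathin (cut_top ps R c) g" unfolding pathin_def continuous_map_def
  proof (intro conjI allI impI)
    show "g \<in> topspace (top_of_set {0..1}) \<rightarrow> topspace (cut_top ps R c)" using g by (auto simp: topspace_cut_top)
    fix U assume "openin (cut_top ps R c) U"
    then have U: "cut_open ps R c U" by (simp add: openin_cut_top)
    show "openin (top_of_set {0..1}) {x \<in> topspace (top_of_set {0..1}). g x \<in> U}"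
      unfolding openin_euclidean_subtopology_iff
    proof (intro conjI ballI)
      show "{x \<in> topspace (top_of_set {0..1}). g x \<in> U} \<subseteq> {0..1}" by auto
      fix t assume "t \<in> {x \<in> topspace (top_of_set {0..1}). g x \<in> U}"
      then have t: "t \<in> {0..1}" "g t \<in> U" by auto
      obtain r where r: "r > 0" "N (g t) r \<subseteq> U" using U t unfolding cut_open_iff by blast
      obtain \<delta> where "\<delta> > 0" "\<forall>t'\<in>{0..1}. \<bar>t' - t\<bar> < \<delta> \<longrightarrow> g t' \<in> N (g t) r" using g t r unfolding ncont_def by blast
      then show "\<exists>e>0. \<forall>x'\<in>{0..1}. dist x' t < e \<longrightarrow> x' \<in> {x \<in> topspace (top_of_set {0..1}). g x \<in> U}"
        using r by (intro exI[of _ \<delta>]) (auto simp: dist_real_def)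
    qed
  qed
qed

lemma ncont_continuous: "ncont g T \<Longrightarrow> continuous_on T (\<lambda>t. fst (g t))"
  unfolding continuous_on_iff
proof (intro ballI allI impI)
  fix t r assume g: "ncont g T" "t \<in> T" "(0::real) < r"
  then obtain \<delta> where "\<delta> > 0" "\<forall>t'\<in>T. \<bar>t' - t\<bar> < \<delta> \<longrightarrow> g t' \<in> N (g t) r" unfolding ncont_def by blast
  then show "\<exists>\<delta>>0. \<forall>t'\<in>T. dist t' t < \<delta> \<longrightarrow> dist (fst (g t')) (fst (g t)) < r"
    by (intro exI[of _ \<delta>]) (simp add: N_def dist_real_def)
qed

lemma ncont_subset: "ncont g T \<Longrightarrow> U \<subseteq> T \<Longrightarrow> ncont g U" unfolding ncont_def by (meson subsetD)

lemma ncont_compose: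
  assumes "ncont g T" "continuous_on U f" "f ` U \<subseteq> T" shows "ncont (g \<circ> f) U"
  unfolding ncont_def
proof (intro ballI allI impI)
  fix t r assume t: "t \<in> U" "(0::real) < r"
  then obtain \<delta> where d: "\<delta> > 0" "\<forall>t'\<in>T. \<bar>t' - f t\<bar> < \<delta> \<longrightarrow> g t' \<in> N (g (f t)) r"
    using assms unfolding ncont_def by blast
  obtain e where "e > 0" "\<forall>t'\<in>U. dist t' t < e \<longrightarrow> dist (f t') (f t) < \<delta>"
    using assms(2) d(1) t unfolding continuous_on_iff by blast
  then show "\<exists>\<delta>>0. \<forall>t'\<in>U. \<bar>t' - t\<bar> < \<delta> \<longrightarrow> (g \<circ> f) t' \<in> N ((g \<circ> f) t) r"
    using d assms(3) by (intro exI[of _ e]) (auto simp: dist_real_def)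
qed

lemma ncont_glue:
  assumes "ncont f {a..m}" "ncont f {m..e}" "a \<le> m" "m \<le> e" shows "ncont f {a..e}"
  unfolding ncont_def
proof (intro ballI allI impI)
  fix t r :: real assume t: "t \<in> {a..e}" and r: "0 < r"
  have L: "\<exists>\<delta>>0. \<forall>t'\<in>{a..m}. \<bar>t' - t\<bar> < \<delta> \<longrightarrow> f t' \<in> N (f t) r"
  proof (cases "t \<le> m")
    case True then show ?thesis using assms(1) t r unfolding ncont_def by auto
  next
    case False then show ?thesis by (intro exI[of _ "t - m"]) auto
  qed
  have U: "\<exists>\<delta>>0. \<forall>t'\<in>{m..e}. \<bar>t' - t\<bar> < \<delta> \<longrightarrow> f t' \<in> N (f t) r"
  proof (cases "m \<le> t")
    case True then show ?thesis using assms(2) t r unfolding ncont_def by auto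
  next
    case False then show ?thesis by (intro exI[of _ "m - t"]) auto
  qed
  obtain \<delta> where \<delta>: "\<delta> > 0" "\<forall>t'\<in>{a..m}. \<bar>t' - t\<bar> < \<delta> \<longrightarrow> f t' \<in> N (f t) r" using L by blast
  obtain \<epsilon> where \<epsilon>: "\<epsilon> > 0" "\<forall>t'\<in>{m..e}. \<bar>t' - t\<bar> < \<epsilon> \<longrightarrow> f t' \<in> N (f t) r" using U by blast
  show "\<exists>\<delta>>0. \<forall>t'\<in>{a..e}. \<bar>t' - t\<bar> < \<delta> \<longrightarrow> f t' \<in> N (f t) r"
  proof (intro exI[of _ "min \<delta> \<epsilon>"] conjI ballI impI)
    fix t' assume "t' \<in> {a..e}" "\<bar>t' - t\<bar> < min \<delta> \<epsilon>"
    then have "t' \<in> {a..m} \<or> t' \<in> {m..e}" "\<bar>t' - t\<bar> < \<delta>" "\<bar>t' - t\<bar> < \<epsilon>" by auto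
    then show "f t' \<in> N (f t) r" using \<delta>(2) \<epsilon>(2) by blast
  qed (use \<delta> \<epsilon> in simp)
qed

lemma ncont_cong:
  assumes fg: "\<And>t. t \<in> T \<Longrightarrow> f t = g t" and g: "ncont g T" shows "ncont f T"
  unfolding ncont_def
proof (intro ballI allI impI)
  fix t r :: real assume t: "t \<in> T" "0 < r"
  obtain \<delta> where "\<delta> > 0" "\<forall>t'\<in>T. \<bar>t' - t\<bar> < \<delta> \<longrightarrow> g t' \<in> N (g t) r" using g t unfolding ncont_def by blast
  then show "\<exists>\<delta>>0. \<forall>t'\<in>T. \<bar>t' - t\<bar> < \<delta> \<longrightarrow> f t' \<in> N (f t) r"
    using fg t(1) by (intro exI[of _ \<delta>]) auto
qed

lemma ncont_join:
  assumes "ncont g {0..1}" "ncont h {0..1}" "g 1 = h 0"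
  shows "ncont (\<lambda>x. if x \<le> 1/2 then g (2 * x) else h (2 * x - 1)) {0..1}"
proof (rule ncont_glue[of _ 0 "1/2"])
  have "ncont (g \<circ> (\<lambda>x. 2 * x)) {0..1/2}"
    by (rule ncont_compose[OF assms(1)]) (auto intro!: continuous_intros)
  then show "ncont (\<lambda>x. if x \<le> 1/2 then g (2 * x) else h (2 * x - 1)) {0..1/2}"
    by (rule ncont_cong[rotated]) simp
  have "ncont (h \<circ> (\<lambda>x. 2 * x - 1)) {1/2..1}"
    by (rule ncont_compose[OF assms(2)]) (auto intro!: continuous_intros)
  then show "ncont (\<lambda>x. if x \<le> 1/2 then g (2 * x) else h (2 * x - 1)) {1/2..1}"
  proof (rule ncont_cong[rotated])
    fix x :: real assume x: "x \<in> {1/2..1}"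
    show "(if x \<le> 1/2 then g (2 * x) else h (2 * x - 1)) = (h \<circ> (\<lambda>x. 2 * x - 1)) x"
    proof (cases "x = 1/2")
      case True show ?thesis unfolding True using assms(3) by simp
    qed (use x in simp)
  qed
qed simp_all

lemma ncont_flag_const:
  assumes g: "ncont g {a..e}" and f: "\<And>t. t \<in> {a..e} \<Longrightarrow> \<exists>\<delta>>0. \<forall>y'\<in>N (g t) \<delta>. snd y' = snd (g t)"
    and st: "s \<in> {a..e}" "t \<in> {a..e}"
  shows "snd (g s) = snd (g t)"
proof (rule connected_local_const[of "{a..e}" s t "\<lambda>t. snd (g t)"])
  show "\<forall>u\<in>{a..e}. \<forall>\<^sub>F w in at u within {a..e}. snd (g u) = snd (g w)"
  proof
    fix u assume u: "u \<in> {a..e}"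
    obtain \<delta> where d: "\<delta> > 0" "\<forall>y'\<in>N (g u) \<delta>. snd y' = snd (g u)" using f[OF u] by blast
    obtain q where q: "q > 0" "\<forall>t'\<in>{a..e}. \<bar>t' - u\<bar> < q \<longrightarrow> g t' \<in> N (g u) \<delta>" using g u d unfolding ncont_def by blast
    show "\<forall>\<^sub>F w in at u within {a..e}. snd (g u) = snd (g w)"
      unfolding eventually_at using q d by (intro exI[of _ q]) (auto simp: dist_real_def)
  qed
qed (use st in auto)

section \<open>Visibility\<close>

definition seg :: "dpoint \<Rightarrow> dpoint \<Rightarrow> (real \<Rightarrow> dpoint) \<Rightarrow> bool" where
  "seg x y g \<longleftrightarrow> g 0 = x \<and> g 1 = y \<and> ncont g {0..1} \<and>
     (\<forall>t\<in>{0..1}. g t \<in> D \<and> fst (g t) = linepath (fst x) (fst y) t)"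

definition visible :: "dpoint \<Rightarrow> dpoint \<Rightarrow> bool" where "visible x y \<longleftrightarrow> (\<exists>g. seg x y g)"

lemma seg_iff_joins: "seg x y g \<longleftrightarrow> joins ps R c g x y \<and> (\<forall>t\<in>{0..1}. fst (g t) = linepath (fst x) (fst y) t)"
  by (auto simp only: seg_def joins_def pathin_iff)

lemma linepath_near:
  assumes "0 < r" obtains \<delta> where "\<delta> > 0" "\<And>t'. \<bar>t' - t\<bar> < \<delta> \<Longrightarrow> dist (linepath p q t') (linepath p (q::complex) t) < r"
proof -
  have "isCont (linepath p q) t" unfolding linepath_def by (intro continuous_intros)
  then show ?thesis using that assms unfolding continuous_at_eps_delta dist_real_def by blast
qed

lemma visible_off_slit:
  assumes "x \<in> D" "y \<in> D" "closed_segment (fst x) (fst y) \<inter> inside P = {}" "closed_segment (fst x) (fst y) \<inter> S = {}"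
  shows "visible x y"
proof -
  let ?l = "linepath (fst x) (fst y)"
  define g where "g t = (?l t, tilde_side ps c (?l t))" for t
  have in_seg: "?l t \<in> closed_segment (fst x) (fst y)" if "t \<in> {0..1}" for t using that linepath_in_path by auto
  have "fst x \<in> R" "fst y \<in> R" using assms by (auto simp: cut_domain_iff)
  then have segR: "closed_segment (fst x) (fst y) \<subseteq> R" using rectangle_props by (intro closed_segment_subset) auto
  have gD: "g t \<in> D" "fst (g t) \<notin> S" if "t \<in> {0..1}" for t
    using in_seg[OF that] assms(3,4) segR by (auto simp: g_def cut_domain_iff)
  have "ncont g {0..1}" unfolding ncont_def
  proof (intro ballI allI impI)
    fix t r :: real assume t: "t \<in> {0..1}" "0 < r"
    obtain \<delta> where "\<delta> > 0" "\<And>t'. \<bar>t' - t\<bar> < \<delta> \<Longrightarrow> dist (?l t') (?l t) < r" by (rule linepath_near[OF t(2)], rule that, blast+)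
    then show "\<exists>\<delta>>0. \<forall>t'\<in>{0..1}. \<bar>t' - t\<bar> < \<delta> \<longrightarrow> g t' \<in> N (g t) r"
      using gD t by (intro exI[of _ \<delta>]) (auto simp: N_def g_def)
  qed
  moreover have "g 0 = x" "g 1 = y"
    using gD[of 0] gD[of 1] assms(1,2) by (auto intro!: dpoint_eqI simp: g_def linepath_def)
  ultimately have "seg x y g" unfolding seg_def using gD by (auto simp: g_def)
  then show ?thesis unfolding visible_def by blast
qed

lemma visible_const_flag:
  assumes "snd x = s" "snd y = s" "\<And>z. z \<in> closed_segment (fst x) (fst y) \<Longrightarrow> (z, s) \<in> D"
  shows "visible x y"
proof -
  let ?l = "linepath (fst x) (fst y)"
  define g where "g t = (?l t, s)" for t
  have gD: "g t \<in> D" if "t \<in> {0..1}" for t using assms(3) that linepath_in_path by (auto simp: g_def)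
  have "ncont g {0..1}" unfolding ncont_def
  proof (intro ballI allI impI)
    fix t r :: real assume t: "t \<in> {0..1}" "0 < r"
    obtain \<delta> where "\<delta> > 0" "\<And>t'. \<bar>t' - t\<bar> < \<delta> \<Longrightarrow> dist (?l t') (?l t) < r" by (rule linepath_near[OF t(2)], rule that, blast+)
    then show "\<exists>\<delta>>0. \<forall>t'\<in>{0..1}. \<bar>t' - t\<bar> < \<delta> \<longrightarrow> g t' \<in> N (g t) r"
      using gD t by (intro exI[of _ \<delta>]) (auto simp: N_def g_def)
  qed
  then have "seg x y g" unfolding seg_def using gD assms(1,2) by (auto simp: g_def linepath_def prod_eq_iff)
  then show ?thesis unfolding visible_def by blast
qed

lemma H_convex: "H ((1 - u) *\<^sub>R z + u *\<^sub>R w) = (1 - u) *\<^sub>R H z + u *\<^sub>R H w"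
proof -
  have "(1 - u) *\<^sub>R z + u *\<^sub>R w - b = (1 - u) *\<^sub>R (z - b) + u *\<^sub>R (w - b)" by (simp add: algebra_simps)
  then show ?thesis unfolding H_def by (simp add: add_divide_distrib scaleR_conv_of_real)
qed

text \<open>
  The small neighbourhoods of a point of the slit are half discs, intersected with the convex set
  \<open>R\<close>; elsewhere they are discs without the polygon. At \<open>b\<close> itself this fails,
  since a neighbourhood of \<open>b\<close> may be a sector with a reflex angle.
\<close>

lemma shortcut:
  assumes x: "x \<in> D" "fst x \<noteq> b"
  obtains r where "r > 0" "\<And>y1 y2. y1 \<in> N x r \<Longrightarrow> y2 \<in> N x r \<Longrightarrow> visible y1 y2 \<or>
     (fst x \<notin> S \<and> closed_segment (fst y1) (fst y2) \<inter> inside P \<noteq> {})"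
proof (cases "fst x \<in> S")
  case False
  obtain r where r: "r > 0" "ball (fst x) r \<inter> S = {}" by (rule ball_off_slit[OF False], rule that, blast+)
  show ?thesis
  proof (rule that[OF r(1)])
    fix y1 y2 assume y: "y1 \<in> N x r" "y2 \<in> N x r"
    then have "closed_segment (fst y1) (fst y2) \<subseteq> ball (fst x) r"
      by (intro closed_segment_subset) (auto simp: N_def dist_commute)
    then show "visible y1 y2 \<or> (fst x \<notin> S \<and> closed_segment (fst y1) (fst y2) \<inter> inside P \<noteq> {})"
      using visible_off_slit[of y1 y2] y r False by (auto simp: N_def)
  qed
next
  case True
  obtain r where r: "r > 0" "\<And>z. z \<in> R \<Longrightarrow> dist z (fst x) < r \<Longrightarrow> z \<notin> P \<union> inside P"
    "\<And>z. z \<in> R \<Longrightarrow> dist z (fst x) < r \<Longrightarrow> Im (H z) = 0 \<Longrightarrow> z \<in> S"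
    "\<And>z. z \<in> R \<Longrightarrow> dist z (fst x) < r \<Longrightarrow> 0 < Im (H z) \<Longrightarrow> z \<notin> S \<and> tilde_side ps c z"
    "\<And>z. z \<in> R \<Longrightarrow> dist z (fst x) < r \<Longrightarrow> Im (H z) < 0 \<Longrightarrow> z \<notin> S \<and> \<not> tilde_side ps c z"
    "\<And>z. dist z (fst x) < r \<Longrightarrow> turn ps c z \<noteq> \<theta>l"
    by (rule half_plane[OF True x(2)], rule that, blast+)
  show ?thesis
  proof (rule that[OF r(1)])
    fix y1 y2 assume y: "y1 \<in> N x r" "y2 \<in> N x r"
    define s where "s = snd x"
    have ys: "snd y1 = s" "snd y2 = s" using y True by (auto simp: N_def s_def)
    have side: "if s then 0 \<le> Im (H (fst y)) else Im (H (fst y)) \<le> 0" if "y \<in> N x r" for y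
    proof -
      have f: "fst y \<in> R" "dist (fst y) (fst x) < r" "fst y \<notin> S \<Longrightarrow> s = tilde_side ps c (fst y)"
        using that True by (auto simp: N_def cut_domain_iff s_def)
      show ?thesis
      proof (cases s)
        case True
        then have "\<not> Im (H (fst y)) < 0" using r(5)[OF f(1,2)] f(3) by blast
        then show ?thesis using True by simp
      next
        case False
        then have "\<not> 0 < Im (H (fst y))" using r(4)[OF f(1,2)] f(3) by blast
        then show ?thesis using False by simp
      qed
    qed
    have "(z, s) \<in> D" if z: "z \<in> closed_segment (fst y1) (fst y2)" for z
    proof -
      have "fst y1 \<in> ball (fst x) r \<inter> R" "fst y2 \<in> ball (fst x) r \<inter> R"
        using y by (simp_all add: N_def dist_commute cut_domain_iff)
      moreover have "convex (ball (fst x) r \<inter> R)" by (intro convex_Int convex_ball rectangle_props)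
      ultimately have "closed_segment (fst y1) (fst y2) \<subseteq> ball (fst x) r \<inter> R" by (rule closed_segment_subset)
      then have zr: "z \<in> R" "dist z (fst x) < r" using z by (auto simp: dist_commute)
      obtain u where u: "0 \<le> u" "u \<le> 1" "z = (1 - u) *\<^sub>R fst y1 + u *\<^sub>R fst y2" using z by (auto simp: in_segment)
      have im: "Im (H z) = (1 - u) * Im (H (fst y1)) + u * Im (H (fst y2))" unfolding u(3) H_convex by simp
      have "if s then 0 \<le> Im (H z) else Im (H z) \<le> 0"
        using side[OF y(1)] side[OF y(2)] u(1,2) unfolding im
        by (cases s) (simp_all add: add_nonneg_nonneg add_nonpos_nonpos mult_nonneg_nonneg mult_nonneg_nonpos)
      then have "z \<notin> S \<Longrightarrow> s = tilde_side ps c z"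
        using r(3)[OF zr] r(4)[OF zr] r(5)[OF zr] by (cases "Im (H z) = 0") (auto split: if_splits)
      then show ?thesis using zr r(2)[OF zr] by (simp add: cut_domain_iff)
    qed
    then show "visible y1 y2 \<or> (fst x \<notin> S \<and> closed_segment (fst y1) (fst y2) \<inter> inside P \<noteq> {})"
      using visible_const_flag[OF ys] by blast
  qed
qed

text \<open>
  Unlike \<open>shortcut\<close> this also holds at \<open>b\<close>, because the inside of the polygon
  is conical at every point.
\<close>

lemma visible_neighbourhood:
  assumes x: "x \<in> D"
  obtains r where "r > 0" "\<And>y. y \<in> N x r \<Longrightarrow> visible x y"
proof -
  obtain r2 where r2: "r2 > 0" "\<And>w \<tau>. dist w (fst x) < r2 \<Longrightarrow> 0 < \<tau> \<Longrightarrow> \<tau> \<le> 1 \<Longrightarrow>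
     (fst x + \<tau> *\<^sub>R (w - fst x) \<in> inside P \<longleftrightarrow> w \<in> inside P)" using radial_inside[of "fst x"] unfolding radial_at_def by blast
  have avoid: "z \<notin> inside P" if zc: "z \<in> closed_segment (fst x) (fst y)" and yN: "y \<in> N x r2" for z y
  proof -
    obtain u where u: "0 \<le> u" "u \<le> 1" and zu: "z = (1 - u) *\<^sub>R fst x + u *\<^sub>R fst y"
      using zc by (auto simp: in_segment)
    have u3: "z = fst x + u *\<^sub>R (fst y - fst x)" unfolding zu by (simp add: algebra_simps)
    show ?thesis
    proof (cases "u = 0")
      case True then show ?thesis using u3 x by (simp add: cut_domain_iff)
    next
      case False then show ?thesis using u u3 yN r2(2)[of "fst y" u] by (simp add: N_def cut_domain_iff)
    qed
  qed
  show ?thesis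
  proof (cases "fst x \<in> S")
    case False
    obtain r where r: "r > 0" "ball (fst x) r \<inter> S = {}" by (rule ball_off_slit[OF False], rule that, blast+)
    show ?thesis
    proof (rule that[of "min r r2"])
      fix y assume y: "y \<in> N x (min r r2)"
      have "closed_segment (fst x) (fst y) \<subseteq> ball (fst x) r"
        using r y by (intro closed_segment_subset) (auto simp: N_def dist_commute)
      then show "visible x y" using y r avoid[of _ y] x N_mono[of "min r r2" r2 x]
        by (intro visible_off_slit) (auto simp: N_def)
    qed (use r r2 in auto)
  next
    case True
    show ?thesis
    proof (cases "fst x = b")
      case False
      obtain r where r: "r > 0" "\<And>y1 y2. y1 \<in> N x r \<Longrightarrow> y2 \<in> N x r \<Longrightarrow> visible y1 y2 \<or>
         (fst x \<notin> S \<and> closed_segment (fst y1) (fst y2) \<inter> inside P \<noteq> {})" by (rule shortcut[OF x False], rule that, blast+)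
      then show ?thesis using that[of r] True N_self[OF x r(1)] by blast
    next
      case xb: True
      show ?thesis
      proof (rule that[OF r2(1)])
        fix y assume y: "y \<in> N x r2"
        then have ys: "snd y = snd x" and yD: "y \<in> D" using True by (auto simp: N_def)
        show "visible x y"
        proof (rule visible_const_flag[OF refl ys])
          fix z assume z: "z \<in> closed_segment (fst x) (fst y)"
          have "closed_segment (fst x) (fst y) \<subseteq> R"
            using x yD rectangle_props by (intro closed_segment_subset) (auto simp: cut_domain_iff)
          moreover have "z \<notin> S \<Longrightarrow> snd x = tilde_side ps c z"
          proof -
            assume zS: "z \<notin> S"
            obtain u where u: "0 \<le> u" "u \<le> 1" "z = (1 - u) *\<^sub>R b + u *\<^sub>R fst y" using z xb by (auto simp: in_segment)
            have "closed_segment b (fst y) \<subseteq> S" if "fst y \<in> S"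
              using that b_slit unfolding slit_def by (simp add: closed_segment_subset)
            then have yS: "fst y \<notin> S" using zS z xb by auto
            have "u \<noteq> 0" using u zS b_slit by auto
            then have "H z = of_real u * H (fst y)" unfolding u(3) H_convex by (simp add: scaleR_conv_of_real)
            then have "turn ps c z = turn ps c (fst y)" using u \<open>u \<noteq> 0\<close> by (simp add: turn_H)
            then show ?thesis using ys yS yD by (simp add: tilde_side_iff cut_domain_iff)
          qed
          ultimately show "(z, snd x) \<in> D" using z avoid[OF z y] by (auto simp: cut_domain_iff)
        qed
      qed
    qed
  qed
qed

lemma visible_D: "visible x y \<Longrightarrow> x \<in> D \<and> y \<in> D" unfolding visible_def seg_def by force

lemma seg_sub:
  assumes "seg x y g" "a \<in> {0..1}" "e \<in> {0..1}" shows "seg (g a) (g e) (g \<circ> linepath a e)"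
proof -
  have l: "linepath a e t \<in> {0..1}" if "t \<in> {0..1}" for t
    using that assms linepath_in_path[of t a e] closed_segment_subset[of a "{0..1}" e] by auto
  have "ncont (g \<circ> linepath a e) {0..1}"
    by (rule ncont_compose[of g "{0..1}"]) (use assms l in \<open>auto simp: seg_def intro!: continuous_intros\<close>)
  moreover have "linepath (fst x) (fst y) (linepath a e t) = linepath (linepath (fst x) (fst y) a) (linepath (fst x) (fst y) e) t" for t
    by (simp add: linepath_def algebra_simps)
  ultimately show ?thesis using assms l unfolding seg_def by (auto simp: linepath_0' linepath_1')
qed

lemma visible_sub: "seg x y g \<Longrightarrow> a \<in> {0..1} \<Longrightarrow> e \<in> {0..1} \<Longrightarrow> visible (g a) (g e)"
  unfolding visible_def by (rule exI, rule seg_sub)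

lemma visible_sym: "visible x y \<Longrightarrow> visible y x"
proof -
  assume "visible x y"
  then obtain g where g: "seg x y g" unfolding visible_def ..
  then have "g 0 = x" "g 1 = y" by (simp_all add: seg_def)
  then show "visible y x" using visible_sub[OF g, of 1 0] by simp
qed

lemma visible_refl: "x \<in> D \<Longrightarrow> visible x x"
  by (rule visible_const_flag[of x "snd x"]) simp_all

section \<open>The length metric\<close>

text \<open>
  Lengths of polygonal paths in the slit domain. Their infimum \<open>d\<close> is the length metric;
  the distance of linked points is the length of the shortest paths between them.
\<close>

inductive chain :: "dpoint \<Rightarrow> dpoint \<Rightarrow> real \<Rightarrow> bool" where
  chain_refl: "x \<in> D \<Longrightarrow> chain x x 0"
| chain_step: "visible x y \<Longrightarrow> chain y z l \<Longrightarrow> chain x z (dist (fst x) (fst y) + l)"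

definition linked :: "dpoint \<Rightarrow> dpoint \<Rightarrow> bool" where "linked x y \<longleftrightarrow> (\<exists>l. chain x y l)"

definition d :: "dpoint \<Rightarrow> dpoint \<Rightarrow> real" where "d x y = Inf {l. chain x y l}"

lemma chain_D: "chain x y l \<Longrightarrow> x \<in> D \<and> y \<in> D"
  by (induction rule: chain.induct) (auto dest: visible_D)

lemma chain_dist: "chain x y l \<Longrightarrow> dist (fst x) (fst y) \<le> l"
proof (induction rule: chain.induct)
  case (chain_step x y z l)
  then show ?case using dist_triangle[of "fst x" "fst z" "fst y"] by simp
qed simp

lemma chain_nonneg: "chain x y l \<Longrightarrow> 0 \<le> l"
  using chain_dist zero_le_dist order_trans by blast

lemma chain_trans: "chain x y l \<Longrightarrow> chain y z k \<Longrightarrow> chain x z (l + k)"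
proof (induction rule: chain.induct)
  case (chain_step x y w l)
  then show ?case using chain.chain_step[of x y z "l + k"] by (simp add: add.assoc)
qed simp

lemma visible_chain: "visible x y \<Longrightarrow> chain x y (dist (fst x) (fst y))"
  using chain_step[of x y y 0] chain_refl[of y] visible_D[of x y] by simp

lemma chain_sym: "chain x y l \<Longrightarrow> chain y x l"
proof (induction rule: chain.induct)
  case (chain_refl x) then show ?case by (rule chain.chain_refl)
next
  case (chain_step x y z l)
  have "chain y x (dist (fst y) (fst x))" using visible_chain visible_sym chain_step by blast
  then have "chain z x (l + dist (fst y) (fst x))" using chain_trans[of z y l x] chain_step by blast
  then show ?case by (metis add.commute dist_commute)
qed

lemma chain_split:
  "chain x y l \<Longrightarrow> 0 \<le> s \<Longrightarrow> s \<le> l \<Longrightarrow> \<exists>z. chain x z s \<and> chain z y (l - s)"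
proof (induction arbitrary: s rule: chain.induct)
  case (chain_refl x) then show ?case using chain.chain_refl[of x] by (intro exI[of _ x]) auto
next
  case (chain_step x y w l)
  let ?k = "dist (fst x) (fst y)"
  show ?case
  proof (cases "s \<le> ?k")
    case False
    then obtain z where "chain y z (s - ?k)" "chain z w (l - (s - ?k))"
      using chain_step.IH[of "s - ?k"] chain_step.prems by auto
    then show ?thesis using chain.chain_step[OF chain_step.hyps(1), of z "s - ?k"]
      by (intro exI[of _ z]) (simp add: algebra_simps)
  next
    case True
    obtain g where g: "seg x y g" using chain_step.hyps unfolding visible_def by blast
    define u where "u = (if ?k = 0 then 0 else s / ?k)"
    have u: "u \<in> {0..1}" "u * ?k = s" using True chain_step.prems by (auto simp: u_def)
    have ends: "g 0 = x" "g 1 = y" and fu: "fst (g u) = linepath (fst x) (fst y) u" using g u by (auto simp: seg_def)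
    have "dist (fst x) (fst (g u)) = s" unfolding fu
      using u by (simp add: dist_norm linepath_def algebra_simps flip: scaleR_diff_right)
    moreover have "visible x (g u)" using visible_sub[OF g, of 0 u] u ends by simp
    ultimately have a: "chain x (g u) s" using visible_chain by metis
    have "fst (g u) - fst y = (1 - u) *\<^sub>R (fst x - fst y)" unfolding fu by (simp add: linepath_def algebra_simps)
    then have "dist (fst (g u)) (fst y) = (1 - u) * ?k" using u by (simp add: dist_norm)
    also have "\<dots> = ?k - s" using u by (simp add: algebra_simps)
    finally have "dist (fst (g u)) (fst y) = ?k - s" .
    moreover have "visible (g u) y" using visible_sub[OF g, of u 1] u ends by simp
    ultimately have "chain (g u) w (?k - s + l)" using chain.chain_step[OF _ chain_step.hyps(2), of "g u"] by simp
    then show ?thesis using a by (intro exI[of _ "g u"]) (simp add: algebra_simps)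
  qed
qed

lemma linked_D: "linked x y \<Longrightarrow> x \<in> D \<and> y \<in> D" unfolding linked_def using chain_D by blast

lemma linked_sym: "linked x y \<Longrightarrow> linked y x" unfolding linked_def using chain_sym by blast

lemma linked_trans: "linked x y \<Longrightarrow> linked y z \<Longrightarrow> linked x z" unfolding linked_def using chain_trans by blast

lemma linked_refl: "x \<in> D \<Longrightarrow> linked x x" unfolding linked_def using chain_refl by blast

lemma visible_linked: "visible x y \<Longrightarrow> linked x y" unfolding linked_def using visible_chain by blast

lemma chain_bdd: "bdd_below {l. chain x y l}" using chain_nonneg by (intro bdd_belowI[of _ 0]) auto

lemma d_le: "chain x y l \<Longrightarrow> d x y \<le> l" unfolding d_def by (rule cInf_lower[OF _ chain_bdd]) simp

lemma d_approx: assumes "linked x y" "e > 0" obtains l where "chain x y l" "l < d x y + e"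
proof -
  have "\<exists>l\<in>{l. chain x y l}. l < d x y + e"
    using cInf_less_iff[of "{l. chain x y l}" "d x y + e"] chain_bdd assms unfolding linked_def d_def by auto
  then show ?thesis using that by auto
qed

lemma d_dist: "linked x y \<Longrightarrow> dist (fst x) (fst y) \<le> d x y"
  unfolding d_def linked_def by (intro cInf_greatest) (auto dest: chain_dist)

lemma d_nonneg: "linked x y \<Longrightarrow> 0 \<le> d x y" using d_dist zero_le_dist order_trans by blast

lemma d_visible: "visible x y \<Longrightarrow> d x y = dist (fst x) (fst y)"
  using d_le[OF visible_chain] d_dist[OF visible_linked] by (simp add: antisym)

lemma d_sym: "d x y = d y x"
proof -
  have "{l. chain x y l} = {l. chain y x l}" using chain_sym by blast
  then show ?thesis by (simp add: d_def)
qed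

lemma d_tri: assumes "linked x y" "linked y z" shows "d x z \<le> d x y + d y z"
proof (rule field_le_epsilon)
  fix e :: real assume e: "0 < e"
  obtain l where l: "chain x y l" "l < d x y + e/2" by (rule d_approx[OF assms(1), of "e/2"]) (use e in auto)
  obtain k where k: "chain y z k" "k < d y z + e/2" by (rule d_approx[OF assms(2), of "e/2"]) (use e in auto)
  show "d x z \<le> d x y + d y z + e" using d_le[OF chain_trans[OF l(1) k(1)]] l k by simp
qed

lemma d_refl: "x \<in> D \<Longrightarrow> d x x = 0" using d_visible[OF visible_refl] by simp

text \<open>
  A chain of visible segments that stays close to a point of the slit does not change its flag.
\<close>

lemma d_imp_N:
  assumes "x \<in> D"
  obtains q where "q > 0" "\<And>y r. linked x y \<Longrightarrow> d x y < r \<Longrightarrow> r \<le> q \<Longrightarrow> y \<in> N x r"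
proof (cases "fst x \<in> S")
  case False
  show ?thesis
  proof (rule that[of 1])
    fix y r assume "linked x y" "d x y < r"
    then show "y \<in> N x r" using False d_dist[of x y] linked_D[of x y] by (simp add: N_def dist_commute)
  qed simp
next
  case True
  obtain q where q: "q > 0" "\<And>y. y \<in> D \<Longrightarrow> dist (fst y) (fst x) < q \<Longrightarrow> \<exists>\<delta>>0. \<forall>y'\<in>N y \<delta>. snd y' = snd y"
    by (rule flag_locally_const[OF True], rule that, blast+)
  have key: "chain w y l \<Longrightarrow> dist (fst w) (fst x) + l < r \<Longrightarrow> r \<le> q \<Longrightarrow> snd w = snd x \<Longrightarrow> y \<in> N x r" for w y l r
  proof (induction rule: chain.induct)
    case (chain_refl w) then show ?case by (simp add: N_def)
  next
    case (chain_step w w' y l)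
    obtain g where g: "seg w w' g" using chain_step.hyps unfolding visible_def by blast
    have gn: "g t \<in> D" "dist (fst (g t)) (fst x) < q" if t: "t \<in> {0..1}" for t
    proof -
      show "g t \<in> D" using g t by (simp add: seg_def)
      have "fst (g t) = linepath (fst w) (fst w') t" using g t by (simp add: seg_def)
      then have "fst (g t) - fst w = t *\<^sub>R (fst w' - fst w)" by (simp add: linepath_def algebra_simps)
      then have "dist (fst (g t)) (fst w) = t * dist (fst w) (fst w')" using t by (simp add: dist_norm norm_minus_commute)
      also have "\<dots> \<le> 1 * dist (fst w) (fst w')" using t by (intro mult_right_mono) auto
      finally have "dist (fst (g t)) (fst x) \<le> dist (fst w) (fst w') + dist (fst w) (fst x)"
        using dist_triangle[of "fst (g t)" "fst x" "fst w"] by simp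
      then show "dist (fst (g t)) (fst x) < q" using chain_step.prems chain_nonneg[OF chain_step.hyps(2)] by simp
    qed
    have nc: "ncont g {0..1}" and ends: "g 0 = w" "g 1 = w'" using g by (auto simp: seg_def)
    have "snd (g 0) = snd (g 1)" by (rule ncont_flag_const[OF nc]) (use gn q in auto)
    then have "snd w' = snd x" using ends chain_step.prems by simp
    moreover have "dist (fst w') (fst x) + l < r"
      using chain_step.prems dist_triangle[of "fst w'" "fst x" "fst w"] by (simp add: dist_commute)
    ultimately show ?case using chain_step.IH chain_step.prems by blast
  qed
  show ?thesis
  proof (rule that[OF q(1)])
    fix y r assume h: "linked x y" "d x y < r" "r \<le> q"
    obtain l where "chain x y l" "l < d x y + (r - d x y)" by (rule d_approx[OF h(1), of "r - d x y"]) (use h in auto)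
    then show "y \<in> N x r" using key[of x y l r] h by simp
  qed
qed

lemma d_zero: assumes "linked x y" "d x y = 0" shows "x = y"
proof -
  have D: "x \<in> D" "y \<in> D" using linked_D[OF assms(1)] by auto
  obtain q where "q > 0" "\<And>y r. linked x y \<Longrightarrow> d x y < r \<Longrightarrow> r \<le> q \<Longrightarrow> y \<in> N x r"
    by (rule d_imp_N[OF D(1)], rule that, blast+)
  then have "y \<in> N x q" using assms by simp
  moreover have "fst x = fst y" using d_dist[OF assms(1)] assms(2) by simp
  ultimately show ?thesis using D by (intro dpoint_eqI) (auto simp: N_def)
qed

lemma N_imp_d:
  assumes "x \<in> D"
  obtains r where "r > 0" "\<And>y. y \<in> N x r \<Longrightarrow> linked x y \<and> d x y = dist (fst x) (fst y)"
proof -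
  obtain r where "r > 0" "\<And>y. y \<in> N x r \<Longrightarrow> visible x y" by (rule visible_neighbourhood[OF assms], rule that, blast+)
  then show ?thesis using that[of r] visible_linked d_visible by blast
qed

lemma domain_compact:
  fixes f :: "nat \<Rightarrow> dpoint"
  assumes f: "\<And>n. f n \<in> D"
  obtains l r where "l \<in> D" "strict_mono (r :: nat \<Rightarrow> nat)" "\<And>e. e > 0 \<Longrightarrow> \<forall>\<^sub>F n in sequentially. f (r n) \<in> N l e"
proof -
  have "compact (R - inside P)" using rectangle_props(1) jordan(1) by (rule compact_diff)
  moreover have "fst (f n) \<in> R - inside P" for n using f[of n] by (auto simp: cut_domain_iff)
  ultimately obtain z r where z: "z \<in> R - inside P" "strict_mono r" "((\<lambda>n. fst (f n)) \<circ> r) \<longlonglongrightarrow> z"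
    using seq_compactE[of "R - inside P" "\<lambda>n. fst (f n)"] compact_imp_seq_compact by metis
  obtain s where s: "infinite {n. snd (f (r n)) = s}"
  proof -
    have "UNIV = {n. snd (f (r n)) = True} \<union> {n. snd (f (r n)) = False}" by auto
    then have "infinite {n. snd (f (r n)) = True} \<or> infinite {n. snd (f (r n)) = False}"
      by (metis finite_UnI infinite_UNIV_nat)
    then show ?thesis using that by blast
  qed
  obtain k where k: "strict_mono (k :: nat \<Rightarrow> nat)" "\<And>n. snd (f (r (k n))) = s"
    using infinite_enumerate[OF s] by auto
  have lim: "(\<lambda>n. fst (f (r (k n)))) \<longlonglongrightarrow> z" using LIMSEQ_subseq_LIMSEQ[OF z(3) k(1)] by (simp add: o_def)
  define l where "l = (z, if z \<in> S then s else tilde_side ps c z)"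
  show ?thesis
  proof (rule that[of l "\<lambda>n. r (k n)"])
    show "l \<in> D" using z(1) by (simp add: l_def cut_domain_iff)
    show "strict_mono (\<lambda>n. r (k n))" using strict_mono_o[OF z(2) k(1)] by (simp add: o_def)
    fix e :: real assume "e > 0"
    then have "\<forall>\<^sub>F n in sequentially. dist (fst (f (r (k n)))) z < e" using lim unfolding tendsto_iff by blast
    then show "\<forall>\<^sub>F n in sequentially. f (r (k n)) \<in> N l e"
      by (rule eventually_mono) (use f k(2) in \<open>auto simp: N_def l_def\<close>)
  qed
qed

text \<open>
  An isometric embedding of an interval for the length metric: a path parametrized by arc length that is
  shortest between any two of its points.
\<close>

definition geodesic :: "(real \<Rightarrow> dpoint) \<Rightarrow> real \<Rightarrow> bool" where
  "geodesic \<sigma> L \<longleftrightarrow> 0 \<le> L \<and> (\<forall>s\<in>{0..L}. \<forall>t\<in>{0..L}. linked (\<sigma> s) (\<sigma> t) \<and> d (\<sigma> s) (\<sigma> t) = \<bar>s - t\<bar>)"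

lemma geodesic_exists:
  assumes xy: "linked x y"
  obtains \<sigma> where "geodesic \<sigma> (d x y)" "\<sigma> 0 = x" "\<sigma> (d x y) = y"
proof -
  define M where "M = {z. linked x z}"
  have lk: "linked p q" if "p \<in> M" "q \<in> M" for p q using that linked_sym linked_trans unfolding M_def by blast
  obtain \<sigma> where \<sigma>: "\<sigma> 0 = x" "\<sigma> (d x y) = y" "\<And>s. s \<in> {0..d x y} \<Longrightarrow> \<sigma> s \<in> M"
    "\<And>s t. s \<in> {0..d x y} \<Longrightarrow> t \<in> {0..d x y} \<Longrightarrow> d (\<sigma> s) (\<sigma> t) = \<bar>s - t\<bar>"
  proof (rule metric_geodesic_exists[of M d x y])
    show "0 \<le> d p q" if "p \<in> M" "q \<in> M" for p q using lk[OF that] d_nonneg by blast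
    show "d p q = d q p" for p q by (rule d_sym)
    show "d p r \<le> d p q + d q r" if "p \<in> M" "q \<in> M" "r \<in> M" for p q r
      using lk[OF that(1,2)] lk[OF that(2,3)] d_tri by blast
    show "d p q = 0 \<longleftrightarrow> p = q" if "p \<in> M" "q \<in> M" for p q
    proof
      show "d p q = 0 \<Longrightarrow> p = q" using lk[OF that] d_zero by blast
      show "p = q \<Longrightarrow> d p q = 0" using d_refl[of q] linked_D[OF lk[OF that]] by simp
    qed
    show "x \<in> M" "y \<in> M" using linked_D[OF xy] linked_refl xy by (auto simp: M_def)
    show "\<exists>l\<in>M. \<exists>r. strict_mono r \<and> (\<lambda>n. d (f (r n)) l) \<longlonglongrightarrow> 0" if f: "\<And>n. f n \<in> M" for f :: "nat \<Rightarrow> dpoint"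
    proof -
      have fD: "f n \<in> D" for n using f linked_D unfolding M_def by blast
      obtain l r where l: "l \<in> D" "strict_mono (r :: nat \<Rightarrow> nat)"
        "\<And>e. e > 0 \<Longrightarrow> \<forall>\<^sub>F n in sequentially. f (r n) \<in> N l e" by (rule domain_compact[of f, OF fD], rule that, blast+)
      obtain q where q: "q > 0" "\<And>y. y \<in> N l q \<Longrightarrow> linked l y \<and> d l y = dist (fst l) (fst y)"
        by (rule N_imp_d[OF l(1)], rule that, blast+)
      have "\<exists>n. f (r n) \<in> N l q" using l(3)[OF q(1)] eventually_happens sequentially_bot by blast
      then obtain n where "linked l (f (r n))" using q(2) by blast
      then have "l \<in> M" using f[of "r n"] linked_sym linked_trans unfolding M_def by blast
      moreover have "(\<lambda>n. d (f (r n)) l) \<longlonglongrightarrow> 0"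
      proof (rule tendstoI)
        fix e :: real assume e: "e > 0"
        have "\<forall>\<^sub>F n in sequentially. f (r n) \<in> N l (min q e)" using l(3)[of "min q e"] q e by simp
        then show "\<forall>\<^sub>F n in sequentially. dist (d (f (r n)) l) 0 < e"
        proof (rule eventually_mono)
          fix n assume h: "f (r n) \<in> N l (min q e)"
          then have "f (r n) \<in> N l q" by (simp add: N_def)
          then have "d (f (r n)) l = dist (fst l) (fst (f (r n)))" using q(2) d_sym by metis
          then show "dist (d (f (r n)) l) 0 < e" using h by (simp add: N_def dist_commute)
        qed
      qed
      ultimately show ?thesis using l(2) by (intro bexI[of _ l] exI[of _ r] conjI)
    qed
    show "\<exists>z\<in>M. d p z \<le> s + e \<and> d z q \<le> d p q - s + e"
      if h: "p \<in> M" "q \<in> M" "0 \<le> s" "s \<le> d p q" "0 < e" for p q s e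
    proof -
      obtain l where l: "chain p q l" "l < d p q + e" by (rule d_approx[OF lk[OF h(1,2)] h(5)], rule that, blast+)
      obtain z where z: "chain p z s" "chain z q (l - s)"
        using chain_split[OF l(1) h(3)] d_le[OF l(1)] h(4) by auto
      have "z \<in> M" using h(1) z(1) linked_trans unfolding M_def linked_def[of p] by (auto simp: linked_def)
         (meson chain_trans)
      then show ?thesis using d_le[OF z(1)] d_le[OF z(2)] l h by (intro bexI[of _ z]) auto
    qed
  next
    fix \<sigma> assume h: "\<sigma> 0 = x" "\<sigma> (d x y) = y" "\<And>s. s \<in> {0..d x y} \<Longrightarrow> \<sigma> s \<in> M"
      "\<And>s t. s \<in> {0..d x y} \<Longrightarrow> t \<in> {0..d x y} \<Longrightarrow> d (\<sigma> s) (\<sigma> t) = \<bar>s - t\<bar>"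
    show thesis by (rule that[OF h(1,2)]) (simp_all only: h(3,4))
  qed
  have "geodesic \<sigma> (d x y)" unfolding geodesic_def using \<sigma>(3,4) lk d_nonneg[OF xy] by blast
  then show ?thesis using that \<sigma>(1,2) by blast
qed

lemma geodesic_D: "geodesic \<sigma> L \<Longrightarrow> t \<in> {0..L} \<Longrightarrow> \<sigma> t \<in> D" unfolding geodesic_def using linked_D by blast

lemma geodesic_d: "geodesic \<sigma> L \<Longrightarrow> s \<in> {0..L} \<Longrightarrow> t \<in> {0..L} \<Longrightarrow> d (\<sigma> s) (\<sigma> t) = \<bar>s - t\<bar>" unfolding geodesic_def by blast

lemma geodesic_linked: "geodesic \<sigma> L \<Longrightarrow> s \<in> {0..L} \<Longrightarrow> t \<in> {0..L} \<Longrightarrow> linked (\<sigma> s) (\<sigma> t)" unfolding geodesic_def by blast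

lemma geodesic_dist: "geodesic \<sigma> L \<Longrightarrow> s \<in> {0..L} \<Longrightarrow> t \<in> {0..L} \<Longrightarrow> dist (fst (\<sigma> s)) (fst (\<sigma> t)) \<le> \<bar>s - t\<bar>"
  using geodesic_d geodesic_linked d_dist by metis

lemma geodesic_rev: "geodesic \<sigma> L \<Longrightarrow> geodesic (\<lambda>t. \<sigma> (L - t)) L"
  unfolding geodesic_def by (auto simp: abs_minus_commute)

lemma geodesic_sub: "geodesic \<sigma> L \<Longrightarrow> 0 \<le> a \<Longrightarrow> a \<le> e \<Longrightarrow> e \<le> L \<Longrightarrow> geodesic (\<lambda>t. \<sigma> (a + t)) (e - a)"
  unfolding geodesic_def by auto

lemma geodesic_ncont: assumes g: "geodesic \<sigma> L" shows "ncont \<sigma> {0..L}"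
  unfolding ncont_def
proof (intro ballI allI impI)
  fix t r :: real assume t: "t \<in> {0..L}" and r: "0 < r"
  obtain q where q: "q > 0" "\<And>y r. linked (\<sigma> t) y \<Longrightarrow> d (\<sigma> t) y < r \<Longrightarrow> r \<le> q \<Longrightarrow> y \<in> N (\<sigma> t) r"
    by (rule d_imp_N[OF geodesic_D[OF g t]], rule that, blast+)
  show "\<exists>\<delta>>0. \<forall>t'\<in>{0..L}. \<bar>t' - t\<bar> < \<delta> \<longrightarrow> \<sigma> t' \<in> N (\<sigma> t) r"
  proof (intro exI[of _ "min q r"] conjI ballI impI)
    fix t' assume t': "t' \<in> {0..L}" "\<bar>t' - t\<bar> < min q r"
    have "\<sigma> t' \<in> N (\<sigma> t) (min q r)"
      using q(2)[of "\<sigma> t'" "min q r"] geodesic_linked[OF g t t'(1)] geodesic_d[OF g t t'(1)] t' by (simp add: abs_minus_commute)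
    then show "\<sigma> t' \<in> N (\<sigma> t) r" by (simp add: N_def)
  qed (use q r in auto)
qed

end

section \<open>Shortest paths are geodesics\<close>

text \<open>
  The length of the polygonal line inscribed in the curve \<open>p\<close> at the given parameters.
\<close>

fun sample_length :: "(real \<Rightarrow> complex) \<Rightarrow> real list \<Rightarrow> real" where
  "sample_length p [] = 0"
| "sample_length p [x] = 0"
| "sample_length p (x # y # ys) = dist (p x) (p y) + sample_length p (y # ys)"

lemma sample_length_nonneg: "0 \<le> sample_length p ts" by (induction p ts rule: sample_length.induct) auto

lemma sample_length_sum: "(\<Sum>i<length ts - 1. ennreal (dist (p (ts ! i)) (p (ts ! Suc i)))) = ennreal (sample_length p ts)"
proof (induction p ts rule: sample_length.induct)
  case (3 p x y ys)
  have "(\<Sum>i<length (x # y # ys) - 1. ennreal (dist (p ((x # y # ys) ! i)) (p ((x # y # ys) ! Suc i)))) =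
      ennreal (dist (p x) (p y)) + (\<Sum>i<length (y # ys) - 1. ennreal (dist (p ((y # ys) ! i)) (p ((y # ys) ! Suc i))))"
    by (simp add: sum.lessThan_Suc_shift del: sum.lessThan_Suc)
  then show ?case using 3 sample_length_nonneg[of p "y # ys"] by (simp add: ennreal_plus)
qed auto

lemma sample_length_append:
  "xs \<noteq> [] \<Longrightarrow> ys \<noteq> [] \<Longrightarrow> sample_length p (xs @ ys) = sample_length p xs + dist (p (last xs)) (p (hd ys)) + sample_length p ys"
proof (induction p xs rule: sample_length.induct)
  case (2 p x) then show ?case by (cases ys) auto
qed auto

lemma curve_length_sample_length: "curve_length p = (SUP ts \<in> {ts. sorted ts \<and> set ts \<subseteq> {0..1}}. ennreal (sample_length p ts))"
  by (simp only: curve_length_def sample_length_sum)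

lemma curve_length_ge: "sorted ts \<Longrightarrow> set ts \<subseteq> {0..1} \<Longrightarrow> ennreal (sample_length p ts) \<le> curve_length p"
  unfolding curve_length_sample_length by (rule SUP_upper[of ts _ "\<lambda>ts. ennreal (sample_length p ts)"]) simp

lemma curve_length_le: "(\<And>ts. sorted ts \<Longrightarrow> set ts \<subseteq> {0..1} \<Longrightarrow> sample_length p ts \<le> L) \<Longrightarrow> curve_length p \<le> ennreal L"
  unfolding curve_length_sample_length by (rule SUP_least) (simp add: ennreal_leI)

lemma sample_length_lipschitz:
  assumes "\<And>s t. s \<in> {0..1} \<Longrightarrow> t \<in> {0..1} \<Longrightarrow> s \<le> t \<Longrightarrow> dist (p s) (p t) \<le> L * (t - s)" and L: "0 \<le> L"
  shows "sorted ts \<Longrightarrow> set ts \<subseteq> {0..1} \<Longrightarrow> ts \<noteq> [] \<Longrightarrow> sample_length p ts \<le> L * (last ts - hd ts)"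
  using assms(1)
proof (induction p ts rule: sample_length.induct)
  case (3 p x y ys)
  have "sample_length p (y # ys) \<le> L * (last (y # ys) - y)" using 3 by simp
  moreover have "dist (p x) (p y) \<le> L * (y - x)" using 3 by simp
  ultimately show ?case by (simp add: algebra_simps)
qed auto

context slit_domain begin

text \<open>
  By the Bolzano principle it suffices to treat short parameter intervals, and there the points of the
  path are visible from one of them.
\<close>

lemma inscribed_chain:
  assumes g: "ncont g {0..1}" "\<And>t. t \<in> {0..1} \<Longrightarrow> g t \<in> D" and st: "0 \<le> s" "s \<le> t" "t \<le> 1"
  shows "\<exists>ts. sorted ts \<and> ts \<noteq> [] \<and> hd ts = s \<and> last ts = t \<and> set ts \<subseteq> {s..t} \<and>
    linked (g s) (g t) \<and> d (g s) (g t) \<le> sample_length (\<lambda>u. fst (g u)) ts"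
proof -
  define p where "p u = fst (g u)" for u
  define Q where "Q s t \<longleftrightarrow> (0 \<le> s \<longrightarrow> s \<le> t \<longrightarrow> t \<le> 1 \<longrightarrow> (\<exists>ts. sorted ts \<and> ts \<noteq> [] \<and> hd ts = s \<and> last ts = t \<and> set ts \<subseteq> {s..t} \<and>
    linked (g s) (g t) \<and> d (g s) (g t) \<le> sample_length p ts))" for s t
  have "Q s t"
  proof (rule Bolzano[OF st(2)])
    fix u v w assume h: "Q u v" "Q v w" "u \<le> v" "v \<le> w"
    show "Q u w" unfolding Q_def
    proof (intro impI)
      assume k: "0 \<le> u" "u \<le> w" "w \<le> 1"
      obtain xs where xs: "sorted xs" "xs \<noteq> []" "hd xs = u" "last xs = v" "set xs \<subseteq> {u..v}"
        "linked (g u) (g v)" "d (g u) (g v) \<le> sample_length p xs" using h k unfolding Q_def by auto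
      obtain ys where ys: "sorted ys" "ys \<noteq> []" "hd ys = v" "last ys = w" "set ys \<subseteq> {v..w}"
        "linked (g v) (g w)" "d (g v) (g w) \<le> sample_length p ys" using h k unfolding Q_def by auto
      have "sorted (xs @ ys)" using xs ys unfolding sorted_append by force
      moreover have "sample_length p (xs @ ys) = sample_length p xs + sample_length p ys" using sample_length_append xs ys by simp
      then have "d (g u) (g w) \<le> sample_length p (xs @ ys)" using d_tri[OF xs(6) ys(6)] xs ys by simp
      moreover have "linked (g u) (g w)" using linked_trans xs ys by blast
      moreover have "set (xs @ ys) \<subseteq> {u..w}" using xs ys h by force
      ultimately show "\<exists>ts. sorted ts \<and> ts \<noteq> [] \<and> hd ts = u \<and> last ts = w \<and> set ts \<subseteq> {u..w} \<and>
        linked (g u) (g w) \<and> d (g u) (g w) \<le> sample_length p ts" using xs ys by (intro exI[of _ "xs @ ys"]) simp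
    qed
  next
    fix x assume x: "s \<le> x" "x \<le> t"
    then have x01: "x \<in> {0..1}" using st by simp
    obtain r where r: "r > 0" "\<And>y. y \<in> N (g x) r \<Longrightarrow> linked (g x) y \<and> d (g x) y = dist (fst (g x)) (fst y)"
      by (rule N_imp_d[OF g(2)[OF x01]], rule that, blast+)
    obtain e where e: "e > 0" "\<forall>t'\<in>{0..1}. \<bar>t' - x\<bar> < e \<longrightarrow> g t' \<in> N (g x) r"
      using g(1) x01 r(1) unfolding ncont_def by blast
    show "\<exists>d>0. \<forall>a b. a \<le> x \<and> x \<le> b \<and> b - a < d \<longrightarrow> Q a b"
    proof (intro exI[of _ e] conjI allI impI e(1))
      fix a b assume ab: "a \<le> x \<and> x \<le> b \<and> b - a < e"
      show "Q a b" unfolding Q_def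
      proof (intro impI)
        assume k: "0 \<le> a" "a \<le> b" "b \<le> 1"
        have "g a \<in> N (g x) r" "g b \<in> N (g x) r" using e(2) ab k by auto
        then have "linked (g x) (g a)" "d (g x) (g a) = dist (p x) (p a)" "linked (g x) (g b)" "d (g x) (g b) = dist (p x) (p b)"
          using r(2) by (auto simp: p_def)
        then show "\<exists>ts. sorted ts \<and> ts \<noteq> [] \<and> hd ts = a \<and> last ts = b \<and> set ts \<subseteq> {a..b} \<and>
          linked (g a) (g b) \<and> d (g a) (g b) \<le> sample_length p ts"
          using ab d_tri[of "g a" "g x" "g b"] linked_sym[of "g x" "g a"] linked_trans[of "g a" "g x" "g b"] d_sym[of "g a" "g x"]
          by (intro exI[of _ "[a, x, b]"]) (simp add: dist_commute)
      qed
    qed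
  qed
  then show ?thesis using st unfolding Q_def p_def by blast
qed

lemma path_length_ge_d:
  assumes "joins ps R c g x y" "0 \<le> s" "s \<le> t" "t \<le> 1"
  shows "linked x (g s)" "linked (g s) (g t)" "linked (g t) y"
    "ennreal (d x (g s) + d (g s) (g t) + d (g t) y) \<le> path_length g"
proof -
  have g: "ncont g {0..1}" "\<And>t. t \<in> {0..1} \<Longrightarrow> g t \<in> D" "g 0 = x" "g 1 = y"
    using assms(1) unfolding joins_def pathin_iff by auto
  obtain xs where xs: "sorted xs" "xs \<noteq> []" "hd xs = 0" "last xs = s" "set xs \<subseteq> {0..s}" "linked (g 0) (g s)" "d (g 0) (g s) \<le> sample_length (\<lambda>u. fst (g u)) xs"
    using inscribed_chain[OF g(1,2), of 0 s] assms by auto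
  obtain ys where ys: "sorted ys" "ys \<noteq> []" "hd ys = s" "last ys = t" "set ys \<subseteq> {s..t}" "linked (g s) (g t)" "d (g s) (g t) \<le> sample_length (\<lambda>u. fst (g u)) ys"
    using inscribed_chain[OF g(1,2), of s t] assms by auto
  obtain zs where zs: "sorted zs" "zs \<noteq> []" "hd zs = t" "last zs = 1" "set zs \<subseteq> {t..1}" "linked (g t) (g 1)" "d (g t) (g 1) \<le> sample_length (\<lambda>u. fst (g u)) zs"
    using inscribed_chain[OF g(1,2), of t 1] assms by auto
  show "linked x (g s)" "linked (g s) (g t)" "linked (g t) y" using xs ys zs g by auto
  have "sorted (xs @ ys)" using xs(1,5) ys(1,5) unfolding sorted_append by force
  moreover have set: "set (xs @ ys) \<subseteq> {0..t}" using xs(5) ys(5) assms by force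
  ultimately have "sorted ((xs @ ys) @ zs)" using zs(1,5) unfolding sorted_append[of "xs @ ys"] by force
  moreover have "set ((xs @ ys) @ zs) \<subseteq> {0..1}" using set zs(5) assms by force
  moreover have "sample_length (fst \<circ> g) ((xs @ ys) @ zs) = sample_length (fst \<circ> g) xs + sample_length (fst \<circ> g) ys + sample_length (fst \<circ> g) zs"
    using sample_length_append[of "xs @ ys" zs "fst \<circ> g"] sample_length_append[of xs ys "fst \<circ> g"] xs ys zs by simp
  ultimately have "ennreal (sample_length (fst \<circ> g) xs + sample_length (fst \<circ> g) ys + sample_length (fst \<circ> g) zs) \<le> path_length g"
    unfolding path_length_def using curve_length_ge by metis
  moreover have "d x (g s) + d (g s) (g t) + d (g t) y \<le> sample_length (fst \<circ> g) xs + sample_length (fst \<circ> g) ys + sample_length (fst \<circ> g) zs"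
    using xs ys zs g by (simp add: o_def)
  ultimately show "ennreal (d x (g s) + d (g s) (g t) + d (g t) y) \<le> path_length g"
    using ennreal_leI order_trans by blast
qed

lemma geodesic_joins:
  assumes "geodesic \<sigma> L" shows "joins ps R c (\<lambda>t. \<sigma> (L * t)) (\<sigma> 0) (\<sigma> L)" "path_length (\<lambda>t. \<sigma> (L * t)) \<le> ennreal L"
proof -
  have L: "0 \<le> L" using assms by (simp add: geodesic_def)
  have r: "L * t \<in> {0..L}" if "t \<in> {0..1}" for t using that L by (simp add: mult_left_le)
  have "ncont (\<sigma> \<circ> (\<lambda>t. L * t)) {0..1}"
    by (rule ncont_compose[OF geodesic_ncont[OF assms]]) (use r in \<open>auto intro!: continuous_intros\<close>)
  then show "joins ps R c (\<lambda>t. \<sigma> (L * t)) (\<sigma> 0) (\<sigma> L)" unfolding joins_def pathin_iff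
    using geodesic_D[OF assms r] by (simp add: o_def)
  show "path_length (\<lambda>t. \<sigma> (L * t)) \<le> ennreal L" unfolding path_length_def
  proof (rule curve_length_le)
    fix ts :: "real list" assume ts: "sorted ts" "set ts \<subseteq> {0..1}"
    show "sample_length (fst \<circ> (\<lambda>t. \<sigma> (L * t))) ts \<le> L"
    proof (cases "ts = []")
      case False
      have "sample_length (fst \<circ> (\<lambda>t. \<sigma> (L * t))) ts \<le> L * (last ts - hd ts)"
      proof (rule sample_length_lipschitz[OF _ L ts False])
        fix s t :: real assume h: "s \<in> {0..1}" "t \<in> {0..1}" "s \<le> t"
        have "L * s \<le> L * t" using h L by (intro mult_left_mono)
        then show "dist ((fst \<circ> (\<lambda>t. \<sigma> (L * t))) s) ((fst \<circ> (\<lambda>t. \<sigma> (L * t))) t) \<le> L * (t - s)"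
          using geodesic_dist[OF assms r[OF h(1)] r[OF h(2)]] by (simp add: algebra_simps)
      qed
      also have "\<dots> \<le> L * 1"
      proof (rule mult_left_mono[OF _ L])
        have "last ts \<in> {0..1}" "hd ts \<in> {0..1}" using ts(2) False hd_in_set last_in_set by blast+
        then show "last ts - hd ts \<le> 1" by simp
      qed
      finally show ?thesis by simp
    qed (use L in simp)
  qed
qed

lemma geodesic_is_SP:
  assumes "geodesic \<sigma> L" "\<sigma> 0 = x" "\<sigma> L = y" shows "is_SP ps R c x y (\<sigma> ` {0..L})"
proof -
  have L: "0 \<le> L" using assms by (simp add: geodesic_def)
  have "d x y = L" using geodesic_d[OF assms(1), of 0 L] L assms by simp
  have "path_length (\<lambda>t. \<sigma> (L * t)) \<le> path_length h" if "joins ps R c h x y" for h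
  proof -
    have h: "h 0 = x" "h 1 = y" using that by (auto simp: joins_def)
    have "ennreal (d x x + d x y + d y y) \<le> path_length h"
      using path_length_ge_d[OF that, of 0 1] h by simp
    moreover have "x \<in> D" "y \<in> D" using geodesic_D[OF assms(1)] L assms by auto
    ultimately have "ennreal L \<le> path_length h" using \<open>d x y = L\<close> d_refl by simp
    then show ?thesis using geodesic_joins(2)[OF assms(1)] order_trans by blast
  qed
  moreover have "(\<lambda>t. \<sigma> (L * t)) ` {0..1} = \<sigma> ` {0..L}"
  proof -
    have "(\<lambda>t. L * t) ` {0..1} = {0..L}"
    proof
      show "(\<lambda>t. L * t) ` {0..1} \<subseteq> {0..L}" using L by (auto simp: mult_left_le)
      show "{0..L} \<subseteq> (\<lambda>t. L * t) ` {0..1}"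
      proof
        fix u assume u: "u \<in> {0..L}"
        define t where "t = (if L = 0 then 0 else u / L)"
        have "u = L * t" "t \<in> {0..1}" using u L by (auto simp: t_def)
        then show "u \<in> (\<lambda>t. L * t) ` {0..1}" by blast
      qed
    qed
    then show ?thesis by (metis image_image)
  qed
  ultimately show ?thesis unfolding is_SP_def shortest_path_def
    using geodesic_joins(1)[OF assms(1)] assms by (intro exI[of _ "\<lambda>t. \<sigma> (L * t)"]) simp
qed

text \<open>
  The length of a shortest path is \<open>d x y\<close>. Hence the triangle inequality is an equality
  along the path, and the distance \<open>f\<close> from \<open>x\<close> is a parameter for which it is
  isometric. The path may rest, so \<open>f\<close> need not be injective, but it identifies only
  parameters of the same point.
\<close>

lemma is_SP_geodesic:
  assumes "is_SP ps R c x y X"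
  obtains \<sigma> where "geodesic \<sigma> (d x y)" "\<sigma> 0 = x" "\<sigma> (d x y) = y" "X = \<sigma> ` {0..d x y}"
proof -
  obtain h where h: "joins ps R c h x y" and hmin: "\<And>g. joins ps R c g x y \<Longrightarrow> path_length h \<le> path_length g"
    and X: "X = h ` {0..1}" using assms unfolding is_SP_def shortest_path_def by blast
  have h01: "h 0 = x" "h 1 = y" and hn: "ncont h {0..1}" and hD: "\<And>t. t \<in> {0..1} \<Longrightarrow> h t \<in> D"
    using h by (auto simp: joins_def pathin_iff)
  define L where "L = d x y"
  have lxy: "linked x y" using path_length_ge_d(2)[OF h, of 0 1] h01 by simp
  have L0: "0 \<le> L" using d_nonneg[OF lxy] by (simp add: L_def)
  obtain \<sigma>0 where \<sigma>0: "geodesic \<sigma>0 L" "\<sigma>0 0 = x" "\<sigma>0 L = y" unfolding L_def by (rule geodesic_exists[OF lxy])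
  have hL: "path_length h \<le> ennreal L" using hmin[of "\<lambda>t. \<sigma>0 (L * t)"] geodesic_joins[OF \<sigma>0(1)] \<sigma>0 order_trans by fastforce
  have key: "linked x (h s)" "linked (h s) (h t)" "linked (h t) y" "d x (h s) + d (h s) (h t) + d (h t) y \<le> L"
    if "0 \<le> s" "s \<le> t" "t \<le> 1" for s t
  proof -
    note P = path_length_ge_d[OF h that]
    show "linked x (h s)" "linked (h s) (h t)" "linked (h t) y" using P by auto
    have "ennreal (d x (h s) + d (h s) (h t) + d (h t) y) \<le> ennreal L" using P(4) hL order_trans by blast
    then show "d x (h s) + d (h s) (h t) + d (h t) y \<le> L" using L0 by (simp add: ennreal_le_iff)
  qed
  define f where "f t = d x (h t)" for t
  have diff: "d (h s) (h t) = f t - f s" "f t + d (h t) y = L" if st: "0 \<le> s" "s \<le> t" "t \<le> 1" for s t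
  proof -
    note K = key[OF st]
    have lt: "linked x (h t)" using linked_trans K by blast
    have "L \<le> f t + d (h t) y" unfolding L_def f_def using d_tri lt K(3) by blast
    moreover have "f t \<le> f s + d (h s) (h t)" unfolding f_def using d_tri K by blast
    ultimately show "d (h s) (h t) = f t - f s" "f t + d (h t) y = L" using K(4) by (auto simp: f_def)
  qed
  have adiff: "d (h s) (h t) = \<bar>f t - f s\<bar>" "linked (h s) (h t)" if "s \<in> {0..1}" "t \<in> {0..1}" for s t
  proof -
    have nn: "0 \<le> d (h u) (h v)" if "0 \<le> u" "u \<le> v" "v \<le> 1" for u v using d_nonneg key(2)[OF that] by blast
    consider "s \<le> t" | "t \<le> s" by linarith
    then show "d (h s) (h t) = \<bar>f t - f s\<bar>"
      using that diff(1)[of s t] diff(1)[of t s] nn[of s t] nn[of t s] d_sym[of "h s" "h t"] by cases auto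
    consider "s \<le> t" | "t \<le> s" by linarith
    then show "linked (h s) (h t)" using that key(2)[of s t] key(2)[of t s] linked_sym by cases auto
  qed
  have fc: "continuous_on {0..1} f" unfolding continuous_on_iff
  proof (intro ballI allI impI)
    fix t e :: real assume t: "t \<in> {0..1}" "0 < e"
    obtain q where q: "q > 0" "\<And>y. y \<in> N (h t) q \<Longrightarrow> linked (h t) y \<and> d (h t) y = dist (fst (h t)) (fst y)"
      by (rule N_imp_d[OF hD[OF t(1)]], rule that, blast+)
    have "0 < min q e" using q t by simp
    then obtain \<delta> where \<delta>: "\<delta> > 0" "\<forall>t'\<in>{0..1}. \<bar>t' - t\<bar> < \<delta> \<longrightarrow> h t' \<in> N (h t) (min q e)"
      using hn t(1) unfolding ncont_def by blast
    show "\<exists>\<delta>>0. \<forall>t'\<in>{0..1}. dist t' t < \<delta> \<longrightarrow> dist (f t') (f t) < e"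
    proof (intro exI[of _ \<delta>] conjI ballI impI \<delta>(1))
      fix t' assume t': "t' \<in> {0..1}" "dist t' t < \<delta>"
      then have n: "h t' \<in> N (h t) (min q e)" using \<delta>(2) by (simp add: dist_real_def)
      then have "h t' \<in> N (h t) q" by (simp add: N_def)
      then have "d (h t) (h t') = dist (fst (h t)) (fst (h t'))" using q(2) by blast
      then have "d (h t) (h t') < e" using n by (simp add: N_def dist_commute)
      then show "dist (f t') (f t) < e" using adiff(1)[OF t(1) t'(1)] by (simp add: dist_real_def)
    qed
  qed
  have f01: "f 0 = 0" "f 1 = L" using h01 d_refl hD[of 0] by (simp_all add: f_def L_def)
  have "\<exists>t\<in>{0..1}. f t = u" if "u \<in> {0..L}" for u
    using IVT'[of f 0 u 1] that f01 fc by auto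
  then obtain \<tau> where \<tau>: "\<And>u. u \<in> {0..L} \<Longrightarrow> \<tau> u \<in> {0..1} \<and> f (\<tau> u) = u" by metis
  have heq: "h s = h t" if "s \<in> {0..1}" "t \<in> {0..1}" "f s = f t" for s t
    using adiff[OF that(1,2)] that(3) d_zero by simp
  have fr: "f t \<in> {0..L}" if t: "t \<in> {0..1}" for t
  proof -
    have "0 \<le> f t" "0 \<le> d (h t) y" unfolding f_def using d_nonneg key(1)[of t t] key(3)[of t t] t by auto
    then show ?thesis using diff(2)[of t t] t by simp
  qed
  show ?thesis
  proof (rule that[of "h \<circ> \<tau>"])
    show "geodesic (h \<circ> \<tau>) (d x y)" unfolding L_def[symmetric] geodesic_def using L0 \<tau> adiff by (auto simp: abs_minus_commute)
    show "(h \<circ> \<tau>) 0 = x" using heq[of "\<tau> 0" 0] \<tau>[of 0] L0 f01 h01 by simp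
    show "(h \<circ> \<tau>) (d x y) = y" unfolding L_def[symmetric] using heq[of "\<tau> L" 1] \<tau>[of L] L0 f01 h01 by simp
    show "X = (h \<circ> \<tau>) ` {0..d x y}" unfolding L_def[symmetric]
    proof
      show "X \<subseteq> (h \<circ> \<tau>) ` {0..L}"
      proof
        fix z assume "z \<in> X"
        then obtain t where t: "t \<in> {0..1}" "z = h t" unfolding X by blast
        have "z = (h \<circ> \<tau>) (f t)" using heq[of t "\<tau> (f t)"] \<tau>[OF fr[OF t(1)]] t by simp
        then show "z \<in> (h \<circ> \<tau>) ` {0..L}" using fr[OF t(1)] by blast
      qed
      show "(h \<circ> \<tau>) ` {0..L} \<subseteq> X" unfolding X using \<tau> by auto
    qed
  qed
qed

section \<open>A logarithm on the slit domain\<close>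

definition Ncont :: "(dpoint \<Rightarrow> complex) \<Rightarrow> dpoint \<Rightarrow> bool" where
  "Ncont f x \<longleftrightarrow> (\<forall>e>0. \<exists>r>0. \<forall>y\<in>N x r. dist (f y) (f x) < e)"

lemma Ncont_planar: assumes "isCont f (fst x)" shows "Ncont (\<lambda>y. f (fst y)) x"
  unfolding Ncont_def
proof (intro allI impI)
  fix e :: real assume "0 < e"
  then obtain r where "r > 0" "\<forall>z. dist z (fst x) < r \<longrightarrow> dist (f z) (f (fst x)) < e"
    using assms unfolding continuous_at_eps_delta by blast
  then show "\<exists>r>0. \<forall>y\<in>N x r. dist (f (fst y)) (f (fst x)) < e"
    by (intro exI[of _ r]) (simp add: N_def)
qed

lemma Ncont_add: assumes "Ncont f x" "Ncont g x" shows "Ncont (\<lambda>y. f y + g y) x"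
  unfolding Ncont_def
proof (intro allI impI)
  fix e :: real assume "0 < e"
  then have "0 < e/2" by simp
  then obtain r where r: "r > 0" "\<forall>y\<in>N x r. dist (f y) (f x) < e/2" using assms(1) unfolding Ncont_def by blast
  obtain q where q: "q > 0" "\<forall>y\<in>N x q. dist (g y) (g x) < e/2"
    using assms(2) \<open>0 < e/2\<close> unfolding Ncont_def by blast
  show "\<exists>r>0. \<forall>y\<in>N x r. dist (f y + g y) (f x + g x) < e"
  proof (intro exI[of _ "min r q"] conjI ballI)
    fix y assume "y \<in> N x (min r q)"
    then have "y \<in> N x r" "y \<in> N x q" by (auto simp: N_def)
    then have "dist (f y) (f x) < e/2" "dist (g y) (g x) < e/2" using r q by auto
    then show "dist (f y + g y) (f x + g x) < e" using dist_triangle_add[of "f y" "g y" "f x" "g x"] by linarith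
  qed (use r q in auto)
qed

lemma Ncont_local:
  assumes "Ncont f x" "q > 0" "\<And>y. y \<in> N x q \<Longrightarrow> g y = f y" "x \<in> D" shows "Ncont g x"
  unfolding Ncont_def
proof (intro allI impI)
  fix e :: real assume "0 < e"
  then obtain r where r: "r > 0" "\<forall>y\<in>N x r. dist (f y) (f x) < e" using assms(1) unfolding Ncont_def by blast
  show "\<exists>r>0. \<forall>y\<in>N x r. dist (g y) (g x) < e"
  proof (intro exI[of _ "min r q"] conjI ballI)
    fix y assume "y \<in> N x (min r q)"
    then have "y \<in> N x r" "y \<in> N x q" by (auto simp: N_def)
    then show "dist (g y) (g x) < e" using r assms(3)[of y] assms(3)[of x] N_self[OF assms(4,2)] by simp
  qed (use r assms in auto)
qed

text \<open>
  The angle from the slit, which has the values \<open>0\<close> and \<open>2 * pi\<close> on its two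
  copies and is thereby continuous on the slit domain away from \<open>b\<close>.
\<close>

definition side_turn :: "dpoint \<Rightarrow> real" where
  "side_turn x = (if fst x \<in> S \<and> \<not> snd x then 2 * pi else turn ps c (fst x))"

lemma H_side_turn: "H (fst x) = of_real (norm (H (fst x))) * exp (\<i> * of_real (side_turn x))"
proof (cases "fst x \<in> S \<and> \<not> snd x")
  case True
  then have "turn ps c (fst x) = 0" by (simp add: turn_zero slit_iff)
  then have "H (fst x) = of_real (norm (H (fst x)))" using H_polar[of "norm (H (fst x))" 0] polar_H[of "fst x"] by simp
  then show ?thesis using True by (simp add: side_turn_def exp_eq_1)
next
  case False
  then show ?thesis using H_polar[of "norm (H (fst x))" "turn ps c (fst x)"] polar_H[of "fst x"] by (auto simp: side_turn_def)
qed

lemma side_turn_continuous: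
  assumes x: "x \<in> D" "fst x \<noteq> b" shows "Ncont (\<lambda>y. of_real (side_turn y)) x"
proof (cases "fst x \<in> S")
  case False
  obtain q where q: "q > 0" "ball (fst x) q \<inter> S = {}" by (rule ball_off_slit[OF False])
  have "Ncont (\<lambda>y. of_real (turn ps c (fst y))) x"
    using x False by (intro Ncont_planar[where f = "\<lambda>z. of_real (turn ps c z)"] continuous_of_real turn_continuous) (auto simp: cut_domain_iff)
  then show ?thesis
  proof (rule Ncont_local[OF _ q(1) _ x(1)])
    fix y assume "y \<in> N x q"
    then have "fst y \<in> ball (fst x) q" by (simp add: N_def dist_commute)
    then have "fst y \<notin> S" using q(2) by blast
    then show "complex_of_real (side_turn y) = complex_of_real (turn ps c (fst y))" by (simp add: side_turn_def)
  qed
next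
  case True
  obtain q where q: "q > 0" "\<And>z. z \<in> R \<Longrightarrow> dist z (fst x) < q \<Longrightarrow> z \<notin> P \<union> inside P"
    "\<And>z. z \<in> R \<Longrightarrow> dist z (fst x) < q \<Longrightarrow> Im (H z) = 0 \<Longrightarrow> z \<in> S"
    "\<And>z. z \<in> R \<Longrightarrow> dist z (fst x) < q \<Longrightarrow> 0 < Im (H z) \<Longrightarrow> z \<notin> S \<and> tilde_side ps c z"
    "\<And>z. z \<in> R \<Longrightarrow> dist z (fst x) < q \<Longrightarrow> Im (H z) < 0 \<Longrightarrow> z \<notin> S \<and> \<not> tilde_side ps c z"
    "\<And>z. dist z (fst x) < q \<Longrightarrow> turn ps c z \<noteq> \<theta>l"
    by (rule half_plane[OF True x(2)], rule that, blast+)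
  show ?thesis unfolding Ncont_def
  proof (intro allI impI)
    fix e :: real assume e: "0 < e"
    obtain r where r: "r > 0" "\<And>z. dist z (fst x) < r \<Longrightarrow> 0 < Re (H z)"
      "\<And>z. dist z (fst x) < r \<Longrightarrow> 0 \<le> Im (H z) \<Longrightarrow> turn ps c z < e"
      "\<And>z. dist z (fst x) < r \<Longrightarrow> Im (H z) < 0 \<Longrightarrow> 2 * pi - e < turn ps c z"
      by (rule turn_near_slit[OF True x(2) e], rule that, blast+)
    show "\<exists>r>0. \<forall>y\<in>N x r. dist (complex_of_real (side_turn y)) (complex_of_real (side_turn x)) < e"
    proof (intro exI[of _ "min r q"] conjI ballI)
      fix y assume "y \<in> N x (min r q)"
      then have y: "fst y \<in> R" "dist (fst y) (fst x) < q" "dist (fst y) (fst x) < r" "snd y = snd x"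
        "fst y \<notin> S \<Longrightarrow> snd y = tilde_side ps c (fst y)" using True by (auto simp: N_def cut_domain_iff)
      note tr = turn_range[of "fst y"]
      have "turn ps c (fst x) = 0" using True by (simp add: turn_zero slit_iff)
      then have "\<bar>side_turn y - side_turn x\<bar> < e"
      proof (cases "snd x")
        case xT: True
        have "\<not> Im (H (fst y)) < 0" using q(5)[OF y(1,2)] y(4,5) xT by blast
        then have "turn ps c (fst y) < e" using r(3)[OF y(3)] by simp
        then show ?thesis using tr xT y(4) \<open>turn ps c (fst x) = 0\<close> by (simp add: side_turn_def)
      next
        case xF: False
        show ?thesis
        proof (cases "fst y \<in> S")
          case True then show ?thesis using xF y(4) \<open>fst x \<in> S\<close> e by (simp add: side_turn_def)
        next
          case yS: False
          have "\<not> 0 < Im (H (fst y))" using q(4)[OF y(1,2)] y(4,5) xF by blast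
          moreover have "Im (H (fst y)) \<noteq> 0" using q(3)[OF y(1,2)] yS by blast
          ultimately have "2 * pi - e < turn ps c (fst y)" using r(4)[OF y(3)] by simp
          then show ?thesis using tr xF y(4) \<open>fst x \<in> S\<close> yS by (simp add: side_turn_def)
        qed
      qed
      then show "dist (complex_of_real (side_turn y)) (complex_of_real (side_turn x)) < e"
        by (simp add: dist_of_real dist_real_def)
    qed (use r q in auto)
  qed
qed

text \<open>
  Adding \<open>1\<close> to a number moves its argument towards zero, without passing zero.
\<close>

lemma Im_Ln_one_plus:
  assumes "0 < k" "\<bar>\<phi>\<bar> < pi"
  defines "q \<equiv> 1 + of_real k * exp (\<i> * of_real \<phi>)"
  shows "\<bar>Im (Ln q) - \<phi>\<bar> < pi"
proof -
  have Im: "Im q = k * sin \<phi>" and Re: "Re q = 1 + k * cos \<phi>" by (simp_all add: q_def exp_Euler cos_of_real sin_of_real)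
  consider "\<phi> = 0" | "0 < \<phi>" | "\<phi> < 0" by linarith
  then show ?thesis
  proof cases
    case 1
    then have "q = of_real (1 + k)" by (simp add: q_def)
    moreover have "Im (Ln (of_real (1 + k))) = 0" using assms(1) by (subst Ln_of_real) auto
    ultimately have "Im (Ln q) = 0" by simp
    then show ?thesis using 1 pi_gt_zero by simp
  next
    case 2
    then have "0 < Im q" unfolding Im using assms by (intro mult_pos_pos sin_gt_zero) auto
    then have "q \<noteq> 0" "0 < Im q" by auto
    then have "0 < Im (Ln q)" "Im (Ln q) < pi" using Im_Ln_pos_lt[of q] by auto
    then show ?thesis using 2 assms by auto
  next
    case 3
    have "0 < sin (- \<phi>)" using 3 assms by (intro sin_gt_zero) auto
    then have "Im q < 0" unfolding Im using assms by (simp add: mult_pos_neg)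
    then have "q \<noteq> 0" "\<not> 0 \<le> Im q" by auto
    then have "Im (Ln q) < 0" using Im_Ln_pos_le[of q] Im_Ln_le_pi[of q] by fastforce
    moreover have "- pi < Im (Ln q)" using mpi_less_Im_Ln \<open>q \<noteq> 0\<close> by blast
    ultimately show ?thesis using 3 assms by auto
  qed
qed

text \<open>
  Choose \<open>w0\<close> in the sector of the polygon at \<open>b\<close> and write \<open>z\<close>
  and \<open>z0\<close> for the coordinates \<open>H\<close> of a point of the domain and of
  \<open>w0\<close>. Then \<open>z - z0\<close> is \<open>z\<close> times \<open>1 - z0 / z\<close>. The
  first factor has the logarithm \<open>ln \<bar>z\<bar> + \<i> * side_turn\<close>. The second one is a
  nonpositive real only on the segment from \<open>b\<close> to \<open>w0\<close>, which is inside the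
  polygon, so that its principal logarithm is continuous. At \<open>b\<close> the sum extends
  continuously; the limits \<open>G\<close> at the two copies of \<open>b\<close> differ by \<open>2 *
  pi * \<i>\<close>, since they are approached from different sides of the sector.
\<close>

lemma continuous_log:
  obtains w0 \<Lambda> where "w0 \<in> inside P" "\<And>x. x \<in> D \<Longrightarrow> exp (\<Lambda> x) = fst x - w0" "\<And>x. x \<in> D \<Longrightarrow> Ncont \<Lambda> x"
proof -
  obtain rb where rb: "rb > 0" "\<And>z. z \<noteq> b \<Longrightarrow> dist z b < rb \<Longrightarrow>
      (z \<in> inside P \<longleftrightarrow> \<theta>l < turn ps c z \<and> turn ps c z < \<theta>u)" and lu: "\<theta>l < \<theta>u"
    by (rule sectors_at_b, rule that, blast+)
  define \<omega> where "\<omega> = (\<theta>l + \<theta>u) / 2"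
  have \<omega>: "\<theta>l < \<omega>" "\<omega> < \<theta>u" using lu by (auto simp: \<omega>_def)
  have nb: "norm (c - b) > 0" using bc by simp
  define \<rho> where "\<rho> = rb / (2 * norm (c - b))"
  have \<rho>: "0 < \<rho>" using rb nb by (simp add: \<rho>_def)
  have inI: "polar k \<omega> \<in> inside P" if k: "0 < k" "k \<le> \<rho>" for k
  proof -
    have "dist (polar k \<omega>) b = k * norm (c - b)" using dist_polar k by simp
    also have "\<dots> \<le> \<rho> * norm (c - b)" using k nb by (intro mult_right_mono) auto
    also have "\<dots> < rb" using nb rb by (simp add: \<rho>_def)
    finally have "dist (polar k \<omega>) b < rb" .
    moreover have "polar k \<omega> \<noteq> b" using k H_polar[of k \<omega>] H_zero[of "polar k \<omega>"] by auto
    moreover have "turn ps c (polar k \<omega>) = \<omega>" using k \<omega> \<theta>_bounds by (intro turn_polar) auto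
    ultimately show ?thesis using rb(2) \<omega> by simp
  qed
  define w0 where "w0 = polar \<rho> \<omega>"
  define z0 where "z0 = complex_of_real \<rho> * exp (\<i> * of_real \<omega>)"
  have Hw0: "H w0 = z0" by (simp add: w0_def z0_def H_polar)
  have z0: "z0 \<noteq> 0" "norm z0 = \<rho>" using \<rho> by (auto simp: z0_def norm_mult)
  \<comment> \<open>at \<open>b\<close> the number is \<open>- z0\<close>; its argument counts as \<open>\<omega> - pi\<close> at \<open>b\<close> tilde and as \<open>\<omega> + pi\<close> at \<open>b\<close>\<close>
  define s where "s x = (if snd x then - pi else pi)" for x :: dpoint
  define F where "F x = of_real (ln (norm (H (fst x)))) + \<i> * of_real (side_turn x) + Ln (1 - z0 / H (fst x))" for x
  define G where "G x = of_real (ln \<rho>) + \<i> * of_real (\<omega> + s x)" for x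
  define \<Lambda> where "\<Lambda> x = (if fst x = b then G x else F x)" for x
  have notneg: "1 - z0 / H (fst x) \<notin> \<real>\<^sub>\<le>\<^sub>0" if x: "x \<in> D" "fst x \<noteq> b" for x
  proof
    assume "1 - z0 / H (fst x) \<in> \<real>\<^sub>\<le>\<^sub>0"
    then obtain t where t: "1 - z0 / H (fst x) = of_real t" "t \<le> 0" by (auto elim: nonpos_Reals_cases)
    define k where "k = 1 - t"
    have "z0 / H (fst x) = of_real k" using t(1) by (simp add: k_def algebra_simps)
    moreover have "H (fst x) \<noteq> 0" using x by simp
    ultimately have "z0 = of_real k * H (fst x)" by (simp add: field_simps)
    then have "H (fst x) = z0 / of_real k" using t(2) by (simp add: k_def field_simps)
    also have "\<dots> = H (polar (\<rho> / k) \<omega>)" by (simp add: H_polar z0_def)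
    finally have "fst x = polar (\<rho> / k) \<omega>" by (simp add: H_inj)
    moreover have "0 < \<rho> / k" "\<rho> / k \<le> \<rho>" using \<rho> t(2) by (auto simp: k_def divide_le_eq)
    ultimately have "fst x \<in> inside P" using inI by simp
    then show False using x by (simp add: cut_domain_iff)
  qed
  have expF: "exp (F x) = H (fst x) - z0" if x: "x \<in> D" "fst x \<noteq> b" for x
  proof -
    have h: "H (fst x) \<noteq> 0" using x by simp
    have nz: "1 - z0 / H (fst x) \<noteq> 0" using notneg[OF x] by (metis nonpos_Reals_zero_I)
    have "exp (F x) = of_real (exp (ln (norm (H (fst x))))) * exp (\<i> * of_real (side_turn x)) * (1 - z0 / H (fst x))"
      by (simp only: F_def exp_add exp_Ln[OF nz] exp_of_real)
    also have "\<dots> = H (fst x) * (1 - z0 / H (fst x))"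
      using h by (subst (3) H_side_turn) simp
    also have "\<dots> = H (fst x) - z0" using h by (simp add: field_simps)
    finally show ?thesis .
  qed
  have expG: "exp (G x) = - z0" for x
  proof -
    have "exp (G x) = of_real \<rho> * (exp (\<i> * of_real \<omega>) * exp (\<i> * of_real (s x)))"
      using \<rho> by (simp add: G_def exp_add exp_of_real distrib_left)
    also have "exp (\<i> * of_real (s x)) = - 1"
      by (simp add: s_def exp_minus)
    finally show ?thesis by (simp add: z0_def)
  qed
  have exp\<Lambda>: "exp (\<Lambda> x) = H (fst x) - z0" if "x \<in> D" for x
    using expF[OF that] expG[of x] by (auto simp: \<Lambda>_def)
  have HC: "isCont H z" for z unfolding H_def using bc by (intro continuous_intros) auto
  have at_b: "\<Lambda> y = G x + Ln (1 - H (fst y) / z0)"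
    if x: "x \<in> D" "fst x = b" and y: "y \<in> N x (min rb (\<rho> * norm (c - b)))" for x y
  proof (cases "fst y = b")
    case True
    have "snd y = snd x" using y x b_slit by (simp add: N_def)
    then show ?thesis using True by (simp add: \<Lambda>_def G_def s_def)
  next
    case False
    have yD: "y \<in> D" and yd: "dist (fst y) b < rb" "dist (fst y) b < \<rho> * norm (c - b)" and ys: "snd y = snd x"
      using y x b_slit by (auto simp: N_def)
    define \<theta> where "\<theta> = side_turn y"
    define k where "k = norm (H (fst y))"
    have k: "k > 0" using False by (simp add: k_def)
    have "k * norm (c - b) < \<rho> * norm (c - b)" using yd H_norm[of "fst y"] by (simp add: k_def dist_norm)
    then have k\<rho>: "k < \<rho>" using nb by (simp add: mult_less_cancel_right_disj)
    have tsec: "turn ps c (fst y) \<le> \<theta>l \<or> \<theta>u \<le> turn ps c (fst y)"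
      using rb(2)[OF False yd(1)] yD by (auto simp: cut_domain_iff)
    have \<theta>r: "if snd x then 0 \<le> \<theta> \<and> \<theta> \<le> \<theta>l else \<theta>u \<le> \<theta> \<and> \<theta> \<le> 2 * pi"
    proof (cases "fst y \<in> S")
      case True
      then have "turn ps c (fst y) = 0" by (simp add: turn_zero slit_iff)
      then show ?thesis using True ys \<theta>_bounds by (simp add: \<theta>_def side_turn_def)
    next
      case yS: False
      then have "snd x = (turn ps c (fst y) \<le> \<theta>l)" using ys yD by (simp add: cut_domain_iff tilde_side_iff)
      then show ?thesis using yS tsec turn_range[of "fst y"] by (auto simp: \<theta>_def side_turn_def)
    qed
    define \<phi> where "\<phi> = \<omega> - \<theta> + s x"
    have \<phi>: "\<bar>\<phi>\<bar> < pi" using \<theta>r \<omega> \<theta>_bounds by (auto simp: \<phi>_def s_def split: if_splits)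
    have Hy: "H (fst y) = of_real k * exp (\<i> * of_real \<theta>)" using H_side_turn[of y] by (simp add: k_def \<theta>_def)
    have "z0 / H (fst y) = of_real (\<rho> / k) * exp (\<i> * of_real \<omega> - \<i> * of_real \<theta>)"
      unfolding Hy z0_def by (simp add: exp_diff)
    also have "\<i> * of_real \<omega> - \<i> * of_real \<theta> = \<i> * of_real \<phi> - \<i> * of_real (s x)"
      by (simp add: \<phi>_def algebra_simps)
    also have "exp (\<i> * of_real \<phi> - \<i> * of_real (s x)) = - exp (\<i> * of_real \<phi>)"
      by (simp add: exp_diff s_def exp_minus)
    finally have q: "1 - z0 / H (fst y) = 1 + of_real (\<rho> / k) * exp (\<i> * of_real \<phi>)" by simp
    have a: "\<bar>Im (Ln (1 - z0 / H (fst y))) - \<phi>\<bar> < pi" unfolding q using \<rho> k \<phi> by (intro Im_Ln_one_plus) auto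
    have "norm (H (fst y) / z0) < 1" using k\<rho> \<rho> z0 by (simp add: norm_divide k_def)
    then have "Re (H (fst y) / z0) < 1" using complex_Re_le_cmod order_le_less_trans by blast
    then have re: "0 < Re (1 - H (fst y) / z0)" by simp
    then have nz: "1 - H (fst y) / z0 \<noteq> 0" by auto
    have bb: "\<bar>Im (Ln (1 - H (fst y) / z0))\<bar> < pi / 2" using Re_Ln_pos_lt[OF nz] re by simp
    have "\<Lambda> y = F y" using False by (simp add: \<Lambda>_def)
    \<comment> \<open>\<open>F\<close> and the claimed expression are logarithms of the same number whose imaginary parts differ by less than \<open>2 * pi\<close>\<close>
    also have "F y = G x + Ln (1 - H (fst y) / z0)"
    proof (rule exp_complex_eqI)
      have "Im (F y) = \<theta> + Im (Ln (1 - z0 / H (fst y)))" by (simp add: F_def \<theta>_def)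
      moreover have "Im (G x + Ln (1 - H (fst y) / z0)) = \<omega> + s x + Im (Ln (1 - H (fst y) / z0))" by (simp add: G_def)
      ultimately show "\<bar>Im (F y) - Im (G x + Ln (1 - H (fst y) / z0))\<bar> < 2 * pi"
        using a bb pi_gt_zero unfolding \<phi>_def by linarith
      have "exp (G x + Ln (1 - H (fst y) / z0)) = - z0 * (1 - H (fst y) / z0)"
        by (simp only: exp_add expG exp_Ln[OF nz])
      also have "\<dots> = H (fst y) - z0" using z0 by (simp add: field_simps)
      finally show "exp (F y) = exp (G x + Ln (1 - H (fst y) / z0))" using expF[OF yD False] by simp
    qed
    finally show ?thesis .
  qed
  have cont: "Ncont \<Lambda> x" if x: "x \<in> D" for x
  proof (cases "fst x = b")
    case True
    have "isCont (\<lambda>z. G x + Ln (1 - H z / z0)) (fst x)"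
      using z0 True by (intro continuous_intros isCont_Ln' HC) auto
    then have "Ncont (\<lambda>y. G x + Ln (1 - H (fst y) / z0)) x" by (rule Ncont_planar)
    then show ?thesis by (rule Ncont_local[OF _ _ at_b[OF x True] x]) (use rb \<rho> nb in auto)
  next
    case False
    have nz: "H (fst x) \<noteq> 0" using False by simp
    have 1: "Ncont (\<lambda>y. of_real (ln (norm (H (fst y))))) x"
      using nz by (intro Ncont_planar[where f = "\<lambda>z. of_real (ln (norm (H z)))"] continuous_intros isCont_ln' HC) auto
    have 2: "Ncont (\<lambda>y. \<i> * of_real (side_turn y)) x"
      using side_turn_continuous[OF x False] unfolding Ncont_def by (simp add: dist_mult_left[of \<i>, symmetric] dist_norm norm_mult flip: right_diff_distrib)
    have 3: "Ncont (\<lambda>y. Ln (1 - z0 / H (fst y))) x"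
      using nz notneg[OF x False] by (intro Ncont_planar[where f = "\<lambda>z. Ln (1 - z0 / H z)"] continuous_intros isCont_Ln' HC) auto
    have "Ncont F x" unfolding F_def by (intro Ncont_add 1 2 3)
    then show ?thesis
    proof (rule Ncont_local[OF _ _ _ x])
      show "0 < dist (fst x) b" using False by simp
      show "\<Lambda> y = F y" if "y \<in> N x (dist (fst x) b)" for y
        using that by (auto simp: N_def \<Lambda>_def dist_commute)
    qed
  qed
  show ?thesis
  proof (rule that[of w0 "\<lambda>x. Ln (c - b) + \<Lambda> x"])
    show "w0 \<in> inside P" using inI[of \<rho>] \<rho> by (simp add: w0_def)
    show "exp (Ln (c - b) + \<Lambda> x) = fst x - w0" if "x \<in> D" for x
    proof -
      have "exp (Ln (c - b) + \<Lambda> x) = (c - b) * (H (fst x) - H w0)" using bc by (simp add: exp_add exp\<Lambda>[OF that] Hw0)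
      also have "\<dots> = (c - b) * H (fst x) - (c - b) * H w0" by (rule right_diff_distrib)
      also have "\<dots> = fst x - w0" using bc by (simp add: H_def)
      finally show ?thesis .
    qed
    show "Ncont (\<lambda>x. Ln (c - b) + \<Lambda> x) x" if "x \<in> D" for x
      using cont[OF that] unfolding Ncont_def by simp
  qed
qed

text \<open>
  The logarithm along the loop returns to its initial value. The winding number is the same about all
  points inside the polygon, as the inside is connected and the loop avoids it.
\<close>

lemma loop_winding_zero:
  assumes g: "ncont g {0..1}" "\<And>t. t \<in> {0..1} \<Longrightarrow> g t \<in> D" "g 0 = g 1" and w: "w \<in> inside P"
  shows "winding_number (\<lambda>t. fst (g t)) w = 0"
proof -
  obtain w0 \<Lambda> where \<Lambda>: "w0 \<in> inside P" "\<And>x. x \<in> D \<Longrightarrow> exp (\<Lambda> x) = fst x - w0" "\<And>x. x \<in> D \<Longrightarrow> Ncont \<Lambda> x"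
    by (rule continuous_log, rule that, blast+)
  let ?p = "\<lambda>t. fst (g t)"
  have p: "path ?p" unfolding path_def by (rule ncont_continuous[OF g(1)])
  have loop: "pathfinish ?p = pathstart ?p" using g(3) by (simp add: pathfinish_def pathstart_def)
  have "path (\<Lambda> \<circ> g)" unfolding path_def continuous_on_iff
  proof (intro ballI allI impI)
    fix t e :: real assume t: "t \<in> {0..1}" "0 < e"
    obtain r where r: "r > 0" "\<forall>y\<in>N (g t) r. dist (\<Lambda> y) (\<Lambda> (g t)) < e"
      using \<Lambda>(3)[OF g(2)[OF t(1)]] t(2) unfolding Ncont_def by blast
    obtain \<delta> where "\<delta> > 0" "\<forall>t'\<in>{0..1}. \<bar>t' - t\<bar> < \<delta> \<longrightarrow> g t' \<in> N (g t) r"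
      using g(1) t(1) r(1) unfolding ncont_def by blast
    then show "\<exists>\<delta>>0. \<forall>t'\<in>{0..1}. dist t' t < \<delta> \<longrightarrow> dist ((\<Lambda> \<circ> g) t') ((\<Lambda> \<circ> g) t) < e"
      using r(2) by (intro exI[of _ \<delta>]) (simp add: dist_real_def)
  qed
  then have "winding_number (exp \<circ> (\<Lambda> \<circ> g)) 0 = 0"
    using winding_number_compose_exp[of "\<Lambda> \<circ> g"] g(3) by (simp add: pathfinish_def pathstart_def)
  moreover have "winding_number (exp \<circ> (\<Lambda> \<circ> g)) 0 = winding_number (\<lambda>t. ?p t - w0) 0"
    by (rule winding_number_cong) (use \<Lambda>(2) g(2) in simp)
  ultimately have 0: "winding_number ?p w0 = 0" by (simp add: winding_number_offset[of ?p w0])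
  have "inside P \<inter> path_image ?p = {}"
    using g(2) by (auto simp: path_image_def cut_domain_iff)
  then have "winding_number ?p w = winding_number ?p w0"
    using winding_number_eq[OF p loop w \<Lambda>(1) jordan(2)] by simp
  then show ?thesis using 0 by simp
qed

end

section \<open>Taut paths\<close>

lemma unit_parallel:
  fixes w1 w2 :: complex
  assumes "norm w1 = 1" "norm w2 = 1" "Im (cnj w1 * w2) = 0" shows "w1 = w2 \<or> w1 = - w2"
proof -
  define x where "x = Re (cnj w1 * w2)"
  have x: "cnj w1 * w2 = of_real x" using assms(3) by (simp add: x_def complex_eq_iff)
  have "\<bar>x\<bar> = 1" using arg_cong[OF x, of norm] assms by (simp add: norm_mult)
  moreover have "w1 * cnj w1 = 1" using assms(1) by (simp add: complex_norm_square[symmetric])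
  then have "w2 = w1 * of_real x" using x by (metis mult.assoc mult.left_neutral)
  ultimately show ?thesis by (cases "0 \<le> x") auto
qed

lemma interior_extremum:
  fixes f :: "real \<Rightarrow> real"
  assumes "continuous_on {u..v} f" "u < v" "f u = f v"
  obtains t where "u < t" "t < v" "(\<forall>x\<in>{u..v}. f x \<le> f t) \<or> (\<forall>x\<in>{u..v}. f t \<le> f x)"
proof -
  obtain m where m: "m \<in> {u..v}" "\<forall>x\<in>{u..v}. f x \<le> f m"
    using continuous_attains_sup[of "{u..v}" f] assms by auto
  obtain n where n: "n \<in> {u..v}" "\<forall>x\<in>{u..v}. f n \<le> f x"
    using continuous_attains_inf[of "{u..v}" f] assms by auto
  show ?thesis
  proof (cases "m \<in> {u, v}")
    case False then show ?thesis using that[of m] m by auto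
  next
    case mu: True
    show ?thesis
    proof (cases "n \<in> {u, v}")
      case False then show ?thesis using that[of n] n by auto
    next
      case True
      have c: "f x = f u" if "x \<in> {u..v}" for x
      proof -
        have "f m = f u" "f n = f u" using mu True assms(3) by auto
        then show ?thesis using m(2) n(2) that by (simp add: antisym)
      qed
      have mid: "(u + v) / 2 \<in> {u..v}" using assms(2) by simp
      show ?thesis
      proof (rule that[of "(u + v) / 2"])
        show "(\<forall>x\<in>{u..v}. f x \<le> f ((u + v) / 2)) \<or> (\<forall>x\<in>{u..v}. f ((u + v) / 2) \<le> f x)"
        proof (rule disjI1, rule ballI)
          fix x assume "x \<in> {u..v}"
          from c[OF this] c[OF mid] show "f x \<le> f ((u + v) / 2)" by linarith
        qed
      qed (use assms(2) in auto)
    qed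
  qed
qed

context slit_domain begin

text \<open>
  The path \<open>g\<close> on \<open>{0..M}\<close> leaves \<open>g t\<close> in the direction
  \<open>w2\<close> and, backwards, in the direction \<open>w1\<close>. The last condition says that it
  is straight at \<open>g t\<close>, or bends around the polygon. It is void at both copies of
  \<open>b\<close>.
\<close>

definition corner :: "(real \<Rightarrow> dpoint) \<Rightarrow> real \<Rightarrow> real \<Rightarrow> real \<Rightarrow> complex \<Rightarrow> complex \<Rightarrow> bool" where
  "corner g M t e w1 w2 \<longleftrightarrow> e \<le> t \<and> t + e \<le> M \<and> norm w1 = 1 \<and> norm w2 = 1 \<and> w1 \<noteq> w2 \<and>
     (\<forall>s\<in>{0..e}. fst (g (t + s)) = fst (g t) + s *\<^sub>R w2 \<and> fst (g (t - s)) = fst (g t) + s *\<^sub>R w1) \<and>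
     (fst (g t) \<noteq> b \<longrightarrow> w1 = - w2 \<or>
        (\<exists>l\<in>{0<..<1}. \<forall>\<tau>\<in>{0<..e}. fst (g t) + \<tau> *\<^sub>R ((1 - l) *\<^sub>R w1 + l *\<^sub>R w2) \<in> inside P))"

definition taut :: "(real \<Rightarrow> dpoint) \<Rightarrow> real \<Rightarrow> bool" where
  "taut g M \<longleftrightarrow> 0 < M \<and> ncont g {0..M} \<and> (\<forall>t\<in>{0..M}. g t \<in> D) \<and>
     (\<forall>t\<in>{0..M}. \<exists>e>0. inj_on g ({t - e..t + e} \<inter> {0..M})) \<and>
     (\<forall>t\<in>{0<..<M}. \<exists>e>0. \<exists>w1 w2. corner g M t e w1 w2)"

text \<open>
  The piece of \<open>g\<close> and the return path \<open>r\<close> form a loop. At an extreme point it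
  cannot be straight, so the corner is a proper one, with inside points of the polygon in its angle.
  There the winding number of the loop is nonzero by \<open>corner_winding\<close> and zero by
  \<open>loop_winding_zero\<close>.
\<close>

lemma taut_extreme_contra:
  assumes g: "taut g M" and st: "0 \<le> s" "s < t0" "t0 < t" "t \<le> M"
    and r: "ncont r {0..1}" "\<And>u. u \<in> {0..1} \<Longrightarrow> r u \<in> D" "r 0 = g t" "r 1 = g s"
    and ext: "fst (g t0) extreme_point_of (convex hull (fst ` g ` {s..t} \<union> fst ` r ` {0..1}))"
    and nb: "fst (g t0) \<noteq> b"
    and uniq: "\<And>u. u \<in> {s..t} \<Longrightarrow> g u = g t0 \<Longrightarrow> u = t0" and nr: "g t0 \<notin> r ` {0..1}"
  shows False
proof -
  let ?z = "fst (g t0)"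
  have t0: "t0 \<in> {0<..<M}" using st by auto
  obtain e w1 w2 where e: "e > 0" "e \<le> t0" "t0 + e \<le> M" and w: "norm w1 = 1" "norm w2 = 1" "w1 \<noteq> w2"
    and loc: "\<And>s. s \<in> {0..e} \<Longrightarrow> fst (g (t0 + s)) = ?z + s *\<^sub>R w2" "\<And>s. s \<in> {0..e} \<Longrightarrow> fst (g (t0 - s)) = ?z + s *\<^sub>R w1"
    and cor: "w1 = - w2 \<or> (\<exists>l\<in>{0<..<1}. \<forall>\<tau>\<in>{0<..e}. ?z + \<tau> *\<^sub>R ((1 - l) *\<^sub>R w1 + l *\<^sub>R w2) \<in> inside P)"
    using g t0 nb unfolding taut_def corner_def by blast
  have gn: "ncont g {0..M}" and gD: "\<And>t. t \<in> {0..M} \<Longrightarrow> g t \<in> D" using g unfolding taut_def by auto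
  define e' where "e' = min e (min (t0 - s) (t - t0))"
  have e': "e' > 0" "e' \<le> e" "e' \<le> t0 - s" "e' \<le> t - t0" using e st by (auto simp: e'_def)
  have nopp: "w1 \<noteq> - w2"
  proof
    assume opp: "w1 = - w2"
    have "fst (g (t0 + e')) \<in> fst ` g ` {s..t}" "fst (g (t0 - e')) \<in> fst ` g ` {s..t}"
      using e' st by (auto intro!: imageI)
    moreover have "fst (g (t0 + e')) = ?z + e' *\<^sub>R w2" "fst (g (t0 - e')) = ?z - e' *\<^sub>R w2"
      using loc[of e'] e' opp by auto
    ultimately have "e' *\<^sub>R w2 = 0" by (intro extreme_point_not_between[OF ext]) auto
    then show False using e' w by simp
  qed
  then obtain l where l: "0 < l" "l < 1" "\<And>\<tau>. \<tau> \<in> {0<..e} \<Longrightarrow> ?z + \<tau> *\<^sub>R ((1 - l) *\<^sub>R w1 + l *\<^sub>R w2) \<in> inside P"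
    using cor by auto
  have zS: "?z \<notin> S"
  proof
    assume zS: "?z \<in> S"
    have "?z \<in> closure (inside P)" unfolding closure_approachable
    proof (intro allI impI)
      fix \<epsilon> :: real assume \<epsilon>: "0 < \<epsilon>"
      define v where "v = (1 - l) *\<^sub>R w1 + l *\<^sub>R w2"
      define \<tau> where "\<tau> = min e (\<epsilon> / (2 * (norm v + 1)))"
      have \<tau>: "0 < \<tau>" "\<tau> \<le> e" using e \<epsilon> by (auto simp: \<tau>_def add_nonneg_pos)
      have np: "0 < 2 * (norm v + 1)" by (simp add: add_nonneg_pos)
      have "\<tau> * (2 * (norm v + 1)) \<le> \<epsilon>" using np by (simp add: \<tau>_def pos_le_divide_eq[symmetric])
      then have "\<tau> * norm v < \<epsilon>" using \<tau> \<epsilon> by (simp add: algebra_simps)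
      then have "dist (?z + \<tau> *\<^sub>R v) ?z < \<epsilon>" using \<tau> by (simp add: dist_norm)
      then show "\<exists>y\<in>inside P. dist y ?z < \<epsilon>" using l(3)[of \<tau>] \<tau> unfolding v_def by auto
    qed
    then have "?z \<in> P \<union> inside P" using closure_Un_frontier[of "inside P"] jordan(3) by blast
    then show False using slit_region[OF zS] nb by blast
  qed
  \<comment> \<open>the loop runs through \<open>{s..t}\<close> in its first half, so time is scaled by \<open>k\<close>\<close>
  define k where "k = 2 * (t - s)"
  have k: "k > 0" using st by (simp add: k_def)
  define g1 where "g1 x = g (s + (t - s) * x)" for x
  define G where "G x = (if x \<le> 1/2 then g1 (2 * x) else r (2 * x - 1))" for x
  have rng: "s + (t - s) * x \<in> {s..t}" if "x \<in> {0..1}" for x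
  proof -
    have "(t - s) * x \<le> (t - s) * 1" by (rule mult_left_mono) (use that st in auto)
    moreover have "0 \<le> (t - s) * x" by (rule mult_nonneg_nonneg) (use that st in auto)
    ultimately show ?thesis by simp
  qed
  have "ncont (g \<circ> (\<lambda>x. s + (t - s) * x)) {0..1}"
    by (rule ncont_compose[OF gn]) (use rng st in \<open>force intro!: continuous_intros\<close>)+
  moreover have "g1 = g \<circ> (\<lambda>x. s + (t - s) * x)" by (simp add: fun_eq_iff g1_def)
  ultimately have g1n: "ncont g1 {0..1}" by simp
  have Gn: "ncont G {0..1}" unfolding G_def by (rule ncont_join[OF g1n r(1)]) (simp add: g1_def r(3))
  have GD: "G x \<in> D" if "x \<in> {0..1}" for x
    using that gD rng[of "2 * x"] st r(2)[of "2 * x - 1"] by (auto simp: G_def g1_def)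
  have G01: "G 0 = G 1" using r(4) by (simp add: G_def g1_def)
  let ?j = "\<lambda>x. fst (G x)"
  have pj: "path ?j" unfolding path_def by (rule ncont_continuous[OF Gn])
  have lj: "pathfinish ?j = pathstart ?j" using G01 by (simp add: pathfinish_def pathstart_def)
  have imgG: "path_image ?j = fst ` g ` {s..t} \<union> fst ` r ` {0..1}"
  proof
    show "path_image ?j \<subseteq> fst ` g ` {s..t} \<union> fst ` r ` {0..1}"
      unfolding path_image_def G_def g1_def using rng by (auto intro!: imageI)
    show "fst ` g ` {s..t} \<union> fst ` r ` {0..1} \<subseteq> path_image ?j"
    proof
      fix y assume "y \<in> fst ` g ` {s..t} \<union> fst ` r ` {0..1}"
      then consider u where "u \<in> {s..t}" "y = fst (g u)" | u where "u \<in> {0..1}" "y = fst (r u)" by blast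
      then show "y \<in> path_image ?j"
      proof cases
        case 1
        define x where "x = (u - s) / k"
        have "x \<in> {0..1/2}" using 1 k by (auto simp: x_def k_def field_simps)
        moreover have "k * x = u - s" using k by (simp add: x_def)
        then have "s + (t - s) * (2 * x) = u" by (simp add: k_def algebra_simps)
        ultimately have "fst (G x) = y" "x \<in> {0..1}" using 1 by (auto simp: G_def g1_def)
        then show ?thesis unfolding path_image_def by blast
      next
        case 2
        define x where "x = (u + 1) / 2"
        have "G x = r u"
        proof (cases "u = 0")
          case True then show ?thesis using r(3) by (simp add: x_def G_def g1_def)
        next
          case False then show ?thesis using 2 by (simp add: x_def G_def field_simps)
        qed
        moreover have "x \<in> {0..1}" using 2 by (auto simp: x_def)
        ultimately show ?thesis using 2 unfolding path_image_def by (metis image_eqI)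
      qed
    qed
  qed
  define x0 where "x0 = (t0 - s) / k"
  define e2 where "e2 = e' / k"
  have kx: "k * x0 = t0 - s" "k * e2 = e'" using k by (auto simp: x0_def e2_def)
  have half: "x0 + e2 \<le> 1/2"
  proof -
    have "x0 + e2 = (t0 - s + e') / k" by (simp add: x0_def e2_def add_divide_distrib)
    also have "\<dots> \<le> (t - s) / k" using e' k by (intro divide_right_mono) auto
    also have "\<dots> = 1/2" using st by (simp add: k_def)
    finally show ?thesis .
  qed
  have x0e: "e2 > 0" "e2 \<le> x0" using e' k by (auto simp: e2_def x0_def divide_right_mono)
  have Gt: "G (x0 + \<sigma>) = g (t0 + k * \<sigma>)" if "- e2 \<le> \<sigma>" "\<sigma> \<le> e2" for \<sigma>
  proof -
    have "s + (t - s) * (2 * (x0 + \<sigma>)) = s + k * x0 + k * \<sigma>" by (simp add: k_def algebra_simps)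
    then show ?thesis using that half kx by (simp add: G_def g1_def)
  qed
  have sc: "k * \<sigma> \<in> {0..e}" if "0 \<le> \<sigma>" "\<sigma> \<le> e2" for \<sigma>
    using mult_left_mono[of \<sigma> e2 k] that k kx e' by simp
  have np: "Im (cnj (k *\<^sub>R w1) * (k *\<^sub>R w2)) \<noteq> 0"
  proof
    assume "Im (cnj (k *\<^sub>R w1) * (k *\<^sub>R w2)) = 0"
    then have "k * (k * Im (cnj w1 * w2)) = 0" by (simp add: algebra_simps)
    then show False using k unit_parallel[OF w(1,2)] w(3) nopp by simp
  qed
  have "\<exists>\<delta>>0. \<forall>\<alpha> \<beta>. 0 < \<alpha> \<longrightarrow> \<alpha> < \<delta> \<longrightarrow> 0 < \<beta> \<longrightarrow> \<beta> < \<delta> \<longrightarrow>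
    ?z + \<alpha> *\<^sub>R (k *\<^sub>R w1) + \<beta> *\<^sub>R (k *\<^sub>R w2) \<notin> path_image ?j \<longrightarrow>
    winding_number ?j (?z + \<alpha> *\<^sub>R (k *\<^sub>R w1) + \<beta> *\<^sub>R (k *\<^sub>R w2)) \<noteq> 0"
  proof (rule corner_winding[OF pj lj x0e, where z = ?z and ?v1.0 = "k *\<^sub>R w1" and ?v2.0 = "k *\<^sub>R w2"])
    show "x0 + e2 \<le> 1" using half by simp
    show "fst (G (x0 + \<sigma>)) = ?z + \<sigma> *\<^sub>R (k *\<^sub>R w2)" if "0 \<le> \<sigma>" "\<sigma> \<le> e2" for \<sigma>
      using Gt[of \<sigma>] loc(1)[OF sc[OF that]] that x0e by (simp add: mult.commute)
    show "fst (G (x0 - \<sigma>)) = ?z + \<sigma> *\<^sub>R (k *\<^sub>R w1)" if "0 \<le> \<sigma>" "\<sigma> \<le> e2" for \<sigma>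
      using Gt[of "- \<sigma>"] loc(2)[OF sc[OF that]] that x0e by (simp add: mult.commute)
    show "?z extreme_point_of (convex hull path_image ?j)" using ext imgG by simp
    show "Im (cnj (k *\<^sub>R w1) * (k *\<^sub>R w2)) \<noteq> 0" by (rule np)
    show "fst (G x) \<noteq> ?z" if x: "x \<in> {0..1}" "x \<noteq> x0" for x
    proof
      assume eq: "fst (G x) = ?z"
      have "g t0 \<in> D" using gD st by simp
      then have eqd: "G x = g t0" using dpoint_eqI[OF GD[OF x(1)], of "g t0"] eq zS by simp
      show False
      proof (cases "x \<le> 1/2")
        case True
        have ux: "s + (t - s) * (2 * x) \<in> {s..t}" using x True by (intro rng) auto
        then have "s + (t - s) * (2 * x) = t0" using uniq eqd True by (simp add: G_def g1_def)
        then have "k * x = k * x0" unfolding kx by (simp add: k_def algebra_simps)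
        then show False using k x by simp
      next
        case False
        then have "r (2 * x - 1) = g t0" "2 * x - 1 \<in> {0..1}" using eqd x by (auto simp: G_def)
        then show False using nr by (metis image_eqI)
      qed
    qed
  qed
  then obtain \<delta> where \<delta>: "\<delta> > 0" "\<And>\<alpha> \<beta>. 0 < \<alpha> \<Longrightarrow> \<alpha> < \<delta> \<Longrightarrow> 0 < \<beta> \<Longrightarrow> \<beta> < \<delta> \<Longrightarrow>
    ?z + \<alpha> *\<^sub>R (k *\<^sub>R w1) + \<beta> *\<^sub>R (k *\<^sub>R w2) \<notin> path_image ?j \<Longrightarrow>
    winding_number ?j (?z + \<alpha> *\<^sub>R (k *\<^sub>R w1) + \<beta> *\<^sub>R (k *\<^sub>R w2)) \<noteq> 0" by auto
  define \<tau> where "\<tau> = min e (\<delta> * k / 2)"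
  have dk: "0 < \<delta> * k" using \<delta>(1) k by simp
  have "\<tau> \<le> \<delta> * k / 2" by (simp add: \<tau>_def)
  then have "\<tau> < \<delta> * k" using dk by linarith
  then have "\<tau> / k < \<delta>" using k by (simp add: pos_divide_less_eq)
  moreover have "0 < \<tau>" "\<tau> \<le> e" using e dk by (auto simp: \<tau>_def)
  ultimately have \<tau>: "0 < \<tau>" "\<tau> \<le> e" "\<tau> / k < \<delta>" by auto
  define \<alpha> where "\<alpha> = (\<tau> / k) * (1 - l)"
  define \<beta> where "\<beta> = (\<tau> / k) * l"
  have tk: "0 < \<tau> / k" using \<tau> k by simp
  have "0 < \<alpha>" "0 < \<beta>" unfolding \<alpha>_def \<beta>_def using tk l by (simp_all only: mult_pos_pos diff_gt_0_iff_gt)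
  moreover have "\<alpha> \<le> (\<tau> / k) * 1" "\<beta> \<le> (\<tau> / k) * 1" unfolding \<alpha>_def \<beta>_def
    using tk l by (intro mult_left_mono; simp)+
  ultimately have ab: "0 < \<alpha>" "\<alpha> < \<delta>" "0 < \<beta>" "\<beta> < \<delta>" using \<tau>(3) by auto
  have ak: "\<alpha> * k = \<tau> * (1 - l)" "\<beta> * k = \<tau> * l" using k by (auto simp: \<alpha>_def \<beta>_def)
  have pt: "?z + \<alpha> *\<^sub>R (k *\<^sub>R w1) + \<beta> *\<^sub>R (k *\<^sub>R w2) = ?z + \<tau> *\<^sub>R ((1 - l) *\<^sub>R w1 + l *\<^sub>R w2)"
    by (simp add: ak scaleR_add_right)
  have inI: "?z + \<tau> *\<^sub>R ((1 - l) *\<^sub>R w1 + l *\<^sub>R w2) \<in> inside P" using l(3) \<tau> by simp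
  then have "?z + \<tau> *\<^sub>R ((1 - l) *\<^sub>R w1 + l *\<^sub>R w2) \<notin> path_image ?j"
    using GD by (auto simp: path_image_def cut_domain_iff)
  then have "winding_number ?j (?z + \<tau> *\<^sub>R ((1 - l) *\<^sub>R w1 + l *\<^sub>R w2)) \<noteq> 0" using \<delta>(2)[OF ab] unfolding pt by blast
  then show False using loop_winding_zero[OF Gn GD G01 inI] by simp
qed

text \<open>
  A path that returns to the same point of a line has an interior extremum on it. But a taut path passes
  every point of a line that contains it straight on.
\<close>

lemma taut_line_inj:
  assumes g: "taut g M" and st: "0 \<le> s" "t \<le> M" and seg: "fst ` g ` {s..t} \<subseteq> closed_segment k1 k2"
  shows "inj_on (\<lambda>u. fst (g u)) {s..t}"
proof (rule linorder_inj_onI')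
  fix u v assume uv: "u \<in> {s..t}" "v \<in> {s..t}" "u < v"
  show "fst (g u) \<noteq> fst (g v)"
  proof
    assume eq: "fst (g u) = fst (g v)"
    define f where "f x = inner (fst (g x)) (k2 - k1)" for x
    have gn: "ncont g {0..M}" using g by (simp add: taut_def)
    have "continuous_on {u..v} (\<lambda>x. fst (g x))"
      by (rule ncont_continuous[OF ncont_subset[OF gn]]) (use uv st in auto)
    then have "continuous_on {u..v} f" unfolding f_def by (intro continuous_on_inner continuous_on_const)
    then obtain x where x: "u < x" "x < v" "(\<forall>y\<in>{u..v}. f y \<le> f x) \<or> (\<forall>y\<in>{u..v}. f x \<le> f y)"
      by (rule interior_extremum) (use uv eq f_def in auto)
    have "x \<in> {0<..<M}" using x uv st by auto
    then obtain e w1 w2 where e: "e > 0" and w: "norm w1 = 1" "norm w2 = 1" "w1 \<noteq> w2"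
      and loc: "\<And>s. s \<in> {0..e} \<Longrightarrow> fst (g (x + s)) = fst (g x) + s *\<^sub>R w2" "\<And>s. s \<in> {0..e} \<Longrightarrow> fst (g (x - s)) = fst (g x) + s *\<^sub>R w1"
      using g unfolding taut_def corner_def by blast
    define q where "q = min e (min (x - u) (v - x))"
    have q: "q > 0" "q \<in> {0..e}" "x + q \<in> {u..v}" "x - q \<in> {u..v}" using e x by (auto simp: q_def)
    have "fst (g y) \<in> closed_segment k1 k2" if "y \<in> {u..v}" for y using seg that uv by auto
    then have "\<exists>m. fst (g y) = k1 + m *\<^sub>R (k2 - k1)" if "y \<in> {u..v}" for y
      using that by (fastforce simp: in_segment algebra_simps)
    then obtain m where m: "\<And>y. y \<in> {u..v} \<Longrightarrow> fst (g y) = k1 + m y *\<^sub>R (k2 - k1)" by metis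
    have xuv: "x \<in> {u..v}" using x by simp
    have "q *\<^sub>R w2 = fst (g (x + q)) - fst (g x)" using loc(1)[OF q(2)] by simp
    also have "\<dots> = (m (x + q) - m x) *\<^sub>R (k2 - k1)" unfolding m[OF q(3)] m[OF xuv] by (simp add: algebra_simps)
    finally have "inverse q *\<^sub>R (q *\<^sub>R w2) = inverse q *\<^sub>R ((m (x + q) - m x) *\<^sub>R (k2 - k1))" by simp
    then have "w2 = (inverse q * (m (x + q) - m x)) *\<^sub>R (k2 - k1)" using q(1) by simp
    then obtain n2 where n2: "w2 = n2 *\<^sub>R (k2 - k1)" by blast
    have "q *\<^sub>R w1 = fst (g (x - q)) - fst (g x)" using loc(2)[OF q(2)] by simp
    also have "\<dots> = (m (x - q) - m x) *\<^sub>R (k2 - k1)" unfolding m[OF q(4)] m[OF xuv] by (simp add: algebra_simps)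
    finally have "inverse q *\<^sub>R (q *\<^sub>R w1) = inverse q *\<^sub>R ((m (x - q) - m x) *\<^sub>R (k2 - k1))" by simp
    then have "w1 = (inverse q * (m (x - q) - m x)) *\<^sub>R (k2 - k1)" using q(1) by simp
    then obtain n1 where n1: "w1 = n1 *\<^sub>R (k2 - k1)" by blast
    have "Im (cnj w1 * w2) = 0" unfolding n1 n2 by (simp add: algebra_simps)
    then have opp: "w1 = - w2" using unit_parallel[OF w(1,2)] w(3) by blast
    have "n2 \<noteq> 0" "k2 - k1 \<noteq> 0" using w(2) n2 by auto
    then have "inner w2 (k2 - k1) \<noteq> 0" unfolding n2 by simp
    moreover have "f (x + q) = f x + q * inner w2 (k2 - k1)" "f (x - q) = f x - q * inner w2 (k2 - k1)"
      using loc[OF q(2)] by (simp_all add: f_def opp inner_add_left inner_diff_left)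
    ultimately show False using x(3) q by (smt (verit) mult_less_0_iff mult_pos_neg mult_pos_pos)
  qed
qed

section \<open>Uniqueness of taut paths\<close>

lemma domain_hausdorff:
  assumes "x \<in> D" "y \<in> D" "x \<noteq> y" obtains r where "r > 0" "N x r \<inter> N y r = {}"
proof (cases "fst x = fst y")
  case True
  then have "fst x \<in> S" "snd x \<noteq> snd y" using assms dpoint_eqI by blast+
  then have "N x 1 \<inter> N y 1 = {}" using True by (auto simp: N_def)
  then show ?thesis using that[of 1] by simp
next
  case False
  show ?thesis
  proof (rule that[of "dist (fst x) (fst y) / 2"])
    show "0 < dist (fst x) (fst y) / 2" using False by simp
    show "N x (dist (fst x) (fst y) / 2) \<inter> N y (dist (fst x) (fst y) / 2) = {}"
    proof (rule equals0I)
      fix z assume "z \<in> N x (dist (fst x) (fst y) / 2) \<inter> N y (dist (fst x) (fst y) / 2)"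
      then have "dist (fst z) (fst x) < dist (fst x) (fst y) / 2" "dist (fst z) (fst y) < dist (fst x) (fst y) / 2"
        by (auto simp: N_def)
      then show False using dist_triangle[of "fst x" "fst y" "fst z"] by (simp add: dist_commute)
    qed
  qed
qed

lemma ncont_seq:
  assumes g: "ncont g T" and l: "l \<in> T" "\<And>n. f n \<in> T" "f \<longlonglongrightarrow> l" and r: "0 < r"
  shows "\<forall>\<^sub>F n in sequentially. g (f n) \<in> N (g l) r"
proof -
  obtain \<delta> where d: "\<delta> > 0" "\<forall>t'\<in>T. \<bar>t' - l\<bar> < \<delta> \<longrightarrow> g t' \<in> N (g l) r" using g l(1) r unfolding ncont_def by blast
  have "\<forall>\<^sub>F n in sequentially. dist (f n) l < \<delta>" using l(3) d(1) by (rule tendstoD)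
  then show ?thesis by (rule eventually_mono) (use d(2) l(2) in \<open>simp add: dist_real_def\<close>)
qed

lemma ncont_seq_eq:
  assumes "ncont g T" "s \<in> T" "\<And>n. f n \<in> T" "f \<longlonglongrightarrow> s"
    and "ncont h U" "t \<in> U" "\<And>n. k n \<in> U" "k \<longlonglongrightarrow> t"
    and eq: "\<And>n. g (f n) = h (k n)" and D: "g s \<in> D" "h t \<in> D"
  shows "g s = h t"
proof (rule ccontr)
  assume "g s \<noteq> h t"
  then obtain r where r: "r > 0" "N (g s) r \<inter> N (h t) r = {}" by (rule domain_hausdorff[OF D])
  have "\<forall>\<^sub>F n in sequentially. g (f n) \<in> N (g s) r \<and> h (k n) \<in> N (h t) r"
    by (intro eventually_conj ncont_seq[OF assms(1-4) r(1)] ncont_seq[OF assms(5-8) r(1)])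
  then obtain n where "g (f n) \<in> N (g s) r \<and> h (k n) \<in> N (h t) r"
    using eventually_happens sequentially_bot by blast
  then show False using r(2) eq[of n] by auto
qed

lemma closed_preimage_path:
  assumes gn: "ncont g {0..M}" and gD: "\<And>t. t \<in> {0..M} \<Longrightarrow> g t \<in> D"
    and hn: "ncont h {0..K}" and hD: "\<And>t. t \<in> {0..K} \<Longrightarrow> h t \<in> D"
  shows "closed {t \<in> {0..M}. g t \<in> h ` {0..K}}"
  unfolding closed_sequential_limits
proof (intro allI impI)
  fix x l assume hx: "(\<forall>n. x n \<in> {t \<in> {0..M}. g t \<in> h ` {0..K}}) \<and> x \<longlonglongrightarrow> l"
  then have xM: "x n \<in> {0..M}" for n by simp
  have lM: "l \<in> {0..M}" using closed_sequentially[OF closed_atLeastAtMost[of 0 M]] xM hx by blast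
  have "\<forall>n. \<exists>u. u \<in> {0..K} \<and> g (x n) = h u"
  proof
    fix n have "g (x n) \<in> h ` {0..K}" using hx by simp
    then show "\<exists>u. u \<in> {0..K} \<and> g (x n) = h u" by blast
  qed
  from choice[OF this] obtain u where u: "\<And>n. u n \<in> {0..K}" "\<And>n. g (x n) = h (u n)" by blast
  have "seq_compact {0..K}" by (simp add: compact_imp_seq_compact)
  then obtain v r where v: "v \<in> {0..K}" "strict_mono r" "(u \<circ> r) \<longlonglongrightarrow> v" by (rule seq_compactE[OF _ allI[OF u(1)]])
  have "g l = h v"
  proof (rule ncont_seq_eq[OF gn lM _ _ hn v(1) _ v(3)])
    show "(x \<circ> r) \<longlonglongrightarrow> l" using hx v(2) LIMSEQ_subseq_LIMSEQ by blast
  qed (use xM u gD lM hD v in auto)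
  then show "l \<in> {t \<in> {0..M}. g t \<in> h ` {0..K}}" using lM v(1) by simp
qed

lemma closed_coincidence:
  assumes g: "ncont g {0..M}" "\<And>t. t \<in> {0..M} \<Longrightarrow> g t \<in> D"
  shows "closed {(s, t). s \<in> {0..M} \<and> t \<in> {0..M} \<and> g s = g t}"
  unfolding closed_sequential_limits
proof (intro allI impI)
  fix x :: "nat \<Rightarrow> real \<times> real" and l
  assume h: "(\<forall>n. x n \<in> {(s, t). s \<in> {0..M} \<and> t \<in> {0..M} \<and> g s = g t}) \<and> x \<longlonglongrightarrow> l"
  have fx: "fst (x n) \<in> {0..M}" "snd (x n) \<in> {0..M}" "g (fst (x n)) = g (snd (x n))" for n
    using h by (auto simp: case_prod_beta)
  have lim: "(\<lambda>n. fst (x n)) \<longlonglongrightarrow> fst l" "(\<lambda>n. snd (x n)) \<longlonglongrightarrow> snd l" using h by (auto intro: tendsto_intros)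
  have l: "fst l \<in> {0..M}" "snd l \<in> {0..M}"
    using closed_sequentially[OF closed_atLeastAtMost _ lim(1)] closed_sequentially[OF closed_atLeastAtMost _ lim(2)] fx by auto
  have "g (fst l) = g (snd l)"
    by (rule ncont_seq_eq[OF g(1) l(1) fx(1) lim(1) g(1) l(2) fx(2) lim(2) fx(3) g(2)[OF l(1)] g(2)[OF l(2)]])
  then show "l \<in> {(s, t). s \<in> {0..M} \<and> t \<in> {0..M} \<and> g s = g t}" using l by (simp add: case_prod_beta)
qed

text \<open>
  Among the loops of \<open>g\<close> choose one of minimal duration; it exists because local
  injectivity keeps the pairs of equal points away from the diagonal. An extreme point of its hull other
  than the base point and \<open>b\<close> contradicts \<open>taut_extreme_contra\<close>, and without
  such a point the loop lies in a segment.
\<close>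

lemma taut_inj: assumes g: "taut g M" shows "inj_on g {0..M}"
proof (rule ccontr)
  assume "\<not> inj_on g {0..M}"
  have gn: "ncont g {0..M}" and gD: "\<And>t. t \<in> {0..M} \<Longrightarrow> g t \<in> D" using g by (auto simp: taut_def)
  define E where "E = {(s, t). s \<in> {0..M} \<and> t \<in> {0..M} \<and> g s = g t}"
  have cE: "closed E" unfolding E_def by (rule closed_coincidence[OF gn gD])
  have "\<forall>t\<in>{0..M}. \<exists>e>0. inj_on g ({t - e..t + e} \<inter> {0..M})" using g by (simp add: taut_def)
  then obtain e where e: "\<And>t. t \<in> {0..M} \<Longrightarrow> e t > 0 \<and> inj_on g ({t - e t..t + e t} \<inter> {0..M})" by metis
  define W where "W = (\<Union>t\<in>{0..M}. {t - e t<..<t + e t} \<times> {t - e t<..<t + e t})"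
  have oW: "open W" unfolding W_def by (intro open_UN ballI open_Times open_greaterThanLessThan)
  have EW: "s = t" if stE: "(s, t) \<in> E" and stW: "(s, t) \<in> W" for s t
  proof -
    obtain u where u: "u \<in> {0..M}" "s \<in> {u - e u<..<u + e u}" "t \<in> {u - e u<..<u + e u}" using stW unfolding W_def by blast
    have "s \<in> {u - e u..u + e u} \<inter> {0..M}" "t \<in> {u - e u..u + e u} \<inter> {0..M}" "g s = g t"
      using u stE by (auto simp: E_def)
    then show ?thesis using e[OF u(1)] unfolding inj_on_def by blast
  qed
  \<comment> \<open>pairs of equal points off the diagonal form a compact set\<close>
  define E' where "E' = {p \<in> E. fst p \<le> snd p} - W"
  have "closed {p::real \<times> real. fst p \<le> snd p}" by (intro closed_Collect_le continuous_intros)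
  then have "closed E'" unfolding E'_def Collect_conj_eq using cE oW by (intro closed_Diff closed_Int) simp_all
  moreover have "E' \<subseteq> {0..M} \<times> {0..M}" by (auto simp: E'_def E_def)
  ultimately have kE: "compact E'" by (metis compact_Int_closed compact_Times compact_Icc inf.absorb_iff2)
  have diag: "s < t" if "(s, t) \<in> E'" for s t
  proof -
    have "s \<noteq> t"
    proof
      assume "s = t"
      then have "s \<in> {0..M}" "(s, t) \<in> {s - e s<..<s + e s} \<times> {s - e s<..<s + e s}" using that e[of s] by (auto simp: E'_def E_def)
      then show False using that unfolding E'_def W_def by blast
    qed
    then show ?thesis using that by (auto simp: E'_def)
  qed
  have inE': "(s, t) \<in> E'" if "s \<in> {0..M}" "t \<in> {0..M}" "g s = g t" "s < t" for s t
    using that EW[of s t] by (auto simp: E'_def E_def)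
  obtain s' t' where st': "s' \<in> {0..M}" "t' \<in> {0..M}" "g s' = g t'" "s' \<noteq> t'"
    using \<open>\<not> inj_on g {0..M}\<close> unfolding inj_on_def by blast
  then have "E' \<noteq> {}" using inE'[of s' t'] inE'[of t' s'] by (cases "s' < t'") auto
  moreover have "continuous_on E' (\<lambda>p. snd p - fst p)" by (intro continuous_intros)
  ultimately obtain p where p: "p \<in> E'" "\<And>q. q \<in> E' \<Longrightarrow> snd p - fst p \<le> snd q - fst q"
    using continuous_attains_inf[OF kE] by blast
  define s where "s = fst p"
  define t where "t = snd p"
  have st: "s \<in> {0..M}" "t \<in> {0..M}" "g s = g t" "s < t"
    using p(1) diag[of s t] by (auto simp: s_def t_def E'_def E_def)
  have uniq: "u = v" if "u \<in> {s..t}" "v \<in> {s..t}" "g u = g v" "(u, v) \<noteq> (s, t)" "(u, v) \<noteq> (t, s)" for u v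
  proof (rule ccontr)
    assume "u \<noteq> v"
    then have "(u, v) \<in> E' \<or> (v, u) \<in> E'" using inE'[of u v] inE'[of v u] that st by (cases "u < v") auto
    then have "t - s \<le> \<bar>v - u\<bar>" using p(2)[of "(u, v)"] p(2)[of "(v, u)"] by (auto simp: s_def t_def)
    then show False using that by (auto simp: abs_if split: if_splits)
  qed
  let ?Q = "fst ` g ` {s..t}"
  have gst: "ncont g {s..t}" by (rule ncont_subset[OF gn]) (use st in auto)
  have "compact ((\<lambda>t. fst (g t)) ` {s..t})" by (intro compact_continuous_image ncont_continuous gst compact_Icc)
  then have cQ: "compact ?Q" by (simp add: image_image)
  consider z where "z extreme_point_of (convex hull ?Q)" "z \<in> ?Q" "z \<noteq> fst (g s)" "z \<noteq> b"
    | "?Q \<subseteq> closed_segment (fst (g s)) b" by (rule extreme_point_outside[OF cQ])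
  then show False
  proof cases
    case 2
    have "inj_on (\<lambda>u. fst (g u)) {s..t}" by (rule taut_line_inj[OF g _ _ 2]) (use st in auto)
    from inj_onD[OF this, of s t] show False using st by simp
  next
    case 1
    obtain t0 where t0: "t0 \<in> {s..t}" "z = fst (g t0)" using 1(2) by blast
    have ne: "t0 \<noteq> s" "t0 \<noteq> t" using 1(3) t0 st(3) by auto
    show False
    proof (rule taut_extreme_contra[OF g, of s t0 t "\<lambda>_. g s"])
      show "ncont (\<lambda>_. g s) {0..1}" unfolding ncont_def using N_self[OF gD[OF st(1)]] by (auto intro: exI[of _ 1])
      have "fst (g s) \<in> ?Q" using st by auto
      then have eq: "fst ` g ` {s..t} \<union> fst ` (\<lambda>_. g s) ` {0..1::real} = ?Q" by auto
      then show "fst (g t0) extreme_point_of (convex hull (fst ` g ` {s..t} \<union> fst ` (\<lambda>_. g s) ` {0..1::real}))"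
        unfolding eq using 1(1) unfolding t0(2) by simp
      show "g t0 \<notin> (\<lambda>_. g s) ` {0..1::real}" using 1(3) t0 by auto
      show "u = t0" if "u \<in> {s..t}" "g u = g t0" for u using uniq[OF that(1) t0(1) that(2)] ne by auto
    qed (use st t0 ne 1(4) gD in auto)
  qed
qed

lemma ncont_affine:
  assumes "ncont g {0..M}" "a \<in> {0..M}" "e \<in> {0..M}"
  shows "ncont (\<lambda>u. g (a + u * (e - a))) {0..1}"
    "(\<lambda>u. g (a + u * (e - a))) ` {0..1} = g ` closed_segment a e"
    "\<And>u. u \<in> {0..1} \<Longrightarrow> a + u * (e - a) \<in> {0..M}"
proof -
  have im: "(\<lambda>u. a + u * (e - a)) ` {0..1} = closed_segment a e"
    unfolding closed_segment_image_interval by (simp add: algebra_simps)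
  have sub: "closed_segment a e \<subseteq> {0..M}" using assms by (intro closed_segment_subset) auto
  show "a + u * (e - a) \<in> {0..M}" if "u \<in> {0..1}" for u using im sub that by blast
  show "(\<lambda>u. g (a + u * (e - a))) ` {0..1} = g ` closed_segment a e" unfolding im[symmetric] image_image by simp
  have "ncont (g \<circ> (\<lambda>u. a + u * (e - a))) {0..1}"
    by (rule ncont_compose[OF assms(1)]) (use im sub in \<open>auto intro!: continuous_intros\<close>)
  then show "ncont (\<lambda>u. g (a + u * (e - a))) {0..1}" by (simp add: o_def)
qed

text \<open>
  A maximal piece of \<open>g\<close> off the image of \<open>h\<close> forms a loop with the piece of
  \<open>h\<close> between its ends. The end points of the two paths are the only ones over
  \<open>b\<close>, so every extreme point of the hull other than the two meeting points falls under
  \<open>taut_extreme_contra\<close>, for \<open>g\<close> or for \<open>h\<close>. If there is no such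
  point, both pieces run along the same segment. Then they coincide, because off the slit the planar
  point determines the point of the domain, and on the slit the flag is constant.
\<close>

lemma taut_image_subset:
  assumes g: "taut g M" "g 0 = b_tilde ps" "g M = b_pt ps"
    and h: "taut h K" "h 0 = b_tilde ps" "h K = b_pt ps"
  shows "g ` {0..M} \<subseteq> h ` {0..K}"
proof (rule ccontr)
  assume "\<not> g ` {0..M} \<subseteq> h ` {0..K}"
  then obtain t0 where t0: "t0 \<in> {0..M}" "g t0 \<notin> h ` {0..K}" by blast
  have gn: "ncont g {0..M}" and gD: "\<And>t. t \<in> {0..M} \<Longrightarrow> g t \<in> D" and M: "0 < M" using g by (auto simp: taut_def)
  have hn: "ncont h {0..K}" and hD: "\<And>t. t \<in> {0..K} \<Longrightarrow> h t \<in> D" and K: "0 < K" using h by (auto simp: taut_def)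
  have gi: "inj_on g {0..M}" and hi: "inj_on h {0..K}" using taut_inj g(1) h(1) by blast+
  have not_b: "fst (g t) \<noteq> b" if "0 < t" "t < M" for t
  proof
    assume "fst (g t) = b"
    then have "g t = g 0 \<or> g t = g M" using g(2,3) by (cases "g t"; cases "snd (g t)") (auto simp: b_tilde_def b_pt_def)
    then show False using inj_onD[OF gi, of t 0] inj_onD[OF gi, of t M] that M by auto
  qed
  have not_b': "fst (h t) \<noteq> b" if "0 < t" "t < K" for t
  proof
    assume "fst (h t) = b"
    then have "h t = h 0 \<or> h t = h K" using h(2,3) by (cases "h t"; cases "snd (h t)") (auto simp: b_tilde_def b_pt_def)
    then show False using inj_onD[OF hi, of t 0] inj_onD[OF hi, of t K] that K by auto
  qed
  define A where "A = {t \<in> {0..M}. g t \<in> h ` {0..K}}"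
  have cA: "closed A" unfolding A_def by (rule closed_preimage_path[OF gn gD hn hD])
  have A0: "0 \<in> A" "M \<in> A" using g(2,3) h(2,3) M K by (auto simp: A_def intro: image_eqI[of _ _ 0] image_eqI[of _ _ K])
  have t0A: "t0 \<notin> A" using t0 by (simp add: A_def)
  have c1: "compact (A \<inter> {0..t0})" "A \<inter> {0..t0} \<noteq> {}" using cA A0 t0 by (auto simp: closed_Int_compact)
  obtain s where s: "s \<in> A \<inter> {0..t0}" "\<forall>u \<in> A \<inter> {0..t0}. u \<le> s" using compact_attains_sup[OF c1] by (elim bexE)
  have c2: "compact (A \<inter> {t0..M})" "A \<inter> {t0..M} \<noteq> {}" using cA A0 t0 by (auto simp: closed_Int_compact)
  obtain t where t: "t \<in> A \<inter> {t0..M}" "\<forall>u \<in> A \<inter> {t0..M}. t \<le> u" using compact_attains_inf[OF c2] by (elim bexE)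
  have st: "0 \<le> s" "s < t0" "t0 < t" "t \<le> M" using s t t0A by (auto simp: order_less_le)
  have avoid: "g u \<notin> h ` {0..K}" if "s < u" "u < t" for u
  proof
    assume "g u \<in> h ` {0..K}"
    then have "u \<in> A" using that st by (simp add: A_def)
    then show False using s(2) t(2) that st by (cases "u \<le> t0") (force simp del: One_nat_def)+
  qed
  obtain s' t' where s': "s' \<in> {0..K}" "h s' = g s" and t': "t' \<in> {0..K}" "h t' = g t" using s t by (force simp: A_def)
  have st': "s' \<noteq> t'"
  proof
    assume "s' = t'"
    then have "g s = g t" using s' t' by simp
    then show False using inj_onD[OF gi, of s t] st by simp
  qed
  define lo where "lo = min s' t'"
  define hi where "hi = max s' t'"
  have lohi: "0 \<le> lo" "lo < hi" "hi \<le> K" "closed_segment t' s' = {lo..hi}" "closed_segment s' t' = {lo..hi}"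
    using s' t' st' by (auto simp: lo_def hi_def closed_segment_eq_real_ivl)
  have hlohi: "u \<in> {s', t'} \<longleftrightarrow> u = lo \<or> u = hi" for u by (auto simp: lo_def hi_def)
  define k1 where "k1 = fst (g s)"
  define k2 where "k2 = fst (g t)"
  define Q where "Q = fst ` g ` {s..t} \<union> fst ` h ` {lo..hi}"
  have gst: "ncont g {s..t}" by (rule ncont_subset[OF gn]) (use st in auto)
  have hst: "ncont h {lo..hi}" by (rule ncont_subset[OF hn]) (use lohi in auto)
  have "compact ((\<lambda>t. fst (g t)) ` {s..t} \<union> (\<lambda>t. fst (h t)) ` {lo..hi})"
    by (intro compact_Un compact_continuous_image ncont_continuous gst hst compact_Icc)
  then have cQ: "compact Q" by (simp add: image_image Q_def)
  consider z where "z extreme_point_of (convex hull Q)" "z \<in> Q" "z \<noteq> k1" "z \<noteq> k2"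
    | "Q \<subseteq> closed_segment k1 k2" by (rule extreme_point_outside[OF cQ])
  then show False
  proof cases
    case 1
    then consider (G) \<tau> where "\<tau> \<in> {s..t}" "z = fst (g \<tau>)" | (H) \<tau> where "\<tau> \<in> {lo..hi}" "z = fst (h \<tau>)"
      unfolding Q_def by blast
    then show False
    proof cases
      case G
      then have \<tau>: "s < \<tau>" "\<tau> < t" using 1(3,4) by (auto simp: k1_def k2_def order_less_le)
      let ?r = "\<lambda>u. h (t' + u * (s' - t'))"
      note aff = ncont_affine[OF hn t'(1) s'(1)]
      show False
      proof (rule taut_extreme_contra[OF g(1), of s \<tau> t ?r])
        show "fst (g \<tau>) extreme_point_of (convex hull (fst ` g ` {s..t} \<union> fst ` ?r ` {0..1}))"
          using 1(1) G(2) unfolding aff(2) lohi Q_def by simp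
        show "g \<tau> \<notin> ?r ` {0..1}" using avoid[OF \<tau>] lohi unfolding aff(2) by auto
        show "u = \<tau>" if "u \<in> {s..t}" "g u = g \<tau>" for u
          using inj_onD[OF gi that(2)] that(1) \<tau> st by simp
      qed (use aff \<tau> st not_b[of \<tau>] s' t' hD in auto)
    next
      case H
      then have \<tau>: "lo < \<tau>" "\<tau> < hi" using 1(3,4) hlohi[of \<tau>] s'(2) t'(2) by (auto simp: k1_def k2_def order_less_le)
      have notin: "h \<tau> \<notin> g ` {s..t}"
      proof
        assume "h \<tau> \<in> g ` {s..t}"
        then obtain v where v: "v \<in> {s..t}" "h \<tau> = g v" by blast
        have "h \<tau> \<in> h ` {0..K}" using \<tau> lohi by (intro imageI) simp
        then have "\<not> (s < v \<and> v < t)" using avoid[of v] v(2) by metis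
        then have "v = s \<or> v = t" using v(1) by auto
        then have "h \<tau> = h s' \<or> h \<tau> = h t'" using v s' t' by auto
        moreover have "\<tau> \<in> {0..K}" using \<tau> lohi by auto
        ultimately have "\<tau> = s' \<or> \<tau> = t'" using hi s'(1) t'(1) unfolding inj_on_def by blast
        then show False using hlohi[of \<tau>] \<tau> by auto
      qed
      define p where "p = (if s' < t' then t else s)"
      define q where "q = (if s' < t' then s else t)"
      have pq: "p \<in> {0..M}" "q \<in> {0..M}" "closed_segment p q = {s..t}" "g p = h hi" "g q = h lo"
        using st s' t' st' by (auto simp: p_def q_def closed_segment_eq_real_ivl lo_def hi_def min_def max_def)
      let ?r = "\<lambda>u. g (p + u * (q - p))"
      note aff = ncont_affine[OF gn pq(1,2)]
      show False
      proof (rule taut_extreme_contra[OF h(1), of lo \<tau> hi ?r])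
        show "fst (h \<tau>) extreme_point_of (convex hull (fst ` h ` {lo..hi} \<union> fst ` ?r ` {0..1}))"
          using 1(1) H(2) unfolding aff(2) pq(3) Q_def by (simp add: Un_commute)
        show "h \<tau> \<notin> ?r ` {0..1}" using notin unfolding aff(2) pq(3) .
        show "u = \<tau>" if "u \<in> {lo..hi}" "h u = h \<tau>" for u
          using inj_onD[OF hi that(2)] that(1) \<tau> lohi by simp
      qed (use aff \<tau> lohi not_b'[of \<tau>] pq gD in auto)
    qed
  next
    case 2
    have gseg: "fst ` g ` {s..t} \<subseteq> closed_segment k1 k2" and hseg: "fst ` h ` {lo..hi} \<subseteq> closed_segment k1 k2"
      using 2 by (auto simp: Q_def)
    have "inj_on (\<lambda>u. fst (g u)) {s..t}" by (rule taut_line_inj[OF g(1) st(1,4) gseg])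
    from inj_onD[OF this, of s t] have k12: "k1 \<noteq> k2" using st by (auto simp: k1_def k2_def)
    define v where "v = k2 - k1"
    have vv: "inner v v > 0" using k12 by (simp add: v_def)
    define \<phi> where "\<phi> z = inner (z - k1) v / inner v v" for z
    have \<phi>: "z = k1 + \<phi> z *\<^sub>R v" "\<phi> z \<in> {0..1}" if "z \<in> closed_segment k1 k2" for z
    proof -
      obtain u where u: "0 \<le> u" "u \<le> 1" "z = (1 - u) *\<^sub>R k1 + u *\<^sub>R k2" using \<open>z \<in> closed_segment k1 k2\<close> by (auto simp: in_segment)
      then have zk: "z - k1 = u *\<^sub>R v" by (simp add: v_def algebra_simps)
      then have \<phi>u: "\<phi> z = u" using vv by (simp add: \<phi>_def)
      show "z = k1 + \<phi> z *\<^sub>R v" unfolding \<phi>u by (metis zk add.commute diff_add_cancel)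
      show "\<phi> z \<in> {0..1}" using u(1,2) \<phi>u by simp
    qed
    have \<phi>k: "\<phi> k1 = 0" "\<phi> k2 = 1" using vv by (auto simp: \<phi>_def v_def)
    \<comment> \<open>the path \<open>h\<close> runs through the whole segment, by the intermediate value theorem\<close>
    have cover: "\<exists>\<tau>\<in>{lo..hi}. fst (h \<tau>) = z" if z: "z \<in> closed_segment k1 k2" for z
    proof -
      have "continuous_on {lo..hi} (\<lambda>t. \<phi> (fst (h t)))" unfolding \<phi>_def
        by (intro continuous_on_divide continuous_on_inner continuous_on_diff continuous_on_const ncont_continuous hst) (use vv in auto)
      then have "connected ((\<lambda>t. \<phi> (fst (h t))) ` {lo..hi})" by (intro connected_continuous_image) auto
      moreover have "s' \<in> {lo..hi}" "t' \<in> {lo..hi}" by (auto simp: lo_def hi_def)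
      then have "0 \<in> (\<lambda>t. \<phi> (fst (h t))) ` {lo..hi}" "1 \<in> (\<lambda>t. \<phi> (fst (h t))) ` {lo..hi}"
        using s'(2) t'(2) \<phi>k by (auto simp: k1_def k2_def intro: image_eqI[of _ _ s'] image_eqI[of _ _ t'])
      ultimately have "{0..1} \<subseteq> (\<lambda>t. \<phi> (fst (h t))) ` {lo..hi}"
        by (meson connected_contains_Icc)
      then obtain \<tau> where \<tau>: "\<tau> \<in> {lo..hi}" "\<phi> z = \<phi> (fst (h \<tau>))" using \<phi>(2)[OF z] by blast
      have "fst (h \<tau>) \<in> closed_segment k1 k2" using hseg \<tau>(1) by blast
      then have "fst (h \<tau>) = z" using \<phi>(1)[OF z] \<phi>(1)[of "fst (h \<tau>)"] \<tau>(2) by metis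
      then show ?thesis using \<tau>(1) by blast
    qed
    have onS: "fst (g u) \<in> S" if u: "s < u" "u < t" for u
    proof (rule ccontr)
      assume nS: "fst (g u) \<notin> S"
      have "fst (g u) \<in> closed_segment k1 k2" using gseg u by auto
      then obtain \<tau> where \<tau>: "\<tau> \<in> {lo..hi}" "fst (h \<tau>) = fst (g u)" using cover by blast
      then have tK: "\<tau> \<in> {0..K}" using lohi by auto
      have "u \<in> {0..M}" using u st by auto
      then have "g u = h \<tau>" using dpoint_eqI[OF gD hD[OF tK]] \<tau>(2) nS by metis
      then show False using avoid[OF u] tK by blast
    qed
    have onS': "fst (g u) \<in> S" if u: "u \<in> {s..t}" for u
    proof -
      have "closure {s<..<t} = {s..t}" using st by (simp add: closure_greaterThanLessThan)
      moreover have "(\<lambda>u. fst (g u)) ` closure {s<..<t} \<subseteq> S"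
        by (rule image_closure_subset[OF _ closed_slit]) (use onS ncont_continuous[OF gst] st in \<open>auto simp: closure_greaterThanLessThan\<close>)
      ultimately show ?thesis using u by auto
    qed
    have flat: "\<exists>\<delta>>0. \<forall>y'\<in>N y \<delta>. snd y' = snd y" if "fst y \<in> S" for y
      using that by (intro exI[of _ 1]) (auto simp: N_def)
    have f1: "snd (g t0) = snd (g s)" by (rule ncont_flag_const[OF gst flat[OF onS']]) (use st in auto)
    have kS: "closed_segment k1 k2 \<subseteq> S"
      using onS'[of s] onS'[of t] st unfolding slit_def k1_def k2_def by (intro closed_segment_subset) auto
    have "fst (g t0) \<in> closed_segment k1 k2" using gseg st by auto
    then obtain \<tau> where \<tau>: "\<tau> \<in> {lo..hi}" "fst (h \<tau>) = fst (g t0)" using cover by blast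
    have hS: "fst (h u) \<in> S" if "u \<in> {lo..hi}" for u using hseg kS that by blast
    have "snd (h \<tau>) = snd (h s')"
      by (rule ncont_flag_const[OF hst flat[OF hS]]) (use \<tau> in \<open>auto simp: lo_def hi_def\<close>)
    then have "h \<tau> = g t0" using \<tau>(2) f1 s'(2) by (simp add: prod_eq_iff)
    moreover have "\<tau> \<in> {0..K}" using \<tau>(1) lohi by auto
    ultimately show False using t0(2) by (metis image_eqI)
  qed
qed

end

section \<open>Geodesics are taut\<close>

lemma norm_additive_collinear:
  fixes a v :: complex
  assumes "norm a = s" "norm v = e" "norm (v - a) \<le> e - s" "0 < e"
  shows "a = (s / e) *\<^sub>R v"
proof -
  have "norm (v - a) = e - s" using norm_triangle_ineq[of a "v - a"] assms by simp
  then have "norm (a + (v - a)) = norm a + norm (v - a)" using assms by simp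
  then have "s *\<^sub>R (v - a) = (e - s) *\<^sub>R a" unfolding norm_triangle_eq using assms \<open>norm (v - a) = e - s\<close> by simp
  then have "s *\<^sub>R v = e *\<^sub>R a" by (simp add: algebra_simps)
  then have "(1 / e) *\<^sub>R (s *\<^sub>R v) = (1 / e) *\<^sub>R (e *\<^sub>R a)" by simp
  then show ?thesis using assms(4) by simp
qed

context slit_domain begin

lemma geodesic_local_line:
  assumes g: "geodesic \<sigma> L" and t: "0 \<le> t" "t < L"
  obtains e w where "e > 0" "t + e \<le> L" "norm w = 1"
    "\<And>s. s \<in> {0..e} \<Longrightarrow> fst (\<sigma> (t + s)) = fst (\<sigma> t) + s *\<^sub>R w"
proof -
  have tL: "t \<in> {0..L}" using t by simp
  obtain r where r: "r > 0" "\<And>y. y \<in> N (\<sigma> t) r \<Longrightarrow> linked (\<sigma> t) y \<and> d (\<sigma> t) y = dist (fst (\<sigma> t)) (fst y)"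
    by (rule N_imp_d[OF geodesic_D[OF g tL]], rule that, blast+)
  obtain \<delta> where \<delta>: "\<delta> > 0" "\<forall>t'\<in>{0..L}. \<bar>t' - t\<bar> < \<delta> \<longrightarrow> \<sigma> t' \<in> N (\<sigma> t) r"
    using geodesic_ncont[OF g] tL r(1) unfolding ncont_def by blast
  define e where "e = min (\<delta>/2) (L - t)"
  have e: "e > 0" "t + e \<le> L" "e < \<delta>" using \<delta> t by (auto simp: e_def)
  define p where "p s = fst (\<sigma> (t + s)) - fst (\<sigma> t)" for s
  have np: "norm (p s) = s" if s: "s \<in> {0..e}" for s
  proof -
    have ts: "t + s \<in> {0..L}" using s e t by simp
    have "\<sigma> (t + s) \<in> N (\<sigma> t) r" using \<delta>(2) ts s e by simp
    then have "d (\<sigma> t) (\<sigma> (t + s)) = dist (fst (\<sigma> t)) (fst (\<sigma> (t + s)))" using r(2) by blast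
    then show ?thesis using geodesic_d[OF g tL ts] s by (simp add: p_def dist_norm norm_minus_commute)
  qed
  define w where "w = (1 / e) *\<^sub>R p e"
  have "p s = s *\<^sub>R w" if s: "s \<in> {0..e}" for s
  proof -
    have "norm (p e - p s) \<le> e - s"
      using geodesic_dist[OF g, of "t + e" "t + s"] s e t by (simp add: p_def dist_norm)
    then have "p s = (s / e) *\<^sub>R p e" using np[OF s] np[of e] e by (intro norm_additive_collinear) auto
    then show ?thesis by (simp add: w_def)
  qed
  then have "fst (\<sigma> (t + s)) = fst (\<sigma> t) + s *\<^sub>R w" if "s \<in> {0..e}" for s
    using that by (simp add: p_def algebra_simps)
  moreover have "norm w = 1" using np[of e] e by (simp add: w_def)
  ultimately show ?thesis using that e by blast
qed

lemma geodesic_local_line_back: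
  assumes g: "geodesic \<sigma> L" and t: "0 < t" "t \<le> L"
  obtains e w where "e > 0" "e \<le> t" "norm w = 1"
    "\<And>s. s \<in> {0..e} \<Longrightarrow> fst (\<sigma> (t - s)) = fst (\<sigma> t) + s *\<^sub>R w"
proof -
  have h: "0 \<le> L - t" "L - t < L" using t by auto
  obtain e w where e: "e > 0" "L - t + e \<le> L" "norm w = 1"
    "\<And>s. s \<in> {0..e} \<Longrightarrow> fst (\<sigma> (L - (L - t + s))) = fst (\<sigma> (L - (L - t))) + s *\<^sub>R w"
    by (rule geodesic_local_line[OF geodesic_rev[OF g] h], rule that, blast+)
  have "fst (\<sigma> (t - s)) = fst (\<sigma> t) + s *\<^sub>R w" if "s \<in> {0..e}" for s
    using e(4)[OF that] by (simp add: algebra_simps)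
  then show ?thesis using that e by simp
qed

text \<open>
  By \<open>shortcut\<close> the only obstacle for a segment across a small corner is the inside of the
  polygon, which is conical at the corner.
\<close>

lemma unobstructed_corner:
  assumes x: "x \<in> D" "fst x \<noteq> b" and e: "e > 0"
    and y: "ncont f {0..e}" "ncont h {0..e}" "f 0 = x" "h 0 = x" "\<And>s. s \<in> {0..e} \<Longrightarrow> f s \<in> D" "\<And>s. s \<in> {0..e} \<Longrightarrow> h s \<in> D"
    and w: "norm w1 = 1" "norm w2 = 1"
    and loc: "\<And>s. s \<in> {0..e} \<Longrightarrow> fst (f s) = fst x + s *\<^sub>R w1" "\<And>s. s \<in> {0..e} \<Longrightarrow> fst (h s) = fst x + s *\<^sub>R w2"
  obtains (visible) e' where "0 < e'" "e' \<le> e" "\<And>s. s \<in> {0..e'} \<Longrightarrow> visible (f s) (h s)"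
   | (obstructed) e' l where "0 < e'" "e' \<le> e" "0 < l" "l < 1" "fst x \<notin> S"
      "\<And>\<tau>. \<tau> \<in> {0<..e'} \<Longrightarrow> fst x + \<tau> *\<^sub>R ((1 - l) *\<^sub>R w1 + l *\<^sub>R w2) \<in> inside P"
proof -
  obtain r where r: "r > 0" "\<And>y1 y2. y1 \<in> N x r \<Longrightarrow> y2 \<in> N x r \<Longrightarrow> visible y1 y2 \<or>
     (fst x \<notin> S \<and> closed_segment (fst y1) (fst y2) \<inter> inside P \<noteq> {})" by (rule shortcut[OF x], rule that, blast+)
  obtain r2 where r2: "r2 > 0" "\<And>w \<tau>. dist w (fst x) < r2 \<Longrightarrow> 0 < \<tau> \<Longrightarrow> \<tau> \<le> 1 \<Longrightarrow>
     (fst x + \<tau> *\<^sub>R (w - fst x) \<in> inside P \<longleftrightarrow> w \<in> inside P)" using radial_inside[of "fst x"] unfolding radial_at_def by blast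
  have 0: "0 \<in> {0..e}" using e by simp
  obtain d1 where d1: "d1 > 0" "\<forall>t'\<in>{0..e}. \<bar>t' - 0\<bar> < d1 \<longrightarrow> f t' \<in> N (f 0) r" using y(1) 0 r(1) unfolding ncont_def by blast
  obtain d2 where d2: "d2 > 0" "\<forall>t'\<in>{0..e}. \<bar>t' - 0\<bar> < d2 \<longrightarrow> h t' \<in> N (h 0) r" using y(2) 0 r(1) unfolding ncont_def by blast
  define e' where "e' = min (min (e/2) (r2/2)) (min (d1/2) (d2/2))"
  have e': "0 < e'" "e' \<le> e" "e' < r2" "e' < d1" "e' < d2" using e r2 d1 d2 by (auto simp: e'_def)
  have inN: "f s \<in> N x r" "h s \<in> N x r" if "s \<in> {0..e'}" for s
    using d1(2) d2(2) y(3,4) that e' by auto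
  show ?thesis
  proof (cases "\<forall>s\<in>{0..e'}. visible (f s) (h s)")
    case True then show ?thesis using visible[of e'] e' by blast
  next
    case False
    then obtain s where s: "s \<in> {0..e'}" "\<not> visible (f s) (h s)" by blast
    then have oS: "fst x \<notin> S" and "closed_segment (fst (f s)) (fst (h s)) \<inter> inside P \<noteq> {}"
      using r(2)[OF inN(1)[OF s(1)] inN(2)[OF s(1)]] by auto
    then obtain q where q: "q \<in> closed_segment (fst (f s)) (fst (h s))" "q \<in> inside P" by blast
    then obtain l where l: "0 \<le> l" "l \<le> 1" "q = (1 - l) *\<^sub>R fst (f s) + l *\<^sub>R fst (h s)" by (auto simp: in_segment)
    have se: "s \<in> {0..e}" using s(1) e' by simp
    have nin: "fst (f s) \<notin> inside P" "fst (h s) \<notin> inside P" using y(5,6)[OF se] by (auto simp: cut_domain_iff)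
    then have "l \<noteq> 0" "l \<noteq> 1" using l(3) q(2) by auto
    then have l': "0 < l" "l < 1" using l by auto
    define v where "v = (1 - l) *\<^sub>R w1 + l *\<^sub>R w2"
    have qv: "q = fst x + s *\<^sub>R v" unfolding l(3) loc(1)[OF se] loc(2)[OF se] v_def by (simp add: algebra_simps)
    have "s \<noteq> 0" using qv q(2) x by (auto simp: cut_domain_iff)
    then have s0: "s > 0" using s by simp
    have "norm v \<le> (1 - l) * 1 + l * 1" unfolding v_def
      by (rule norm_triangle_le) (use l w in simp)
    then have "s * norm v \<le> s" using mult_left_mono[of "norm v" 1 s] s0 by simp
    moreover have "dist q (fst x) = s * norm v" using qv s0 by (simp add: dist_norm)
    ultimately have dq: "dist q (fst x) < r2" using s(1) e' unfolding atLeastAtMost_iff by linarith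
    have "fst x + \<tau> *\<^sub>R v \<in> inside P" if \<tau>: "\<tau> \<in> {0<..s}" for \<tau>
      using r2(2)[OF dq, of "\<tau> / s"] \<tau> s0 q(2) by (simp add: qv)
    then show ?thesis using obstructed[of s l] s0 s e' l' oS unfolding v_def by auto
  qed
qed

text \<open>
  If the two points at distance \<open>s\<close> from a corner see each other, their distance \<open>2 *
  s\<close> is the planar one, and the corner is straight.
\<close>

lemma geodesic_corner:
  assumes g: "geodesic \<sigma> L" and t: "0 < t" "t < L"
  obtains e w1 w2 where "0 < e" "e \<le> t" "t + e \<le> L" "norm w1 = 1" "norm w2 = 1" "w1 \<noteq> w2"
    "\<forall>s\<in>{0..e}. fst (\<sigma> (t + s)) = fst (\<sigma> t) + s *\<^sub>R w2 \<and> fst (\<sigma> (t - s)) = fst (\<sigma> t) + s *\<^sub>R w1"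
    "fst (\<sigma> t) \<noteq> b \<longrightarrow> w1 = - w2 \<or> (fst (\<sigma> t) \<notin> S \<and> (\<exists>l\<in>{0<..<1}. \<forall>\<tau>\<in>{0<..e}. fst (\<sigma> t) + \<tau> *\<^sub>R ((1 - l) *\<^sub>R w1 + l *\<^sub>R w2) \<in> inside P))"
proof -
  let ?x = "\<sigma> t"
  have tL: "t \<in> {0..L}" using t by simp
  have xD: "?x \<in> D" using geodesic_D[OF g tL] .
  have h: "0 \<le> t" "t < L" "0 < t" "t \<le> L" using t by auto
  obtain ea w2 where ea: "ea > 0" "t + ea \<le> L" "norm w2 = 1" "\<And>s. s \<in> {0..ea} \<Longrightarrow> fst (\<sigma> (t + s)) = fst ?x + s *\<^sub>R w2"
    by (rule geodesic_local_line[OF g h(1,2)], rule that, blast+)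
  obtain eb w1 where eb: "eb > 0" "eb \<le> t" "norm w1 = 1" "\<And>s. s \<in> {0..eb} \<Longrightarrow> fst (\<sigma> (t - s)) = fst ?x + s *\<^sub>R w1"
    by (rule geodesic_local_line_back[OF g h(3,4)], rule that, blast+)
  define e where "e = min ea eb"
  have e: "e > 0" "e \<le> t" "t + e \<le> L" using ea eb by (auto simp: e_def)
  have loc: "fst (\<sigma> (t + s)) = fst ?x + s *\<^sub>R w2" "fst (\<sigma> (t - s)) = fst ?x + s *\<^sub>R w1" if "s \<in> {0..e}" for s
    using ea(4)[of s] eb(4)[of s] that by (auto simp: e_def)
  have rng: "t + s \<in> {0..L}" "t - s \<in> {0..L}" if "s \<in> {0..e}" for s using that e t by auto
  have nf: "ncont (\<sigma> \<circ> (\<lambda>s. t - s)) {0..e}" "ncont (\<sigma> \<circ> (\<lambda>s. t + s)) {0..e}"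
    by (rule ncont_compose[OF geodesic_ncont[OF g]]; use rng in \<open>force intro!: continuous_intros\<close>)+
  have d2: "d (\<sigma> (t - s)) (\<sigma> (t + s)) = 2 * s" if "s \<in> {0..e}" for s
    using geodesic_d[OF g rng(2)[OF that] rng(1)[OF that]] that by simp
  have ne: "w1 \<noteq> w2"
  proof
    assume eq: "w1 = w2"
    have "\<exists>r>0. fst ?x \<notin> S \<longrightarrow> ball (fst ?x) r \<inter> S = {}"
    proof (cases "fst ?x \<in> S")
      case True then show ?thesis by (intro exI[of _ 1]) simp
    next
      case False
      obtain r where "r > 0" "ball (fst ?x) r \<inter> S = {}" by (rule ball_off_slit[OF False])
      then show ?thesis by blast
    qed
    then obtain r where r: "r > 0" "fst ?x \<notin> S \<Longrightarrow> ball (fst ?x) r \<inter> S = {}" by blast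
    obtain \<delta> where \<delta>: "\<delta> > 0" "\<forall>t'\<in>{0..L}. \<bar>t' - t\<bar> < \<delta> \<longrightarrow> \<sigma> t' \<in> N ?x r"
      using geodesic_ncont[OF g] tL r(1) unfolding ncont_def by blast
    define s where "s = min e (\<delta>/2)"
    have s: "0 < s" "s \<in> {0..e}" "s < \<delta>" using e \<delta> by (auto simp: s_def)
    have y: "\<sigma> (t + s) \<in> N ?x r" "\<sigma> (t - s) \<in> N ?x r" using \<delta>(2) rng[OF s(2)] s by auto
    have feq: "fst (\<sigma> (t - s)) = fst (\<sigma> (t + s))" using loc[OF s(2)] eq by simp
    have "fst (\<sigma> (t - s)) \<notin> S \<or> snd (\<sigma> (t - s)) = snd (\<sigma> (t + s))"
    proof (cases "fst ?x \<in> S")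
      case True then show ?thesis using y by (simp add: N_def)
    next
      case False
      have "fst (\<sigma> (t - s)) \<in> ball (fst ?x) r" using y by (simp add: N_def dist_commute)
      then show ?thesis using r(2)[OF False] by blast
    qed
    then have "\<sigma> (t - s) = \<sigma> (t + s)"
      using dpoint_eqI[OF geodesic_D[OF g rng(2)[OF s(2)]] geodesic_D[OF g rng(1)[OF s(2)]] feq] by blast
    then have "d (\<sigma> (t - s)) (\<sigma> (t + s)) = 0" using d_refl[OF geodesic_D[OF g rng(1)[OF s(2)]]] by simp
    then show False using d2[OF s(2)] s(1) by simp
  qed
  show ?thesis
  proof (cases "fst ?x = b")
    case True
    show ?thesis by (rule that[of e w1 w2]) (use e ea eb ne loc True in auto)
  next
    case nb: False
    show ?thesis
    proof (rule unobstructed_corner[OF xD nb e(1) nf _ _ _ _ eb(3) ea(3)])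
      show "(\<sigma> \<circ> (\<lambda>s. t - s)) 0 = ?x" "(\<sigma> \<circ> (\<lambda>s. t + s)) 0 = ?x" by auto
      show "(\<sigma> \<circ> (\<lambda>s. t - s)) s \<in> D" "(\<sigma> \<circ> (\<lambda>s. t + s)) s \<in> D" if "s \<in> {0..e}" for s
        using geodesic_D[OF g] rng[OF that] by auto
      show "fst ((\<sigma> \<circ> (\<lambda>s. t - s)) s) = fst ?x + s *\<^sub>R w1" "fst ((\<sigma> \<circ> (\<lambda>s. t + s)) s) = fst ?x + s *\<^sub>R w2" if "s \<in> {0..e}" for s
        using loc[OF that] by auto
    next
      fix e' assume e': "0 < e'" "e' \<le> e" "\<And>s. s \<in> {0..e'} \<Longrightarrow> visible ((\<sigma> \<circ> (\<lambda>s. t - s)) s) ((\<sigma> \<circ> (\<lambda>s. t + s)) s)"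
      have "visible (\<sigma> (t - e')) (\<sigma> (t + e'))" using e'(3)[of e'] e'(1) by simp
      then have "dist (fst (\<sigma> (t - e'))) (fst (\<sigma> (t + e'))) = 2 * e'" using d_visible d2[of e'] e' by simp
      then have "norm (e' *\<^sub>R (w1 - w2)) = 2 * e'" using loc[of e'] e' by (simp add: dist_norm algebra_simps)
      then have n2: "norm (w1 - w2) = 2" using e'(1) by simp
      then have "norm (w1 + (- w2)) = norm w1 + norm (- w2)" using ea eb by simp
      then have "norm w1 *\<^sub>R (- w2) = norm (- w2) *\<^sub>R w1" unfolding norm_triangle_eq .
      then have "w1 = - w2" using ea eb by simp
      then show ?thesis using that[of e w1 w2] e ea eb ne loc by auto
    next
      fix e' l assume o: "0 < e'" "e' \<le> e" "0 < l" "l < 1" "fst ?x \<notin> S"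
        "\<And>\<tau>. \<tau> \<in> {0<..e'} \<Longrightarrow> fst ?x + \<tau> *\<^sub>R ((1 - l) *\<^sub>R w1 + l *\<^sub>R w2) \<in> inside P"
      show ?thesis
      proof (rule that[of e' w1 w2])
        show "fst ?x \<noteq> b \<longrightarrow> w1 = - w2 \<or> (fst ?x \<notin> S \<and> (\<exists>l\<in>{0<..<1}. \<forall>\<tau>\<in>{0<..e'}. fst ?x + \<tau> *\<^sub>R ((1 - l) *\<^sub>R w1 + l *\<^sub>R w2) \<in> inside P))"
          using o by (intro impI disjI2 conjI bexI[of _ l] ballI) auto
      qed (use o e ea eb ne loc in auto)
    qed
  qed
qed

lemma geodesic_inj: "geodesic \<sigma> L \<Longrightarrow> inj_on \<sigma> {0..L}"
proof (rule inj_onI)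
  fix s t assume "geodesic \<sigma> L" "s \<in> {0..L}" "t \<in> {0..L}" "\<sigma> s = \<sigma> t"
  then show "s = t" using geodesic_d[of \<sigma> L s t] d_refl[of "\<sigma> t"] geodesic_D[of \<sigma> L t] by simp
qed

lemma geodesic_taut: assumes g: "geodesic \<sigma> L" "0 < L" shows "taut \<sigma> L"
  unfolding taut_def
proof (intro conjI ballI)
  show "0 < L" "ncont \<sigma> {0..L}" using g geodesic_ncont by auto
  show "\<sigma> t \<in> D" if "t \<in> {0..L}" for t using geodesic_D[OF g(1) that] .
  show "\<exists>e>0. inj_on \<sigma> ({t - e..t + e} \<inter> {0..L})" for t
    using inj_on_subset[OF geodesic_inj[OF g(1)]] by (intro exI[of _ 1]) auto
  fix t assume "t \<in> {0<..<L}"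
  then have t: "0 < t" "t < L" by auto
  obtain e w1 w2 where *: "0 < e" "e \<le> t" "t + e \<le> L" "norm w1 = 1" "norm w2 = 1" "w1 \<noteq> w2"
    "\<forall>s\<in>{0..e}. fst (\<sigma> (t + s)) = fst (\<sigma> t) + s *\<^sub>R w2 \<and> fst (\<sigma> (t - s)) = fst (\<sigma> t) + s *\<^sub>R w1"
    "fst (\<sigma> t) \<noteq> b \<longrightarrow> w1 = - w2 \<or> (fst (\<sigma> t) \<notin> S \<and> (\<exists>l\<in>{0<..<1}. \<forall>\<tau>\<in>{0<..e}. fst (\<sigma> t) + \<tau> *\<^sub>R ((1 - l) *\<^sub>R w1 + l *\<^sub>R w2) \<in> inside P))"
    by (rule geodesic_corner[OF g(1) t])
  show "\<exists>e>0. \<exists>w1 w2. corner \<sigma> L t e w1 w2"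
    unfolding corner_def using * by (intro exI[of _ e] exI[of _ w1] exI[of _ w2]) blast
qed

section \<open>Joining taut paths\<close>

text \<open>
  Local injectivity at the joint is where injectivity of the two paths and \<open>w1 \<noteq> w2\<close>
  enter.
\<close>

lemma taut_join:
  assumes g: "taut g M" and h: "taut h K" and gh: "g M = h 0"
    and e: "0 < e" "e \<le> M" "e \<le> K" and w: "norm w1 = 1" "norm w2 = 1" "w1 \<noteq> w2"
    and loc: "\<And>s. s \<in> {0..e} \<Longrightarrow> fst (h s) = fst (g M) + s *\<^sub>R w2" "\<And>s. s \<in> {0..e} \<Longrightarrow> fst (g (M - s)) = fst (g M) + s *\<^sub>R w1"
    and cor: "fst (g M) \<noteq> b \<longrightarrow> w1 = - w2 \<or> (\<exists>l\<in>{0<..<1}. \<forall>\<tau>\<in>{0<..e}. fst (g M) + \<tau> *\<^sub>R ((1 - l) *\<^sub>R w1 + l *\<^sub>R w2) \<in> inside P)"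
  shows "taut (\<lambda>t. if t \<le> M then g t else h (t - M)) (M + K)"
proof -
  define f where "f t = (if t \<le> M then g t else h (t - M))" for t
  have fl: "f t = g t" if "t \<le> M" for t using that by (simp add: f_def)
  have fr: "f t = h (t - M)" if "M \<le> t" for t using that gh by (cases "t = M") (auto simp: f_def)
  have gM: "0 < M" "ncont g {0..M}" "\<And>t. t \<in> {0..M} \<Longrightarrow> g t \<in> D" using g by (auto simp: taut_def)
  have hK: "0 < K" "ncont h {0..K}" "\<And>t. t \<in> {0..K} \<Longrightarrow> h t \<in> D" using h by (auto simp: taut_def)
  have gi: "inj_on g {0..M}" and hi: "inj_on h {0..K}" using taut_inj g h by blast+
  have "taut f (M + K)" unfolding taut_def
  proof (intro conjI ballI)
    show "0 < M + K" using gM hK by simp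
    have "ncont (h \<circ> (\<lambda>t. t - M)) {M..M + K}" by (rule ncont_compose[OF hK(2)]) (auto intro!: continuous_intros)
    then have "ncont f {M..M + K}" by (rule ncont_cong[rotated]) (simp add: fr)
    moreover have "ncont f {0..M}" by (rule ncont_cong[OF _ gM(2)]) (simp add: fl)
    ultimately show "ncont f {0..M + K}" using gM hK by (intro ncont_glue[of f 0 M "M + K"]) auto
    show "f t \<in> D" if "t \<in> {0..M + K}" for t using gM(3)[of t] hK(3)[of "t - M"] that by (auto simp: f_def)
    show "\<exists>e>0. inj_on f ({t - e..t + e} \<inter> {0..M + K})" if t: "t \<in> {0..M + K}" for t
    proof -
      consider "t < M" | "t = M" | "M < t" by linarith
      then show ?thesis
      proof cases
        case 1
        have "inj_on f ({t - (M - t)..t + (M - t)} \<inter> {0..M + K})"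
        proof (rule inj_onI)
          fix u v assume "u \<in> {t - (M - t)..t + (M - t)} \<inter> {0..M + K}" "v \<in> {t - (M - t)..t + (M - t)} \<inter> {0..M + K}" "f u = f v"
          then show "u = v" using inj_onD[OF gi, of u v] fl[of u] fl[of v] by auto
        qed
        then show ?thesis using 1 by (intro exI[of _ "M - t"]) simp
      next
        case 3
        have "inj_on f ({t - (t - M)..t + (t - M)} \<inter> {0..M + K})"
        proof (rule inj_onI)
          fix u v assume "u \<in> {t - (t - M)..t + (t - M)} \<inter> {0..M + K}" "v \<in> {t - (t - M)..t + (t - M)} \<inter> {0..M + K}" "f u = f v"
          then show "u = v" using inj_onD[OF hi, of "u - M" "v - M"] fr[of u] fr[of v] by auto
        qed
        then show ?thesis using 3 by (intro exI[of _ "t - M"]) simp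
      next
        case 2
        have mixed: "u = M" if "u \<in> {M - e..M}" "v \<in> {M..M + e}" "f u = f v" for u v
        proof -
          have "fst (f u) = fst (g M) + (M - u) *\<^sub>R w1" using fl[of u] loc(2)[of "M - u"] that by simp
          moreover have "fst (f v) = fst (g M) + (v - M) *\<^sub>R w2" using fr[of v] loc(1)[of "v - M"] that by simp
          ultimately have eq: "(M - u) *\<^sub>R w1 = (v - M) *\<^sub>R w2" using that(3) by simp
          then have "norm ((M - u) *\<^sub>R w1) = norm ((v - M) *\<^sub>R w2)" by simp
          then have "M - u = v - M" using w that by simp
          then have "(M - u) *\<^sub>R w1 = (M - u) *\<^sub>R w2" using eq by simp
          then show ?thesis using w(3) by simp
        qed
        have mixed': "v = M" if "u \<in> {M - e..M}" "v \<in> {M..M + e}" "f u = f v" for u v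
        proof -
          have "u = M" using mixed[OF that] .
          then have "h 0 = h (v - M)" using that fr[of M] fr[of v] by simp
          then show ?thesis using inj_onD[OF hi, of 0 "v - M"] that e by simp
        qed
        have "inj_on f ({t - e..t + e} \<inter> {0..M + K})"
        proof (rule inj_onI)
          fix u v assume uv: "u \<in> {t - e..t + e} \<inter> {0..M + K}" "v \<in> {t - e..t + e} \<inter> {0..M + K}" "f u = f v"
          consider "u \<le> M" "v \<le> M" | "M \<le> u" "M \<le> v" | "u \<le> M" "M \<le> v" | "M \<le> u" "v \<le> M" by linarith
          then show "u = v"
          proof cases
            case 1 then show ?thesis using inj_onD[OF gi, of u v] fl[of u] fl[of v] uv by auto
          next
            case 2 then show ?thesis using inj_onD[OF hi, of "u - M" "v - M"] fr[of u] fr[of v] uv by auto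
          next
            case 3 then show ?thesis using mixed[of u v] mixed'[of u v] uv \<open>t = M\<close> by auto
          next
            case 4 then show ?thesis using mixed[of v u] mixed'[of v u] uv \<open>t = M\<close> by auto
          qed
        qed
        then show ?thesis using e by blast
      qed
    qed
    fix t assume t: "t \<in> {0<..<M + K}"
    consider "t < M" | "t = M" | "M < t" by linarith
    then show "\<exists>e>0. \<exists>w1 w2. corner f (M + K) t e w1 w2"
    proof cases
      case 1
      then have "t \<in> {0<..<M}" using t by simp
      then obtain e w1 w2 where *: "e > 0" "e \<le> t" "t + e \<le> M" "norm w1 = 1" "norm w2 = 1" "w1 \<noteq> w2"
        "\<forall>s\<in>{0..e}. fst (g (t + s)) = fst (g t) + s *\<^sub>R w2 \<and> fst (g (t - s)) = fst (g t) + s *\<^sub>R w1"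
        "fst (g t) \<noteq> b \<longrightarrow> w1 = - w2 \<or>
           (\<exists>l\<in>{0<..<1}. \<forall>\<tau>\<in>{0<..e}. fst (g t) + \<tau> *\<^sub>R ((1 - l) *\<^sub>R w1 + l *\<^sub>R w2) \<in> inside P)"
        using g unfolding taut_def corner_def by blast
      have "\<forall>s\<in>{0..e}. fst (f (t + s)) = fst (f t) + s *\<^sub>R w2 \<and> fst (f (t - s)) = fst (f t) + s *\<^sub>R w1"
        using *(3,7) 1 by (simp add: f_def)
      moreover have ft: "f t = g t" using 1 fl by simp
      moreover have "t + e \<le> M + K" using * hK by simp
      ultimately show ?thesis using * unfolding corner_def ft by (intro exI[of _ e] conjI exI[of _ w1] exI[of _ w2])
    next
      case 3
      then have "t - M \<in> {0<..<K}" using t by simp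
      then obtain e w1 w2 where *: "e > 0" "e \<le> t - M" "t - M + e \<le> K" "norm w1 = 1" "norm w2 = 1" "w1 \<noteq> w2"
        "\<forall>s\<in>{0..e}. fst (h (t - M + s)) = fst (h (t - M)) + s *\<^sub>R w2 \<and> fst (h (t - M - s)) = fst (h (t - M)) + s *\<^sub>R w1"
        "fst (h (t - M)) \<noteq> b \<longrightarrow> w1 = - w2 \<or>
           (\<exists>l\<in>{0<..<1}. \<forall>\<tau>\<in>{0<..e}. fst (h (t - M)) + \<tau> *\<^sub>R ((1 - l) *\<^sub>R w1 + l *\<^sub>R w2) \<in> inside P)"
        using h unfolding taut_def corner_def by blast
      have ft: "f t = h (t - M)" using 3 fr by simp
      have "f (t + s) = h (t - M + s)" "f (t - s) = h (t - M - s)" if "s \<in> {0..e}" for s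
        using fr[of "t + s"] fr[of "t - s"] that *(2) 3 by (auto simp: algebra_simps)
      then have "\<forall>s\<in>{0..e}. fst (f (t + s)) = fst (f t) + s *\<^sub>R w2 \<and> fst (f (t - s)) = fst (f t) + s *\<^sub>R w1"
        using *(7) ft by simp
      moreover have "e \<le> t" "t + e \<le> M + K" using * gM by simp_all
      ultimately show ?thesis using * unfolding corner_def ft by (intro exI[of _ e] conjI exI[of _ w1] exI[of _ w2])
    next
      case 2
      have ft: "f t = g M" using 2 fl by simp
      have "f (t + s) = h s" "f (t - s) = g (M - s)" if "s \<in> {0..e}" for s
        using fr[of "t + s"] fl[of "t - s"] that 2 by auto
      then have "\<forall>s\<in>{0..e}. fst (f (t + s)) = fst (f t) + s *\<^sub>R w2 \<and> fst (f (t - s)) = fst (f t) + s *\<^sub>R w1"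
        using loc ft by simp
      moreover have "e \<le> t" "t + e \<le> M + K" using e 2 by simp_all
      ultimately show ?thesis using e w cor unfolding corner_def ft by (intro exI[of _ e] conjI exI[of _ w1] exI[of _ w2])
    qed
  qed
  then show ?thesis unfolding f_def[abs_def] .
qed

section \<open>Cutting segments\<close>

text \<open>
  The end points cannot lie over \<open>b\<close>, since both copies of \<open>b\<close> are separated
  by the segment and therefore do not belong to it. All points other than \<open>u\<close> are off the
  slit, so they are determined by their planar points (\<open>point_on_cut\<close>).
\<close>

lemma cutting_segment_facts:
  assumes X: "cutting_segment ps R c u v X"
  obtains g where "seg u v g" "X = g ` {0..1}" "fst u \<in> S \<union> frontier R" "fst v \<in> P" "fst u \<noteq> b"
    "fst u \<noteq> fst v" "\<forall>t\<in>{0<..1}. fst (g t) \<notin> S \<union> frontier R" "\<forall>t\<in>{0..<1}. fst (g t) \<notin> P"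
proof -
  have X': "u \<in> B1 ps R c" "v \<in> B2 ps R c" "is_segment ps R c u v X"
    "X - {u, v} \<subseteq> poly_interior ps R c D" "b_tilde ps \<notin> X" "b_pt ps \<notin> X"
    using X unfolding cutting_segment_def strictly_separates_def by blast+
  obtain g where g: "seg u v g" "X = g ` {0..1}" using X'(3) unfolding is_segment_def seg_iff_joins by blast
  have ends: "g 0 = u" "g 1 = v" and lin: "\<And>t. t \<in> {0..1} \<Longrightarrow> g t \<in> D \<and> fst (g t) = linepath (fst u) (fst v) t"
    using g(1) unfolding seg_def by blast+
  have "0 \<in> {0..1::real}" "1 \<in> {0..1::real}" by simp_all
  then have uX: "u \<in> X" and vX: "v \<in> X" unfolding g(2) using ends by (metis imageI)+
  have nb: "fst x \<noteq> b" if "x \<in> X" for x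
  proof
    assume "fst x = b"
    then have "x = b_tilde ps \<or> x = b_pt ps" unfolding b_tilde_def b_pt_def by (cases x; cases "snd x") auto
    then show False using X'(5,6) that by blast
  qed
  have u: "fst u \<in> S \<union> frontier R" using X'(1) by (simp add: B1_def)
  have v: "fst v \<in> P" using X'(2) by (simp add: B2_def)
  have vS: "fst v \<notin> S \<union> frontier R" using slit_region[of "fst v"] region_R(3) v nb[OF vX] by blast
  have uP: "fst u \<notin> P" using slit_region[of "fst u"] region_R(3) u nb[OF uX] by blast
  have uv: "fst u \<noteq> fst v" using uP v by auto
  have mid: "fst (g t) \<notin> S \<union> frontier R \<union> P" if t: "0 < t" "t < 1" for t
  proof -
    have tt: "t \<in> {0..1}" using t by simp
    have f: "fst (g t) = fst u + t *\<^sub>R (fst v - fst u)" using lin[OF tt] by (simp add: linepath_def algebra_simps)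
    have "fst (g t) \<noteq> fst u" using f uv t by simp
    moreover have "fst (g t) \<noteq> fst v"
    proof
      assume "fst (g t) = fst v"
      then have "t *\<^sub>R (fst v - fst u) = 1 *\<^sub>R (fst v - fst u)" using f by (metis add_diff_cancel_left' scaleR_one)
      then show False using uv t by (simp only: scaleR_cancel_right) simp
    qed
    ultimately have "g t \<in> X - {u, v}" using g(2) tt by auto
    then have "g t \<notin> B1 ps R c \<union> B2 ps R c" using X'(4) unfolding poly_interior_def by blast
    then show ?thesis using lin[OF tt] by (simp add: B1_def B2_def)
  qed
  show ?thesis
  proof (rule that[OF g u v nb[OF uX] uv])
    show "\<forall>t\<in>{0<..1}. fst (g t) \<notin> S \<union> frontier R"
    proof
      fix t :: real assume "t \<in> {0<..1}"
      then show "fst (g t) \<notin> S \<union> frontier R" using mid[of t] vS ends by (cases "t = 1") auto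
    qed
    show "\<forall>t\<in>{0..<1}. fst (g t) \<notin> P"
    proof
      fix t :: real assume "t \<in> {0..<1}"
      then show "fst (g t) \<notin> P" using mid[of t] uP ends by (cases "t = 0") auto
    qed
  qed
qed

lemma point_on_cut:
  assumes "seg u v g" "\<forall>t\<in>{0<..1}. fst (g t) \<notin> S \<union> frontier R" "q \<in> D"
    and t: "0 < t" "t \<le> 1" "fst q = fst u + t *\<^sub>R (fst v - fst u)"
  shows "q = g t"
proof -
  have "g t \<in> D \<and> fst (g t) = linepath (fst u) (fst v) t" using assms(1) t unfolding seg_def by simp
  then have "g t \<in> D" "fst (g t) = fst q" unfolding t(3) by (simp_all add: linepath_def algebra_simps)
  moreover have "fst (g t) \<notin> S" using assms(2) t by simp
  ultimately show ?thesis using dpoint_eqI[of q "g t"] assms(3) by simp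
qed

text \<open>
  A point obstructed by the inside of the polygon is in its closure, hence on \<open>P\<close>.
\<close>

lemma geodesic_corner_straight:
  assumes g: "geodesic \<sigma> L" and t: "0 < t" "t < L" and nb: "fst (\<sigma> t) \<noteq> b" and nP: "fst (\<sigma> t) \<notin> P"
  obtains e w where "0 < e" "e \<le> t" "t + e \<le> L" "norm w = 1"
    "\<forall>s\<in>{0..e}. fst (\<sigma> (t + s)) = fst (\<sigma> t) + s *\<^sub>R w \<and> fst (\<sigma> (t - s)) = fst (\<sigma> t) - s *\<^sub>R w"
proof -
  let ?x = "\<sigma> t"
  obtain e w1 w2 where *: "0 < e" "e \<le> t" "t + e \<le> L" "norm w1 = 1" "norm w2 = 1" "w1 \<noteq> w2"
    "\<forall>s\<in>{0..e}. fst (\<sigma> (t + s)) = fst (\<sigma> t) + s *\<^sub>R w2 \<and> fst (\<sigma> (t - s)) = fst (\<sigma> t) + s *\<^sub>R w1"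
    "fst (\<sigma> t) \<noteq> b \<longrightarrow> w1 = - w2 \<or> (fst (\<sigma> t) \<notin> S \<and> (\<exists>l\<in>{0<..<1}. \<forall>\<tau>\<in>{0<..e}. fst (\<sigma> t) + \<tau> *\<^sub>R ((1 - l) *\<^sub>R w1 + l *\<^sub>R w2) \<in> inside P))"
    by (rule geodesic_corner[OF g t])
  have xD: "?x \<in> D" using geodesic_D[OF g] t by simp
  have "w1 = - w2"
  proof (rule ccontr)
    assume "w1 \<noteq> - w2"
    then obtain l where l: "\<forall>\<tau>\<in>{0<..e}. fst ?x + \<tau> *\<^sub>R ((1 - l) *\<^sub>R w1 + l *\<^sub>R w2) \<in> inside P" using *(8) nb by blast
    have "fst ?x \<in> closure (inside P)"
    proof (rule Lim_in_closed_set[where F = "at_right (0::real)" and f = "\<lambda>\<tau>. fst ?x + \<tau> *\<^sub>R ((1 - l) *\<^sub>R w1 + l *\<^sub>R w2)"])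
      show "\<forall>\<^sub>F \<tau> in at_right 0. fst ?x + \<tau> *\<^sub>R ((1 - l) *\<^sub>R w1 + l *\<^sub>R w2) \<in> closure (inside P)"
        unfolding eventually_at_right_field using l *(1) closure_subset[of "inside P"]
        by (intro exI[of _ e]) (auto intro!: subsetD[OF closure_subset])
      have "((\<lambda>\<tau>. fst ?x + \<tau> *\<^sub>R ((1 - l) *\<^sub>R w1 + l *\<^sub>R w2)) \<longlongrightarrow> fst ?x + 0 *\<^sub>R ((1 - l) *\<^sub>R w1 + l *\<^sub>R w2)) (at_right 0)"
        by (intro tendsto_intros)
      then show "((\<lambda>\<tau>. fst ?x + \<tau> *\<^sub>R ((1 - l) *\<^sub>R w1 + l *\<^sub>R w2)) \<longlongrightarrow> fst ?x) (at_right 0)" by simp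
    qed simp_all
    then have "fst ?x \<in> inside P \<union> P" using closure_Un_frontier[of "inside P"] jordan(3) by simp
    then show False using nP xD cut_domain_iff by simp
  qed
  then show ?thesis using that[of e w2] * by simp
qed

lemma geodesic_straight_to:
  assumes g: "geodesic \<sigma> L" and t: "0 \<le> t" "t < L" and v: "visible (\<sigma> t) (\<sigma> L)" and s: "s \<in> {0..L - t}"
  shows "fst (\<sigma> (t + s)) = fst (\<sigma> t) + (s / (L - t)) *\<^sub>R (fst (\<sigma> L) - fst (\<sigma> t))"
proof -
  have r: "t \<in> {0..L}" "L \<in> {0..L}" "t + s \<in> {0..L}" using t s by auto
  have D: "dist (fst (\<sigma> t)) (fst (\<sigma> L)) = L - t" using d_visible[OF v] geodesic_d[OF g r(1,2)] t by simp
  have A: "dist (fst (\<sigma> t)) (fst (\<sigma> (t + s))) \<le> s" using geodesic_dist[OF g r(1,3)] s by simp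
  have B: "dist (fst (\<sigma> (t + s))) (fst (\<sigma> L)) \<le> L - t - s" using geodesic_dist[OF g r(3,2)] s by simp
  have "dist (fst (\<sigma> t)) (fst (\<sigma> (t + s))) = s" using A B D dist_triangle[of "fst (\<sigma> t)" "fst (\<sigma> L)" "fst (\<sigma> (t + s))"] by linarith
  then have "fst (\<sigma> (t + s)) - fst (\<sigma> t) = (s / (L - t)) *\<^sub>R (fst (\<sigma> L) - fst (\<sigma> t))"
    using B D t by (intro norm_additive_collinear) (simp_all add: dist_norm norm_minus_commute)
  then show ?thesis by (simp add: algebra_simps)
qed

text \<open>
  If \<open>x\<close> is on the boundary of the convex set \<open>R\<close>, it is not between an
  interior point and another point of \<open>R\<close>. If it is on the slit, the points just before and
  just after \<open>x\<close> are on different sides of the slit and have different flags.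
\<close>

lemma straight_not_through_outer_boundary:
  assumes x: "x \<in> D" "fst x \<noteq> b" "fst x \<in> S \<union> frontier R"
    and e: "0 < e" and f: "ncont f {-e..e}" "f 0 = x" "\<And>s. s \<in> {-e..e} \<Longrightarrow> f s \<in> D"
      "\<And>s. s \<in> {-e..e} \<Longrightarrow> fst (f s) = fst x + s *\<^sub>R w"
    and off: "\<And>s. s \<in> {0<..e} \<Longrightarrow> fst (f s) \<notin> S \<union> frontier R"
  shows False
proof (cases "fst x \<in> frontier R")
  case True
  have m: "fst (f e) = fst x + e *\<^sub>R w" "fst (f (- e)) = fst x - e *\<^sub>R w" using f(4)[of e] f(4)[of "- e"] e by auto
  have "f e \<in> D" "f (- e) \<in> D" using f(3)[of e] f(3)[of "- e"] e by auto
  then have eR: "fst (f e) \<in> R" "fst (f (- e)) \<in> R" by (simp_all only: cut_domain_iff)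
  moreover note eR
  moreover have "fst (f e) \<notin> frontier R" using off[of e] e by simp
  ultimately have i: "fst (f e) \<in> interior R" "fst (f (- e)) \<in> closure R"
    by (simp_all add: frontier_def closure_closed[OF closed_R])
  have "fst (f (- e)) - (1/2) *\<^sub>R (fst (f (- e)) - fst (f e)) \<in> interior R"
    by (rule mem_interior_closure_convex_shrink[OF rectangle_props(2) i]) simp_all
  moreover have "fst (f (- e)) - (1/2) *\<^sub>R (fst (f (- e)) - fst (f e)) = fst x" unfolding m by (simp add: algebra_simps flip: scaleR_add_left)
  ultimately show False using True by (simp add: frontier_def)
next
  case False
  then have xS: "fst x \<in> S" using x by blast
  obtain r where r: "r > 0" "\<And>z. z \<in> R \<Longrightarrow> dist z (fst x) < r \<Longrightarrow> Im (H z) = 0 \<Longrightarrow> z \<in> S"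
    "\<And>z. z \<in> R \<Longrightarrow> dist z (fst x) < r \<Longrightarrow> 0 < Im (H z) \<Longrightarrow> z \<notin> S \<and> tilde_side ps c z"
    "\<And>z. z \<in> R \<Longrightarrow> dist z (fst x) < r \<Longrightarrow> Im (H z) < 0 \<Longrightarrow> z \<notin> S \<and> \<not> tilde_side ps c z"
    by (rule half_plane[OF xS x(2)], rule that, blast+)
  have 0: "0 \<in> {-e..e}" using e by simp
  obtain \<delta> where \<delta>: "\<delta> > 0" "\<forall>t'\<in>{-e..e}. \<bar>t' - 0\<bar> < \<delta> \<longrightarrow> f t' \<in> N (f 0) r"
    using f(1) 0 r(1) unfolding ncont_def by blast
  define s where "s = min e (\<delta>/2)"
  have s: "0 < s" "s \<le> e" "s < \<delta>" using e \<delta> by (auto simp: s_def)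
  have y: "f s \<in> N x r" "f (- s) \<in> N x r" using \<delta>(2) f(2) s by auto
  let ?p = "fst (f s)" and ?q = "fst (f (- s))"
  have pq: "?p \<in> R" "?q \<in> R" "dist ?p (fst x) < r" "dist ?q (fst x) < r"
    and fl: "snd (f s) = snd (f (- s))" using y xS by (auto simp: N_def cut_domain_iff)
  have "?q = 2 *\<^sub>R fst x - ?p" using f(4)[of s] f(4)[of "- s"] s by (simp add: scaleR_2)
  then have "H ?q = 2 * H (fst x) - H ?p" using bc unfolding H_def by (simp add: divide_simps scaleR_conv_of_real)
  then have im: "Im (H ?q) = - Im (H ?p)" using xS by (simp add: slit_iff)
  have "?p \<notin> S" using off[of s] s by simp
  then have "Im (H ?p) \<noteq> 0" using r(2)[OF pq(1,3)] by blast
  then consider "0 < Im (H ?p)" | "Im (H ?p) < 0" by linarith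
  then show False
  proof cases
    case 1
    then have "tilde_side ps c ?p" "?p \<notin> S" "\<not> tilde_side ps c ?q" "?q \<notin> S" using r(3)[OF pq(1,3)] r(4)[OF pq(2,4)] im by auto
    then show False using fl y unfolding N_def cut_domain_iff by auto
  next
    case 2
    then have "\<not> tilde_side ps c ?p" "?p \<notin> S" "tilde_side ps c ?q" "?q \<notin> S" using r(4)[OF pq(1,3)] r(3)[OF pq(2,4)] im by auto
    then show False using fl y unfolding N_def cut_domain_iff by auto
  qed
qed

text \<open>
  Consider the first point of the geodesic on the segment. From there it sees \<open>v\<close> along the
  segment, so the geodesic follows the segment to \<open>v\<close>. Unless the point is
  \<open>v\<close>, it is not on the polygon, so the geodesic is straight there and arrives along the
  line of the segment. This contradicts the choice of the point, or
  \<open>straight_not_through_outer_boundary\<close> if the point is \<open>u\<close>.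
\<close>

lemma geodesic_meets_cut_only_at_polygon:
  assumes X: "cutting_segment ps R c u v X" and g: "geodesic \<sigma> L" "\<sigma> L = v" "\<sigma> 0 \<notin> X" and t: "0 \<le> t" "t < L"
  shows "\<sigma> t \<notin> X"
proof
  assume tX: "\<sigma> t \<in> X"
  obtain h where h: "seg u v h" "X = h ` {0..1}" "fst u \<in> S \<union> frontier R" "fst v \<in> P" "fst u \<noteq> b"
    "fst u \<noteq> fst v" "\<forall>t\<in>{0<..1}. fst (h t) \<notin> S \<union> frontier R" "\<forall>t\<in>{0..<1}. fst (h t) \<notin> P"
    by (rule cutting_segment_facts[OF X])
  have hh: "ncont h {0..1}" "\<And>t. t \<in> {0..1} \<Longrightarrow> h t \<in> D" "h 0 = u" "h 1 = v"
    and hl: "\<And>t. t \<in> {0..1} \<Longrightarrow> fst (h t) = fst u + t *\<^sub>R (fst v - fst u)"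
    using h(1) unfolding seg_def by (auto simp: linepath_def algebra_simps)
  let ?T = "{t \<in> {0..L}. \<sigma> t \<in> h ` {0..1}}"
  have cl: "closed ?T" by (rule closed_preimage_path[OF geodesic_ncont[OF g(1)] geodesic_D[OF g(1)] hh(1,2)])
  have ne: "t \<in> ?T" using tX t h(2) by simp
  define s where "s = Inf ?T"
  have bd: "bdd_below ?T" by (intro bdd_belowI[of _ 0]) simp
  have sT: "s \<in> ?T" unfolding s_def by (rule closed_contains_Inf[OF _ bd cl]) (use ne in blast)
  have first: "\<sigma> q \<notin> X" if "0 \<le> q" "q < s" for q
  proof
    assume "\<sigma> q \<in> X"
    then have "q \<in> ?T" using that sT h(2) by auto
    then have "s \<le> q" unfolding s_def by (rule cInf_lower[OF _ bd])
    then show False using that by simp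
  qed
  have "s \<le> t" unfolding s_def by (rule cInf_lower[OF ne bd])
  then have sL: "s < L" using t by simp
  have "s \<noteq> 0" using sT g(3) h(2) by auto
  then have s0: "0 < s" using sT by simp
  obtain a where a: "a \<in> {0..1}" "\<sigma> s = h a" using sT by blast
  have "\<sigma> s \<noteq> \<sigma> L" using inj_onD[OF geodesic_inj[OF g(1)], of s L] sL s0 by auto
  then have a1: "a < 1" using a g(2) hh(4) by (cases "a = 1") auto
  have vi: "visible (\<sigma> s) (\<sigma> L)" using visible_sub[OF h(1) a(1), of 1] a(2) g(2) hh(4) by simp
  have nb: "fst (\<sigma> s) \<noteq> b"
  proof (cases "a = 0")
    case True then show ?thesis using a h(5) hh(3) by simp
  next
    case False
    then have "fst (h a) \<notin> S \<union> frontier R" using a(1) h(7) by simp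
    then show ?thesis using a(2) b_slit by auto
  qed
  have nP: "fst (\<sigma> s) \<notin> P" using a a1 h(8) by simp
  obtain e w where e: "0 < e" "e \<le> s" "s + e \<le> L" "norm w = 1"
    "\<forall>q\<in>{0..e}. fst (\<sigma> (s + q)) = fst (\<sigma> s) + q *\<^sub>R w \<and> fst (\<sigma> (s - q)) = fst (\<sigma> s) - q *\<^sub>R w"
    by (rule geodesic_corner_straight[OF g(1) s0 sL nb nP])
  define k where "k = (1 - a) / (L - s)"
  have k: "k > 0" using a1 sL by (simp add: k_def)
  have fs: "fst (\<sigma> s) = fst u + a *\<^sub>R (fst v - fst u)" using hl[OF a(1)] a(2) by simp
  have vs: "fst v - fst (\<sigma> s) = (1 - a) *\<^sub>R (fst v - fst u)" unfolding fs by (simp add: algebra_simps)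
  have str: "fst (\<sigma> (s + q)) = fst (\<sigma> s) + (q * k) *\<^sub>R (fst v - fst u)" if "q \<in> {0..L - s}" for q
    using geodesic_straight_to[OF g(1) _ sL vi that] s0 unfolding g(2) vs k_def by simp
  have "fst (\<sigma> s) + e *\<^sub>R w = fst (\<sigma> s) + (e * k) *\<^sub>R (fst v - fst u)" using str[of e] e by simp
  then have "(1 / e) *\<^sub>R (e *\<^sub>R w) = (1 / e) *\<^sub>R ((e * k) *\<^sub>R (fst v - fst u))" by simp
  then have w: "w = k *\<^sub>R (fst v - fst u)" using e(1) by simp
  show False
  proof (cases "a = 0")
    case False
    then have a0: "a > 0" using a by simp
    define q where "q = min e (a / (2 * k))"
    have q: "0 < q" "q \<le> e" using e a0 k by (auto simp: q_def)
    have "q \<le> a / (2 * k)" by (simp add: q_def)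
    then have "q * (2 * k) \<le> a" using k by (simp add: pos_le_divide_eq)
    then have "2 * (q * k) \<le> a" by (simp add: ac_simps)
    then have qk: "0 < a - q * k" "a - q * k \<le> 1" using a0 a1 mult_pos_pos[OF q(1) k] by linarith+
    have "fst (\<sigma> (s - q)) = fst u + (a - q * k) *\<^sub>R (fst v - fst u)" using e(5) q unfolding fs w by (simp add: scaleR_diff_left)
    then have "\<sigma> (s - q) = h (a - q * k)"
      using point_on_cut[OF h(1,7) _ qk] geodesic_D[OF g(1), of "s - q"] q e sL by simp
    then have "\<sigma> (s - q) \<in> X" using h(2) qk by simp
    then show False using first[of "s - q"] q e by simp
  next
    case True
    then have su: "\<sigma> s = u" using a hh by simp
    have rng: "s + q \<in> {0..L}" if "q \<in> {-e..e}" for q using that e by auto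
    have nc: "ncont (\<sigma> \<circ> (\<lambda>q. s + q)) {-e..e}"
      by (rule ncont_compose[OF geodesic_ncont[OF g(1)]]; use rng in \<open>force intro!: continuous_intros\<close>)
    show False
    proof (rule straight_not_through_outer_boundary[where x = u and e = e and w = w, OF _ h(5,3) e(1) nc])
      show "u \<in> D" using hh(2)[of 0] hh(3) by simp
      show "(\<sigma> \<circ> (\<lambda>q. s + q)) 0 = u" using su by simp
      show "(\<sigma> \<circ> (\<lambda>q. s + q)) q \<in> D" if "q \<in> {-e..e}" for q using geodesic_D[OF g(1) rng[OF that]] by simp
      show "fst ((\<sigma> \<circ> (\<lambda>q. s + q)) q) = fst u + q *\<^sub>R w" if "q \<in> {-e..e}" for q
        using e(5)[rule_format, of "\<bar>q\<bar>"] that su by (cases "q \<ge> 0") auto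
      show "fst ((\<sigma> \<circ> (\<lambda>q. s + q)) q) \<notin> S \<union> frontier R" if q: "q \<in> {0<..e}" for q
      proof -
        have "k * q \<le> k * (L - s)" using q e k by (intro mult_left_mono) auto
        also have "\<dots> = 1" using True sL by (simp add: k_def)
        finally have qk: "q * k \<in> {0<..1}" using q mult_pos_pos[of q k] k by (simp add: mult.commute)
        have "fst (\<sigma> (s + q)) = fst (h (q * k))" using str[of q] hl[of "q * k"] q e qk su by auto
        then show ?thesis using h(7) qk by simp
      qed
    qed
  qed
qed

section \<open>Separation by a cutting segment\<close>

abbreviation "T \<equiv> cut_top ps R c"

lemma poly_interior_open: "openin T (poly_interior ps R c A)"
proof -
  let ?Z = "S \<union> frontier R \<union> P"
  have Z: "closed ?Z" using closed_slit jordan(4) by (intro closed_Un frontier_closed)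
  have eq: "B1 ps R c \<union> B2 ps R c = {x \<in> D. fst x \<in> ?Z}" by (auto simp: B1_def B2_def)
  have "cut_open ps R c {x \<in> D. fst x \<notin> ?Z}"
    unfolding cut_open_iff
  proof (intro conjI ballI)
    fix x assume x: "x \<in> {x \<in> D. fst x \<notin> ?Z}"
    have "open (- ?Z)" using Z by (simp only: open_Compl)
    moreover have "fst x \<in> - ?Z" using x by simp
    ultimately obtain r where r: "r > 0" "ball (fst x) r \<subseteq> - ?Z" by (meson open_contains_ball)
    have "N x r \<subseteq> {x \<in> D. fst x \<notin> ?Z}"
    proof
      fix y assume "y \<in> N x r"
      then have "y \<in> D" "fst y \<in> ball (fst x) r" by (auto simp: N_def dist_commute)
      then show "y \<in> {x \<in> D. fst x \<notin> ?Z}" using r(2) by blast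
    qed
    then show "\<exists>r>0. N x r \<subseteq> {x \<in> D. fst x \<notin> ?Z}" using r(1) by blast
  qed simp
  then have "openin T {x \<in> D. fst x \<notin> ?Z}" by (simp add: openin_cut_top)
  moreover have "openin T (T interior_of A)" by simp
  ultimately have "openin T (T interior_of A \<inter> {x \<in> D. fst x \<notin> ?Z})" by (rule openin_Int[rotated])
  moreover have "T interior_of A \<inter> {x \<in> D. fst x \<notin> ?Z} = poly_interior ps R c A"
    unfolding poly_interior_def eq using interior_of_subset_topspace[of T A] by (auto simp: topspace_cut_top)
  ultimately show ?thesis by simp
qed

lemma poly_interior_subset: "poly_interior ps R c A \<subseteq> A"
  unfolding poly_interior_def using interior_of_subset[of T A] by blast

lemma seg_in_N:
  assumes "x \<in> D"
  obtains q where "q > 0" "\<And>r y g t. r \<le> q \<Longrightarrow> y \<in> N x r \<Longrightarrow> seg x y g \<Longrightarrow> t \<in> {0..1} \<Longrightarrow> g t \<in> N x r"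
proof -
  obtain q where q: "q > 0" "\<And>y r. linked x y \<Longrightarrow> d x y < r \<Longrightarrow> r \<le> q \<Longrightarrow> y \<in> N x r"
    by (rule d_imp_N[OF assms], rule that, blast+)
  have "g t \<in> N x r" if r: "r \<le> q" and y: "y \<in> N x r" and g: "seg x y g" and t: "t \<in> {0..1}" for r y g t
  proof -
    have v: "visible x (g t)" using visible_sub[OF g, of 0 t] g t by (simp add: seg_def)
    have gt: "fst (g t) \<in> closed_segment (fst x) (fst y)" using g t unfolding seg_def by (simp add: linepath_in_path)
    have "dist (fst x) (fst (g t)) \<le> dist (fst x) (fst y)" using dist_in_closed_segment[OF gt] by (simp add: dist_commute)
    also have "\<dots> < r" using y by (simp add: N_def dist_commute)
    finally show ?thesis using q(2)[OF visible_linked[OF v] _ r] d_visible[OF v] by simp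
  qed
  then show ?thesis using that q(1) by blast
qed

text \<open>
  Small neighbourhoods are star shaped, see \<open>visible_neighbourhood\<close>. So open connected sets
  are path connected, which turns the connectedness of the sub-polygons into paths that avoid a cutting
  segment.
\<close>

lemma locally_path_connected: "locally_path_connected_space T"
  unfolding locally_path_connected_space_def neighbourhood_base_of
proof (intro allI impI)
  fix W x assume W: "openin T W \<and> x \<in> W"
  then obtain r0 where r0: "r0 > 0" "N x r0 \<subseteq> W" and xD: "x \<in> D" unfolding openin_cut_top cut_open_iff by blast
  obtain r1 where r1: "r1 > 0" "\<And>y. y \<in> N x r1 \<Longrightarrow> visible x y" by (rule visible_neighbourhood[OF xD], rule that, blast+)
  obtain r2 where r2: "r2 > 0" "\<And>r. r \<le> r2 \<Longrightarrow> cut_open ps R c (N x r)" by (rule N_open[OF xD], rule that, blast+)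
  obtain r3 where r3: "r3 > 0" "\<And>r y g t. r \<le> r3 \<Longrightarrow> y \<in> N x r \<Longrightarrow> seg x y g \<Longrightarrow> t \<in> {0..1} \<Longrightarrow> g t \<in> N x r"
    by (rule seg_in_N[OF xD], rule that, blast+)
  define r where "r = min (min r0 r1) (min r2 r3)"
  have r: "r > 0" "r \<le> r0" "r \<le> r1" "r \<le> r2" "r \<le> r3" using r0 r1 r2 r3 by (auto simp: r_def)
  let ?V = "N x r"
  have op: "openin T ?V" using r2(2)[OF r(4)] by (simp add: openin_cut_top)
  have star: "path_component_of (subtopology T ?V) x y" if y: "y \<in> ?V" for y
  proof -
    have "y \<in> N x r1" using y N_mono[OF r(3)] by blast
    then obtain g where g: "seg x y g" using r1(2) unfolding visible_def by blast
    have "pathin T g" using g unfolding seg_iff_joins joins_def by blast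
    moreover have "\<forall>t\<in>{0..1}. g t \<in> ?V" using r3(2)[OF r(5) y g] by blast
    ultimately have "pathin (subtopology T ?V) g" unfolding pathin_subtopology by blast
    then show ?thesis unfolding path_component_of_def using g unfolding seg_def by blast
  qed
  have "path_connected_space (subtopology T ?V)"
    unfolding path_connected_space_iff_path_component
  proof (intro ballI)
    fix y z assume "y \<in> topspace (subtopology T ?V)" "z \<in> topspace (subtopology T ?V)"
    then have "y \<in> ?V" "z \<in> ?V" by simp_all
    then show "path_component_of (subtopology T ?V) y z" using path_component_of_trans[OF path_component_of_sym[OF star] star] by blast
  qed
  then have "path_connectedin T ?V" using openin_subset[OF op] by (simp add: path_connectedin_def)
  moreover have "x \<in> ?V" using N_self[OF xD r(1)] .
  moreover have "?V \<subseteq> W" using r0(2) N_mono[OF r(2)] by blast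
  ultimately show "\<exists>U V. openin T U \<and> path_connectedin T V \<and> x \<in> U \<and> U \<subseteq> V \<and> V \<subseteq> W"
    using op by (intro exI[of _ ?V]) simp
qed

lemma connected_imp_path_component:
  assumes Q: "openin T Q" and W: "connectedin T W" "W \<subseteq> Q" "x \<in> W" "y \<in> W"
  shows "path_component_of (subtopology T Q) x y"
proof -
  have "locally_path_connected_space (subtopology T Q)" by (rule locally_path_connected_space_open_subset[OF locally_path_connected Q])
  then have "path_component_of_set (subtopology T Q) x = connected_component_of_set (subtopology T Q) x"
    by (rule path_component_eq_connected_component_of)
  moreover have "connected_component_of (subtopology T Q) x y"
    unfolding connected_component_of_def connectedin_subtopology using W by blast
  ultimately show ?thesis by blast
qed

lemma hausdorff: "Hausdorff_space T"
  unfolding Hausdorff_space_def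
proof (intro allI impI)
  fix x y assume xy: "x \<in> topspace T \<and> y \<in> topspace T \<and> x \<noteq> y"
  then have D: "x \<in> D" "y \<in> D" "x \<noteq> y" by (simp_all add: topspace_cut_top)
  obtain r where r: "r > 0" "N x r \<inter> N y r = {}" by (rule domain_hausdorff[OF D])
  obtain q1 where q1: "q1 > 0" "\<And>r. r \<le> q1 \<Longrightarrow> cut_open ps R c (N x r)" by (rule N_open[OF D(1)], rule that, blast+)
  obtain q2 where q2: "q2 > 0" "\<And>r. r \<le> q2 \<Longrightarrow> cut_open ps R c (N y r)" by (rule N_open[OF D(2)], rule that, blast+)
  define e where "e = min r (min q1 q2)"
  have e: "e > 0" "e \<le> r" "e \<le> q1" "e \<le> q2" using r q1 q2 by (auto simp: e_def)
  show "\<exists>U V. openin T U \<and> openin T V \<and> x \<in> U \<and> y \<in> V \<and> disjnt U V"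
  proof (intro exI conjI)
    show "openin T (N x e)" "openin T (N y e)" using q1(2)[OF e(3)] q2(2)[OF e(4)] by (simp_all add: openin_cut_top)
    show "x \<in> N x e" "y \<in> N y e" using N_self D e by auto
    show "disjnt (N x e) (N y e)" using r(2) N_mono[OF e(2)] unfolding disjnt_def by blast
  qed
qed

lemma cut_complement_open:
  assumes "is_segment ps R c u v X" shows "openin T (D - X)"
proof -
  obtain g where g: "pathin T g" "X = g ` {0..1}" using assms unfolding is_segment_def joins_def by blast
  have "compactin (top_of_set {0..1}) {0..1::real}" by (simp add: compactin_subtopology)
  then have "compactin T X" unfolding g(2) using g(1) unfolding pathin_def by (rule image_compactin)
  then have "closedin T X" by (rule compactin_imp_closedin[OF hausdorff])
  then show ?thesis unfolding closedin_def topspace_cut_top by blast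
qed

lemma geodesic_path_component:
  assumes g: "geodesic \<sigma> L" and a: "0 \<le> a" "a \<le> e" "e \<le> L" and Q: "\<And>t. t \<in> {a..e} \<Longrightarrow> \<sigma> t \<in> Q"
  shows "path_component_of (subtopology T Q) (\<sigma> a) (\<sigma> e)"
proof -
  have j: "joins ps R c (\<lambda>t. \<sigma> (a + (e - a) * t)) (\<sigma> a) (\<sigma> e)" using geodesic_joins(1)[OF geodesic_sub[OF g a]] by simp
  have "a + (e - a) * t \<in> {a..e}" if "t \<in> {0..1}" for t
    using that a mult_left_mono[of t 1 "e - a"] mult_nonneg_nonneg[of "e - a" t] by simp
  then have "pathin (subtopology T Q) (\<lambda>t. \<sigma> (a + (e - a) * t))"
    using j Q unfolding pathin_subtopology joins_def by blast
  then show ?thesis using j unfolding path_component_of_def joins_def by blast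
qed

text \<open>
  The segment \<open>\<xi> i\<close> does not meet the interiors of the sub-polygons, so each \<open>E l
  - \<xi> i\<close> lies between a connected set and its closure. Consecutive ones share the cutting
  segment between them, if this is not \<open>\<xi> i\<close>. Hence \<open>b\<close> tilde and \<open>a
  (i - 1)\<close> lie in one connected set off \<open>\<xi> i\<close>, and \<open>a (i + 1)\<close> and
  \<open>b\<close> in another.
\<close>

lemma partition_separates:
  assumes part: "cut_partition ps R c n u v \<xi> E" and a: "\<forall>i\<le>n + 1. a i \<in> \<xi> i" and i: "1 \<le> i" "i \<le> n"
    and ai: "a (i - 1) \<notin> \<xi> i" "a (i + 1) \<notin> \<xi> i"
  shows "\<not> path_component_of (subtopology T (D - \<xi> i)) (a (i - 1)) (a (i + 1))"
proof
  assume mid: "path_component_of (subtopology T (D - \<xi> i)) (a (i - 1)) (a (i + 1))"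
  define I where "I l = poly_interior ps R c (E l)" for l
  have p: "\<xi> 0 = {b_tilde ps}" "\<xi> (n + 1) = {b_pt ps}" "cutting_segment ps R c (u i) (v i) (\<xi> i)"
    "\<And>l. l \<in> {1..n} \<Longrightarrow> l \<noteq> i \<Longrightarrow> \<xi> i \<inter> \<xi> l = {}"
    using part i unfolding cut_partition_def by auto
  have sub: "T closure_of (I l) = E l" "connectedin T (I l)" "\<xi> l \<union> \<xi> (l + 1) \<subseteq> E l - I l" if "l \<le> n" for l
    using part that unfolding cut_partition_def is_subpolygon_def I_def by blast+
  have dis: "I l \<inter> I k = {}" if "l \<le> n" "k \<le> n" "l \<noteq> k" for l k
    using part that unfolding cut_partition_def I_def by blast
  have sep: "strictly_separates ps R c (\<xi> i) (b_tilde ps) (b_pt ps)" and sg: "is_segment ps R c (u i) (v i) (\<xi> i)"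
    using p(3) unfolding cutting_segment_def by blast+
  have op: "openin T (D - \<xi> i)" by (rule cut_complement_open[OF sg])
  have off: "\<xi> i \<inter> I l = {}" if l: "l \<le> n" for l
  proof (cases "l = i")
    case True then show ?thesis using sub(3)[OF l] by blast
  next
    case False
    have "openin T (I l)" unfolding I_def by (rule poly_interior_open)
    moreover have "\<xi> i \<subseteq> T closure_of (I i)" using sub(1,3)[OF i(2)] by blast
    ultimately show ?thesis using dis[OF l i(2) False] unfolding closure_of_def by blast
  qed
  have conn: "connectedin T (E l - \<xi> i)" if l: "l \<le> n" for l
  proof (rule connectedin_intermediate_closure_of[OF sub(2)[OF l]])
    show "I l \<subseteq> E l - \<xi> i" using off[OF l] poly_interior_subset[of "E l"] unfolding I_def by blast
    show "E l - \<xi> i \<subseteq> T closure_of I l" using sub(1)[OF l] by blast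
  qed
  have run: "connectedin T (\<Union>l\<in>{j..k}. E l - \<xi> i)" if "j \<le> k" "k \<le> n" "k < i \<or> i \<le> j" for j k
    using that
  proof (induction k rule: dec_induct)
    case base then show ?case using conn by simp
  next
    case (step k)
    have k: "k \<le> n" "Suc k \<le> n" using step by auto
    have "\<xi> i \<inter> \<xi> (k + 1) = {}" using p(4)[of "k + 1"] step by auto
    moreover have "a (k + 1) \<in> \<xi> (k + 1)" using a k by simp
    moreover have "\<xi> (k + 1) \<subseteq> E k \<inter> E (Suc k)" using sub(3)[OF k(1)] sub(3)[OF k(2)] by auto
    ultimately have "a (k + 1) \<in> (E k - \<xi> i) \<inter> (E (Suc k) - \<xi> i)" by blast
    moreover have "E k - \<xi> i \<subseteq> (\<Union>l\<in>{j..k}. E l - \<xi> i)" using step by auto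
    ultimately have "(\<Union>l\<in>{j..k}. E l - \<xi> i) \<inter> (E (Suc k) - \<xi> i) \<noteq> {}" by blast
    then have "connectedin T ((\<Union>l\<in>{j..k}. E l - \<xi> i) \<union> (E (Suc k) - \<xi> i))"
      using step.IH step.prems k conn[OF k(2)] by (intro connectedin_Un) auto
    moreover have "(\<Union>l\<in>{j..k}. E l - \<xi> i) \<union> (E (Suc k) - \<xi> i) = (\<Union>l\<in>{j..Suc k}. E l - \<xi> i)"
      using atLeastAtMostSuc_conv[of j k] step(1) by auto
    ultimately show ?case by simp
  qed
  have inD: "(\<Union>l\<in>M. E l - \<xi> i) \<subseteq> D - \<xi> i" if "M \<subseteq> {..n}" for M
  proof -
    have "E l \<subseteq> D" if "l \<le> n" for l using sub(1)[OF that] closure_of_subset_topspace[of T "I l"] by (simp add: topspace_cut_top)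
    then show ?thesis using that by blast
  qed
  have bnot: "b_tilde ps \<notin> \<xi> i" "b_pt ps \<notin> \<xi> i" using sep unfolding strictly_separates_def by blast+
  have before: "path_component_of (subtopology T (D - \<xi> i)) (b_tilde ps) (a (i - 1))"
  proof (rule connected_imp_path_component[OF op run[of 0 "i - 1"]])
    show "b_tilde ps \<in> (\<Union>l\<in>{0..i - 1}. E l - \<xi> i)" using sub(3)[of 0] p(1) bnot(1) by auto
    have i1: "i - 1 \<le> n" "i - 1 \<le> n + 1" using i by auto
    have "a (i - 1) \<in> E (i - 1) - \<xi> i" using sub(3)[OF i1(1)] a[rule_format, OF i1(2)] ai(1) by blast
    then show "a (i - 1) \<in> (\<Union>l\<in>{0..i - 1}. E l - \<xi> i)" by auto
  qed (use i inD[of "{0..i - 1}"] in auto)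
  have after: "path_component_of (subtopology T (D - \<xi> i)) (a (i + 1)) (b_pt ps)"
  proof (rule connected_imp_path_component[OF op run[of i n]])
    show "b_pt ps \<in> (\<Union>l\<in>{i..n}. E l - \<xi> i)" using sub(3)[of n] p(2) bnot(2) i by auto
    have "i + 1 \<le> n + 1" using i by simp
    then have "a (i + 1) \<in> E i - \<xi> i" using sub(3)[OF i(2)] a ai(2) by blast
    then show "a (i + 1) \<in> (\<Union>l\<in>{i..n}. E l - \<xi> i)" using i by auto
  qed (use i inD[of "{i..n}"] in auto)
  have "path_component_of (subtopology T (D - \<xi> i)) (b_tilde ps) (b_pt ps)"
    by (rule path_component_of_trans[OF path_component_of_trans[OF before mid] after])
  then obtain g where "pathin T g" "\<forall>t\<in>{0..1}. g t \<in> D - \<xi> i" "g 0 = b_tilde ps" "g 1 = b_pt ps"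
    unfolding path_component_of_def pathin_subtopology by blast
  then have "joins ps R c g (b_tilde ps) (b_pt ps)" "g ` {0..1} \<inter> \<xi> i = {}" unfolding joins_def by blast+
  then show False using sep unfolding strictly_separates_def by blast
qed

end

section \<open>Upper angles\<close>

lemma upper_angle_pi_opposite:
  assumes w: "norm w1 = norm w2" and a: "upper_angle e w1 w2 = pi" and e: "e \<noteq> 0"
  shows "w1 = - w2"
proof -
  define A1 A2 where "A1 = Arg2pi (w1 / e)" and "A2 = Arg2pi (w2 / e)"
  have pol: "w1 / e = of_real (norm (w1 / e)) * exp (\<i> * of_real A1)" "w2 / e = of_real (norm (w2 / e)) * exp (\<i> * of_real A2)"
    unfolding A1_def A2_def by (rule Arg2pi_eq)+
  have "\<bar>A1 - A2\<bar> = pi" using a unfolding upper_angle_def A1_def A2_def by simp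
  then consider "A1 = A2 + pi" | "A2 = A1 + pi" by linarith
  then have "exp (\<i> * of_real A1) = - exp (\<i> * of_real A2)"
  proof cases
    case 1 then show ?thesis by (simp add: distrib_left exp_add mult.commute)
  next
    case 2 then show ?thesis by (simp add: distrib_left exp_add mult.commute)
  qed
  then have "w1 / e = - (w2 / e)" using pol w by (simp add: norm_divide)
  then show ?thesis using e by (simp add: field_simps)
qed

text \<open>
  The sector of \<open>w1\<close> and \<open>w2\<close> that does not contain \<open>e\<close> has an
  angle of at most \<open>pi\<close> if the upper angle is at least \<open>pi\<close>. If it is smaller
  than \<open>pi\<close>, the chord between \<open>w1\<close> and \<open>w2\<close> stays in this
  sector.
\<close>

lemma sector_avoids_ray:
  assumes w: "norm w1 = 1" "norm w2 = 1" and a: "pi \<le> upper_angle e w1 w2" and e: "e \<noteq> 0"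
    and nz: "Arg2pi (w1 / e) \<noteq> 0" "Arg2pi (w2 / e) \<noteq> 0"
    and l: "0 \<le> l" "l \<le> 1" and s: "0 \<le> s" and eq: "(1 - l) *\<^sub>R w1 + l *\<^sub>R w2 = s *\<^sub>R e"
  shows "w1 = - w2"
proof (rule ccontr)
  assume no: "w1 \<noteq> - w2"
  have main: False
    if w: "norm w1 = 1" "norm w2 = 1" and nz: "Arg2pi (w1 / e) \<noteq> 0" and no: "w1 \<noteq> - w2"
    and a: "pi \<le> upper_angle e w1 w2" and le: "Arg2pi (w1 / e) \<le> Arg2pi (w2 / e)"
    and l: "0 \<le> l" "l \<le> 1" and eq: "(1 - l) *\<^sub>R w1 + l *\<^sub>R w2 = s *\<^sub>R e" for w1 w2 l
  proof -
    define A1 A2 \<rho> where "A1 = Arg2pi (w1 / e)" and "A2 = Arg2pi (w2 / e)" and "\<rho> = 1 / norm e"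
    have \<rho>: "\<rho> > 0" using e by (simp add: \<rho>_def)
    have pol: "w1 / e = of_real \<rho> * cis A1" "w2 / e = of_real \<rho> * cis A2"
      using Arg2pi_eq[of "w1 / e"] Arg2pi_eq[of "w2 / e"] w unfolding A1_def A2_def \<rho>_def by (simp_all add: norm_divide cis_conv_exp)
    have A: "0 < A1" "A1 \<le> A2" "A2 < 2 * pi" using le nz Arg2pi_ge_0[of "w1 / e"] Arg2pi_lt_2pi[of "w2 / e"] unfolding A1_def A2_def by auto
    have "upper_angle e w1 w2 \<noteq> pi" using upper_angle_pi_opposite[of w1 w2 e] w e no by auto
    then have d: "A2 - A1 < pi" using a A unfolding upper_angle_def A1_def[symmetric] A2_def[symmetric] by auto
    have "(1 - l) *\<^sub>R (w1 / e) + l *\<^sub>R (w2 / e) = ((1 - l) *\<^sub>R w1 + l *\<^sub>R w2) / e" by (simp add: scaleR_conv_of_real add_divide_distrib)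
    also have "\<dots> = of_real s" unfolding eq using e by (simp add: scaleR_conv_of_real)
    finally have E: "(1 - l) *\<^sub>R (of_real \<rho> * cis A1) + l *\<^sub>R (of_real \<rho> * cis A2) = of_real s" unfolding pol .
    have E1: "l * \<rho> * sin (A2 - A1) = - s * sin A1"
    proof -
      have "Im (((1 - l) *\<^sub>R (of_real \<rho> * cis A1) + l *\<^sub>R (of_real \<rho> * cis A2)) * cis (- A1)) = Im (of_real s * cis (- A1))" unfolding E ..
      then show ?thesis by (simp add: sin_diff algebra_simps)
    qed
    have E2: "(1 - l) * \<rho> * sin (A2 - A1) = s * sin A2"
    proof -
      have "Im (((1 - l) *\<^sub>R (of_real \<rho> * cis A1) + l *\<^sub>R (of_real \<rho> * cis A2)) * cis (- A2)) = Im (of_real s * cis (- A2))" unfolding E ..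
      then show ?thesis by (simp add: sin_diff algebra_simps)
    qed
    show False
    proof (cases "A1 = A2")
      case True
      then have "of_real \<rho> * cis A1 = of_real s" using E by (simp flip: scaleR_add_left)
      then have "w1 / e = of_real s" using pol by simp
      then have "Arg2pi (w1 / e) = 0" using s by (simp add: Arg2pi_eq_0)
      then show False using nz by simp
    next
      case False
      then have sp: "sin (A2 - A1) > 0" using A d by (intro sin_gt_zero) auto
      have "0 \<le> l * \<rho> * sin (A2 - A1)" "0 \<le> (1 - l) * \<rho> * sin (A2 - A1)" using l \<rho> sp by simp_all
      then have q: "s * sin A1 \<le> 0" "0 \<le> s * sin A2" using E1 E2 by simp_all
      have "s \<noteq> 0" using E1 E2 sp \<rho> by auto
      then have s0: "s > 0" using s by simp
      have "sin A1 \<le> 0" "0 \<le> sin A2" using q s0 by (simp_all add: mult_le_0_iff zero_le_mult_iff)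
      then have "pi \<le> A1" using sin_gt_zero[of A1] A(1) by (cases "pi \<le> A1") auto
      then have "sin A2 < 0" using A False by (intro sin_lt_zero) auto
      then show False using \<open>0 \<le> sin A2\<close> by simp
    qed
  qed
  show False
  proof (cases "Arg2pi (w1 / e) \<le> Arg2pi (w2 / e)")
    case True then show False using main[OF w nz(1) no a _ l eq] by simp
  next
    case False
    have "upper_angle e w2 w1 = upper_angle e w1 w2" by (simp add: upper_angle_def abs_minus_commute)
    moreover have "w2 \<noteq> - w1" using no by auto
    moreover have "(1 - (1 - l)) *\<^sub>R w2 + (1 - l) *\<^sub>R w1 = s *\<^sub>R e" using eq by (simp add: add.commute)
    ultimately show False using main[OF w(2,1) nz(2), of "1 - l"] False a l by simp
  qed
qed

text \<open>
  It identifies the direction in the angle condition with the initial direction of a geodesic.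
\<close>

lemma leaves_along_unique:
  assumes X: "leaves_along X p w" and v: "norm v = 1" and e: "0 < e"
    and loc: "\<And>s. s \<in> {0..e} \<Longrightarrow> fst p + s *\<^sub>R v \<in> fst ` X"
  shows "w = v"
proof -
  obtain r where r: "r > 0" "fst ` X \<inter> ball (fst p) r = {fst p + t *\<^sub>R w | t. 0 \<le> t \<and> t < r}" and w: "norm w = 1"
    using X unfolding leaves_along_def by blast
  define s where "s = min e (r/2)"
  have s: "0 < s" "s \<le> e" "s < r" using e r(1) by (auto simp: s_def)
  have "fst p + s *\<^sub>R v \<in> ball (fst p) r" using s v by (simp add: dist_norm)
  then have "fst p + s *\<^sub>R v \<in> fst ` X \<inter> ball (fst p) r" using loc[of s] s by simp
  then have "fst p + s *\<^sub>R v \<in> {fst p + t *\<^sub>R w | t. 0 \<le> t \<and> t < r}" unfolding r(2) .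
  then obtain t where t: "0 \<le> t" "s *\<^sub>R v = t *\<^sub>R w" by auto
  then have "norm (s *\<^sub>R v) = norm (t *\<^sub>R w)" by simp
  then have "s = t" using s(1) t(1) unfolding norm_scaleR v w by simp
  then show ?thesis using t s by simp
qed

context slit_domain begin

section \<open>The corner at a shooting point\<close>

text \<open>
  Only the case \<open>p = v\<close> with a corner that is not straight needs an argument. There the
  geodesics meet the cutting segment in no other point, so their directions differ from that of the
  segment, and the chord across the corner avoids the segment by \<open>sector_avoids_ray\<close>. If
  the chord lies in the domain, it connects the two geodesics off the segment.
\<close>

lemma taut_joint:
  assumes X: "cutting_segment ps R c u v X" and g: "geodesic \<sigma> L" and h: "geodesic \<tau> K" and p: "\<sigma> L = p" "\<tau> 0 = p"
    and LK: "0 < L" "0 < K" and ends: "\<sigma> 0 \<notin> X" "\<tau> K \<notin> X"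
    and B: "collinear_condition_B u v X (\<sigma> ` {0..L}) (\<tau> ` {0..K}) p"
    and sep: "\<not> path_component_of (subtopology T (D - X)) (\<sigma> 0) (\<tau> K)"
  obtains e w1 w2 where "0 < e" "e \<le> L" "e \<le> K" "norm w1 = 1" "norm w2 = 1" "w1 \<noteq> w2"
    "\<forall>s\<in>{0..e}. fst (\<tau> s) = fst p + s *\<^sub>R w2" "\<forall>s\<in>{0..e}. fst (\<sigma> (L - s)) = fst p + s *\<^sub>R w1"
    "w1 = - w2 \<or> (\<exists>l\<in>{0<..<1}. \<forall>\<tau>\<in>{0<..e}. fst p + \<tau> *\<^sub>R ((1 - l) *\<^sub>R w1 + l *\<^sub>R w2) \<in> inside P)"
proof -
  obtain k where k: "seg u v k" "X = k ` {0..1}" "fst u \<in> S \<union> frontier R" "fst v \<in> P" "fst u \<noteq> b"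
    "fst u \<noteq> fst v" "\<forall>t\<in>{0<..1}. fst (k t) \<notin> S \<union> frontier R" "\<forall>t\<in>{0..<1}. fst (k t) \<notin> P"
    by (rule cutting_segment_facts[OF X])
  have kk: "k 0 = u" "k 1 = v" and kl: "\<And>t. t \<in> {0..1} \<Longrightarrow> fst (k t) = fst u + t *\<^sub>R (fst v - fst u)"
    using k(1) unfolding seg_def by (auto simp: linepath_def algebra_simps)
  have h0: "(0::real) \<le> 0" "L \<le> L" by simp_all
  obtain ea w2 where ea: "ea > 0" "0 + ea \<le> K" "norm w2 = 1" "\<And>s. s \<in> {0..ea} \<Longrightarrow> fst (\<tau> (0 + s)) = fst (\<tau> 0) + s *\<^sub>R w2"
    by (rule geodesic_local_line[OF h h0(1) LK(2)], rule that, blast+)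
  obtain eb w1 where eb: "eb > 0" "eb \<le> L" "norm w1 = 1" "\<And>s. s \<in> {0..eb} \<Longrightarrow> fst (\<sigma> (L - s)) = fst (\<sigma> L) + s *\<^sub>R w1"
    by (rule geodesic_local_line_back[OF g LK(1) h0(2)], rule that, blast+)
  define e where "e = min ea eb"
  have e: "0 < e" "e \<le> L" "e \<le> K" using ea eb by (auto simp: e_def)
  have loc: "fst (\<tau> s) = fst p + s *\<^sub>R w2" "fst (\<sigma> (L - s)) = fst p + s *\<^sub>R w1" if "s \<in> {0..e}" for s
    using ea(4)[of s] eb(4)[of s] that p by (auto simp: e_def)
  have rng: "s \<in> {0..K}" "L - s \<in> {0..L}" if "s \<in> {0..e}" for s using that e by auto
  have pD: "p \<in> D" using geodesic_D[OF g, of L] p LK by simp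
  let ?E = "fst u - fst p"
  obtain \<theta> w1' w2' where \<theta>: "leaves_along (\<sigma> ` {0..L}) p w1'" "leaves_along (\<tau> ` {0..K}) p w2'"
    "\<theta> = upper_angle ?E w1' w2'" "(p \<in> X - {u, v} \<and> \<theta> = pi) \<or> (p = v \<and> pi \<le> \<theta>)"
    using B unfolding collinear_condition_B_def has_upper_angle_def by blast
  have w1': "w1' = w1"
  proof (rule leaves_along_unique[OF \<theta>(1) eb(3) e(1)])
    fix s assume s: "s \<in> {0..e}"
    then show "fst p + s *\<^sub>R w1 \<in> fst ` \<sigma> ` {0..L}" using loc(2)[OF s] rng(2)[OF s] by (metis imageI)
  qed
  have w2': "w2' = w2"
  proof (rule leaves_along_unique[OF \<theta>(2) ea(3) e(1)])
    fix s assume s: "s \<in> {0..e}"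
    then show "fst p + s *\<^sub>R w2 \<in> fst ` \<tau> ` {0..K}" using loc(1)[OF s] rng(1)[OF s] by (metis imageI)
  qed
  have ang: "\<theta> = upper_angle ?E w1 w2" using \<theta>(3) w1' w2' by simp
  have pu: "p \<noteq> u" using \<theta>(4) k(6) by auto
  have pX: "p \<in> X" using \<theta>(4) k(2) kk(2) by auto
  then obtain a where a: "a \<in> {0..1}" "p = k a" using k(2) by blast
  have "a \<noteq> 0" using a pu kk(1) by auto
  then have a0: "0 < a" using a by simp
  have E0: "?E \<noteq> 0" using a kl[OF a(1)] a0 k(6) by simp
  have "fst p \<notin> S" using k(7) a a0 by simp
  then have nb: "fst p \<noteq> b" using b_slit by auto
  show ?thesis
  proof (cases "w1 = - w2")
    case True
    have "w1 \<noteq> w2"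
    proof
      assume "w1 = w2"
      then have "w1 = - w1" using True by simp
      then have "2 * w1 = 0" by (simp only: mult_2 eq_neg_iff_add_eq_0)
      then have "w1 = 0" by simp
      then show False using eb(3) by simp
    qed
    then show ?thesis using that[of e w1 w2] e ea(3) eb(3) loc True by blast
  next
    case False
    then have "upper_angle ?E w1 w2 \<noteq> pi" using upper_angle_pi_opposite[of w1 w2 ?E] E0 ea(3) eb(3) by auto
    then have pv: "p = v" "pi \<le> upper_angle ?E w1 w2" using \<theta>(4) ang by auto
    have \<sigma>X: "\<sigma> t \<notin> X" if "0 \<le> t" "t < L" for t
      by (rule geodesic_meets_cut_only_at_polygon[OF X g _ ends(1) that]) (use p pv in simp)
    have \<tau>X: "\<tau> t \<notin> X" if "0 < t" "t \<le> K" for t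
      using geodesic_meets_cut_only_at_polygon[OF X geodesic_rev[OF h], of "K - t"] that ends(2) p pv by simp
    have cutpt: "q \<in> X" if "q \<in> D" "0 \<le> s" "s < 1" "fst q = fst p + s *\<^sub>R ?E" for q s
    proof -
      have "fst q = fst u + (1 - s) *\<^sub>R (fst v - fst u)" using that(4) pv by (simp add: algebra_simps)
      then have "q = k (1 - s)" using that by (intro point_on_cut[OF k(1,7)]) auto
      then show ?thesis using k(2) that by simp
    qed
    have ray: "Arg2pi (w / ?E) \<noteq> 0" if w: "norm w = 1" and off: "\<And>s. s \<in> {0<..e} \<Longrightarrow> \<exists>q\<in>D. q \<notin> X \<and> fst q = fst p + s *\<^sub>R w" for w
    proof
      assume "Arg2pi (w / ?E) = 0"
      then have "w / ?E = of_real (norm (w / ?E))" using Arg2pi_eq[of "w / ?E"] by simp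
      then have wE: "w = norm (w / ?E) *\<^sub>R ?E" using E0 by (simp add: scaleR_conv_of_real divide_eq_eq)
      define m where "m = norm (w / ?E)"
      have m: "m > 0" using w E0 by (simp add: m_def norm_divide)
      define s where "s = min e (1 / (2 * m))"
      have s: "s \<in> {0<..e}" using e m by (simp add: s_def)
      have "s \<le> 1 / (2 * m)" by (simp add: s_def)
      then have sm: "s * m < 1" "0 \<le> s * m" using m s by (simp_all add: field_simps)
      obtain q where q: "q \<in> D" "q \<notin> X" "fst q = fst p + s *\<^sub>R w" using off[OF s] by blast
      have "w = m *\<^sub>R ?E" using wE unfolding m_def .
      then have "fst q = fst p + (s * m) *\<^sub>R ?E" using q(3) by simp
      then show False using cutpt[OF q(1) sm(2,1)] q(2) by simp
    qed
    have nz1: "Arg2pi (w1 / ?E) \<noteq> 0"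
    proof (rule ray[OF eb(3)])
      fix s assume s: "s \<in> {0<..e}"
      have "\<sigma> (L - s) \<in> D" "\<sigma> (L - s) \<notin> X" using geodesic_D[OF g] \<sigma>X s e by auto
      then show "\<exists>q\<in>D. q \<notin> X \<and> fst q = fst p + s *\<^sub>R w1" using loc(2)[of s] s by (intro bexI[of _ "\<sigma> (L - s)"]) auto
    qed
    have nz2: "Arg2pi (w2 / ?E) \<noteq> 0"
    proof (rule ray[OF ea(3)])
      fix s assume s: "s \<in> {0<..e}"
      have "\<tau> s \<in> D" "\<tau> s \<notin> X" using geodesic_D[OF h] \<tau>X s e by auto
      then show "\<exists>q\<in>D. q \<notin> X \<and> fst q = fst p + s *\<^sub>R w2" using loc(1)[of s] s by (intro bexI[of _ "\<tau> s"]) auto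
    qed
    have nf: "ncont (\<sigma> \<circ> (\<lambda>s. L - s)) {0..e}" by (rule ncont_compose[OF geodesic_ncont[OF g]]; use rng in \<open>force intro!: continuous_intros\<close>)
    have nh: "ncont \<tau> {0..e}" by (rule ncont_subset[OF geodesic_ncont[OF h]]) (use rng in blast)
    show ?thesis
    proof (rule unobstructed_corner[OF pD nb e(1) nf nh _ p(2) _ _ eb(3) ea(3)])
      show "(\<sigma> \<circ> (\<lambda>s. L - s)) 0 = p" using p by simp
      show "(\<sigma> \<circ> (\<lambda>s. L - s)) s \<in> D" "\<tau> s \<in> D" if "s \<in> {0..e}" for s
        using geodesic_D[OF g] geodesic_D[OF h] rng[OF that] by auto
      show "fst ((\<sigma> \<circ> (\<lambda>s. L - s)) s) = fst p + s *\<^sub>R w1" "fst (\<tau> s) = fst p + s *\<^sub>R w2" if "s \<in> {0..e}" for s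
        using loc[OF that] by auto
    next
      fix e' l assume o: "0 < e'" "e' \<le> e" "0 < l" "l < 1" "fst p \<notin> S"
        "\<And>\<tau>. \<tau> \<in> {0<..e'} \<Longrightarrow> fst p + \<tau> *\<^sub>R ((1 - l) *\<^sub>R w1 + l *\<^sub>R w2) \<in> inside P"
      have "w1 \<noteq> w2"
      proof
        assume "w1 = w2"
        then have "fst (\<tau> e') \<in> inside P" using o(6)[of e'] o(1,2) loc(1)[of e'] by (simp flip: scaleR_add_left)
        then show False using geodesic_D[OF h, of e'] o e by (simp add: cut_domain_iff)
      qed
      moreover have "\<forall>s\<in>{0..e'}. fst (\<tau> s) = fst p + s *\<^sub>R w2" "\<forall>s\<in>{0..e'}. fst (\<sigma> (L - s)) = fst p + s *\<^sub>R w1" using loc o(2) by auto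
      moreover have "\<exists>l\<in>{0<..<1}. \<forall>\<tau>\<in>{0<..e'}. fst p + \<tau> *\<^sub>R ((1 - l) *\<^sub>R w1 + l *\<^sub>R w2) \<in> inside P"
        using o(3,4,6) by (intro bexI[of _ l] ballI) auto
      ultimately show ?thesis using that[of e' w1 w2] o(1,2) e ea(3) eb(3) by simp
    next
      fix e' assume vs: "0 < e'" "e' \<le> e" "\<And>s. s \<in> {0..e'} \<Longrightarrow> visible ((\<sigma> \<circ> (\<lambda>s. L - s)) s) (\<tau> s)"
      have "visible (\<sigma> (L - e')) (\<tau> e')" using vs(3)[of e'] vs(1) by simp
      then obtain j where j: "seg (\<sigma> (L - e')) (\<tau> e') j" unfolding visible_def by blast
      have jX: "j l \<in> D - X" if l: "l \<in> {0..1}" for l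
      proof -
        have jD: "j l \<in> D" "fst (j l) = linepath (fst (\<sigma> (L - e'))) (fst (\<tau> e')) l" using j l unfolding seg_def by blast+
        then have jl: "fst (j l) = fst p + e' *\<^sub>R ((1 - l) *\<^sub>R w1 + l *\<^sub>R w2)" using loc[of e'] vs by (simp add: linepath_def algebra_simps)
        have "j l \<notin> X"
        proof
          assume "j l \<in> X"
          then obtain t where t: "t \<in> {0..1}" "j l = k t" using k(2) by blast
          have "fst (j l) = fst p + (1 - t) *\<^sub>R ?E" using kl[OF t(1)] t(2) pv by (simp add: algebra_simps)
          then have "e' *\<^sub>R ((1 - l) *\<^sub>R w1 + l *\<^sub>R w2) = (1 - t) *\<^sub>R ?E" using jl by simp
          then have "(1 / e') *\<^sub>R (e' *\<^sub>R ((1 - l) *\<^sub>R w1 + l *\<^sub>R w2)) = (1 / e') *\<^sub>R ((1 - t) *\<^sub>R ?E)" by simp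
          then have "(1 - l) *\<^sub>R w1 + l *\<^sub>R w2 = ((1 - t) / e') *\<^sub>R ?E" using vs(1) by simp
          then have "w1 = - w2" using sector_avoids_ray[OF eb(3) ea(3) pv(2) E0 nz1 nz2, of l "(1 - t) / e'"] l t vs(1) by simp
          then show False using False by simp
        qed
        then show ?thesis using jD by simp
      qed
      have "pathin T j" using j unfolding seg_iff_joins joins_def by blast
      then have "pathin (subtopology T (D - X)) j" unfolding pathin_subtopology using jX by blast
      then have mid: "path_component_of (subtopology T (D - X)) (\<sigma> (L - e')) (\<tau> e')"
        unfolding path_component_of_def using j unfolding seg_def by blast
      have pre: "path_component_of (subtopology T (D - X)) (\<sigma> 0) (\<sigma> (L - e'))"
      proof (rule geodesic_path_component[OF g])
        fix t assume t: "t \<in> {0..L - e'}"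
        then show "\<sigma> t \<in> D - X" using geodesic_D[OF g, of t] \<sigma>X[of t] vs(1) by simp
      qed (use vs e in auto)
      have post: "path_component_of (subtopology T (D - X)) (\<tau> e') (\<tau> K)"
      proof (rule geodesic_path_component[OF h])
        fix t assume t: "t \<in> {e'..K}"
        then show "\<tau> t \<in> D - X" using geodesic_D[OF h, of t] \<tau>X[of t] vs(1) by simp
      qed (use vs e in auto)
      show ?thesis using sep path_component_of_trans[OF path_component_of_trans[OF pre mid] post] by simp
    qed
  qed
qed

section \<open>The path through the shooting points\<close>

lemma partition_neighbours_disjoint:
  assumes part: "cut_partition ps R c n u v \<xi> E" and i: "i \<le> n"
  shows "\<xi> i \<inter> \<xi> (i + 1) = {}"
proof -
  have n: "1 \<le> n" and p: "\<xi> 0 = {b_tilde ps}" "\<xi> (n + 1) = {b_pt ps}"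
    "\<forall>j\<in>{1..n}. cutting_segment ps R c (u j) (v j) (\<xi> j)"
    "\<forall>j\<in>{1..n}. \<forall>k\<in>{1..n}. j \<noteq> k \<longrightarrow> \<xi> j \<inter> \<xi> k = {}"
    using part unfolding cut_partition_def by - (elim conjE; assumption)+
  have nb: "b_tilde ps \<notin> \<xi> j \<and> b_pt ps \<notin> \<xi> j" if "j \<in> {1..n}" for j
    using p(3)[rule_format, OF that] unfolding cutting_segment_def strictly_separates_def by blast
  consider "i = 0" | "i = n" "i \<noteq> 0" | "i \<in> {1..n}" "i + 1 \<in> {1..n}" using i n by (cases "i = 0"; cases "i = n") auto
  then show ?thesis
  proof cases
    case 1 then show ?thesis using nb[of 1] n p(1) by simp
  next
    case 2 then show ?thesis using nb[of n] n p(2) by simp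
  next
    case 3 then show ?thesis using p(4) by simp
  qed
qed

text \<open>
  The geodesics between the shooting points are joined one by one. The induction records that the path
  constructed so far ends with the last geodesic, since \<open>taut_joint\<close> speaks of this
  geodesic.
\<close>

theorem shortest_path_iff_union:
  assumes part: "cut_partition ps R c n u v \<xi> E" and a: "\<forall>i\<le>n + 1. a i \<in> \<xi> i"
    and X: "\<forall>i\<le>n. is_SP ps R c (a i) (a (i + 1)) (X i)"
    and B: "\<forall>i\<in>{1..n}. collinear_condition_B (u i) (v i) (\<xi> i) (X (i - 1)) (X i) (a i)"
  shows "is_SP ps R c (b_tilde ps) (b_pt ps) Y \<longleftrightarrow> Y = (\<Union>i\<le>n. X i)"
proof -
  define l where "l i = d (a i) (a (i + 1))" for i
  have "\<forall>i. \<exists>\<sigma>. i \<le> n \<longrightarrow> geodesic \<sigma> (l i) \<and> \<sigma> 0 = a i \<and> \<sigma> (l i) = a (i + 1) \<and> X i = \<sigma> ` {0..l i}"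
  proof
    fix i
    show "\<exists>\<sigma>. i \<le> n \<longrightarrow> geodesic \<sigma> (l i) \<and> \<sigma> 0 = a i \<and> \<sigma> (l i) = a (i + 1) \<and> X i = \<sigma> ` {0..l i}"
    proof (cases "i \<le> n")
      case True
      then have sp: "is_SP ps R c (a i) (a (i + 1)) (X i)" using X by simp
      obtain \<sigma> where "geodesic \<sigma> (d (a i) (a (i + 1)))" "\<sigma> 0 = a i" "\<sigma> (d (a i) (a (i + 1))) = a (i + 1)" "X i = \<sigma> ` {0..d (a i) (a (i + 1))}"
        by (rule is_SP_geodesic[OF sp])
      then show ?thesis unfolding l_def by blast
    qed simp
  qed
  from choice[OF this] obtain \<sigma> where
    \<sigma>: "\<forall>i. i \<le> n \<longrightarrow> geodesic (\<sigma> i) (l i) \<and> \<sigma> i 0 = a i \<and> \<sigma> i (l i) = a (i + 1) \<and> X i = \<sigma> i ` {0..l i}" by blast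
  have disj: "a i \<notin> \<xi> (i + 1) \<and> a (i + 1) \<notin> \<xi> i" if "i \<le> n" for i
  proof -
    have "a i \<in> \<xi> i" "a (i + 1) \<in> \<xi> (i + 1)" using a that by auto
    then show ?thesis using partition_neighbours_disjoint[OF part that] by blast
  qed
  have lpos: "0 < l i" if i: "i \<le> n" for i
  proof (rule ccontr)
    assume "\<not> 0 < l i"
    moreover have "0 \<le> l i" using \<sigma> i unfolding geodesic_def by blast
    ultimately have "l i = 0" by simp
    then have "a i = a (i + 1)" using \<sigma> i by metis
    then show False using disj[OF i] a i by auto
  qed
  have joined: "\<exists>\<gamma> M. taut \<gamma> M \<and> \<gamma> 0 = a 0 \<and> \<gamma> M = a (k + 1) \<and> \<gamma> ` {0..M} = (\<Union>i\<le>k. X i) \<and> l k \<le> M \<and>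
      (\<forall>s\<in>{0..l k}. \<gamma> (M - s) = \<sigma> k (l k - s)) \<and> linked (a 0) (a (k + 1))" if "k \<le> n" for k
    using that
  proof (induction k)
    case 0
    have s0: "geodesic (\<sigma> 0) (l 0)" "\<sigma> 0 0 = a 0" "\<sigma> 0 (l 0) = a 1" "X 0 = \<sigma> 0 ` {0..l 0}" using \<sigma>[rule_format, of 0] by simp_all
    have "linked (a 0) (a 1)" using geodesic_linked[OF s0(1), of 0 "l 0"] lpos[of 0] s0 by simp
    then show ?case using geodesic_taut[OF s0(1) lpos] s0 by (intro exI[of _ "\<sigma> 0"] exI[of _ "l 0"]) simp
  next
    case (Suc k)
    let ?i = "Suc k"
    have k: "k \<le> n" "?i \<le> n" using Suc by auto
    obtain \<gamma> M where G: "taut \<gamma> M" "\<gamma> 0 = a 0" "\<gamma> M = a ?i" "\<gamma> ` {0..M} = (\<Union>i\<le>k. X i)" "l k \<le> M"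
      "\<forall>s\<in>{0..l k}. \<gamma> (M - s) = \<sigma> k (l k - s)" "linked (a 0) (a ?i)" using Suc.IH[OF k(1)] by auto
    have S: "geodesic (\<sigma> k) (l k)" "\<sigma> k 0 = a k" "\<sigma> k (l k) = a ?i" "X k = \<sigma> k ` {0..l k}" using \<sigma>[rule_format, OF k(1)] by simp_all
    have U: "geodesic (\<sigma> ?i) (l ?i)" "\<sigma> ?i 0 = a ?i" "\<sigma> ?i (l ?i) = a (?i + 1)" "X ?i = \<sigma> ?i ` {0..l ?i}" using \<sigma>[rule_format, OF k(2)] by simp_all
    have cs: "cutting_segment ps R c (u ?i) (v ?i) (\<xi> ?i)" using part k(2) unfolding cut_partition_def by simp
    have e0: "\<sigma> k 0 \<notin> \<xi> ?i" "\<sigma> ?i (l ?i) \<notin> \<xi> ?i" using disj[OF k(1)] disj[OF k(2)] S(2) U(3) by auto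
    have cB: "collinear_condition_B (u ?i) (v ?i) (\<xi> ?i) (\<sigma> k ` {0..l k}) (\<sigma> ?i ` {0..l ?i}) (a ?i)"
      using B[rule_format, of ?i] k(2) S(4) U(4) by simp
    have sep: "\<not> path_component_of (subtopology T (D - \<xi> ?i)) (\<sigma> k 0) (\<sigma> ?i (l ?i))"
      using partition_separates[OF part a _ k(2)] e0 S(2) U(3) by simp
    obtain e w1 w2 where J: "0 < e" "e \<le> l k" "e \<le> l ?i" "norm w1 = 1" "norm w2 = 1" "w1 \<noteq> w2"
      "\<forall>s\<in>{0..e}. fst (\<sigma> ?i s) = fst (a ?i) + s *\<^sub>R w2" "\<forall>s\<in>{0..e}. fst (\<sigma> k (l k - s)) = fst (a ?i) + s *\<^sub>R w1"
      "w1 = - w2 \<or> (\<exists>l\<in>{0<..<1}. \<forall>\<tau>\<in>{0<..e}. fst (a ?i) + \<tau> *\<^sub>R ((1 - l) *\<^sub>R w1 + l *\<^sub>R w2) \<in> inside P)"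
      by (rule taut_joint[OF cs S(1) U(1) S(3) U(2) lpos[OF k(1)] lpos[OF k(2)] e0 cB sep])
    define f where "f = (\<lambda>t. if t \<le> M then \<gamma> t else \<sigma> ?i (t - M))"
    have tf: "taut f (M + l ?i)" unfolding f_def
    proof (rule taut_join[OF G(1) geodesic_taut[OF U(1) lpos[OF k(2)]] _ J(1) _ J(3) J(4,5,6)])
      show "\<gamma> M = \<sigma> ?i 0" using G(3) U(2) by simp
      show "e \<le> M" using J(2) G(5) by simp
      show "fst (\<sigma> ?i s) = fst (\<gamma> M) + s *\<^sub>R w2" if "s \<in> {0..e}" for s using J(7) that unfolding G(3) by blast
      show "fst (\<gamma> (M - s)) = fst (\<gamma> M) + s *\<^sub>R w1" if s: "s \<in> {0..e}" for s
      proof -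
        have "\<gamma> (M - s) = \<sigma> k (l k - s)" using G(6) s J(2) by simp
        then show ?thesis using J(8) s unfolding G(3) by simp
      qed
      show "fst (\<gamma> M) \<noteq> b \<longrightarrow> w1 = - w2 \<or> (\<exists>l\<in>{0<..<1}. \<forall>\<tau>\<in>{0<..e}. fst (\<gamma> M) + \<tau> *\<^sub>R ((1 - l) *\<^sub>R w1 + l *\<^sub>R w2) \<in> inside P)"
        using J(9) unfolding G(3) by (rule impI)
    qed
    have M0: "0 < M" using G(1) unfolding taut_def by blast
    have fr: "f (M + s) = \<sigma> ?i s" if "0 \<le> s" for s using that G(3) U(2) by (cases "s = 0") (auto simp: f_def)
    have img: "f ` {0..M + l ?i} = (\<Union>i\<le>?i. X i)"
    proof -
      have "{0..M + l ?i} = {0..M} \<union> (\<lambda>s. M + s) ` {0..l ?i}" using M0 lpos[OF k(2)] by (simp add: ivl_disj_un_two_touch(4))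
      then have "f ` {0..M + l ?i} = f ` {0..M} \<union> (\<lambda>s. f (M + s)) ` {0..l ?i}" by (simp only: image_Un image_image)
      also have "f ` {0..M} = \<gamma> ` {0..M}" by (rule image_cong) (simp_all add: f_def)
      also have "(\<lambda>s. f (M + s)) ` {0..l ?i} = \<sigma> ?i ` {0..l ?i}" by (rule image_cong) (simp_all add: fr)
      finally show ?thesis using G(4) U(4) by (simp add: atMost_Suc Un_commute)
    qed
    have "linked (a ?i) (a (?i + 1))" using geodesic_linked[OF U(1), of 0 "l ?i"] lpos[OF k(2)] U by simp
    then have lk: "linked (a 0) (a (?i + 1))" by (rule linked_trans[OF G(7)])
    have "f 0 = a 0" using M0 G(2) by (simp add: f_def)
    moreover have "f (M + l ?i) = a (?i + 1)" using fr[of "l ?i"] lpos[OF k(2)] U(3) by simp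
    moreover have "\<forall>s\<in>{0..l ?i}. f (M + l ?i - s) = \<sigma> ?i (l ?i - s)"
    proof
      fix s assume "s \<in> {0..l ?i}"
      then show "f (M + l ?i - s) = \<sigma> ?i (l ?i - s)" using fr[of "l ?i - s"] by (simp add: add_diff_eq)
    qed
    ultimately show ?case using tf img lk M0 by (intro exI[of _ f] exI[of _ "M + l ?i"]) simp
  qed
  obtain \<gamma> M where \<gamma>: "taut \<gamma> M" "\<gamma> 0 = a 0" "\<gamma> M = a (n + 1)" "\<gamma> ` {0..M} = (\<Union>i\<le>n. X i)" "linked (a 0) (a (n + 1))"
    using joined[of n] by auto
  have "\<xi> 0 = {b_tilde ps}" "\<xi> (n + 1) = {b_pt ps}" using part unfolding cut_partition_def by - (elim conjE; assumption)+
  then have ab: "a 0 = b_tilde ps" "a (n + 1) = b_pt ps" using a[rule_format, of 0] a[rule_format, of "n + 1"] by simp_all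
  have lk: "linked (b_tilde ps) (b_pt ps)" using \<gamma>(5) ab by simp
  have "d (b_tilde ps) (b_pt ps) \<noteq> 0" using d_zero[OF lk] by (auto simp: b_tilde_def b_pt_def)
  then have dpos: "0 < d (b_tilde ps) (b_pt ps)" using d_nonneg[OF lk] by simp
  have same: "\<rho> ` {0..d (b_tilde ps) (b_pt ps)} = (\<Union>i\<le>n. X i)"
    if \<rho>: "geodesic \<rho> (d (b_tilde ps) (b_pt ps))" "\<rho> 0 = b_tilde ps" "\<rho> (d (b_tilde ps) (b_pt ps)) = b_pt ps" for \<rho>
  proof -
    have G: "\<gamma> 0 = b_tilde ps" "\<gamma> M = b_pt ps" using \<gamma> ab by simp_all
    have t: "taut \<rho> (d (b_tilde ps) (b_pt ps))" by (rule geodesic_taut[OF \<rho>(1) dpos])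
    have "\<rho> ` {0..d (b_tilde ps) (b_pt ps)} \<subseteq> \<gamma> ` {0..M}" by (rule taut_image_subset[OF t \<rho>(2,3) \<gamma>(1) G])
    moreover have "\<gamma> ` {0..M} \<subseteq> \<rho> ` {0..d (b_tilde ps) (b_pt ps)}" by (rule taut_image_subset[OF \<gamma>(1) G t \<rho>(2,3)])
    ultimately have "\<rho> ` {0..d (b_tilde ps) (b_pt ps)} = \<gamma> ` {0..M}" by (rule equalityI)
    then show ?thesis unfolding \<gamma>(4) .
  qed
  show ?thesis
  proof
    assume Y: "is_SP ps R c (b_tilde ps) (b_pt ps) Y"
    obtain \<rho> where \<rho>: "geodesic \<rho> (d (b_tilde ps) (b_pt ps))" "\<rho> 0 = b_tilde ps" "\<rho> (d (b_tilde ps) (b_pt ps)) = b_pt ps"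
      "Y = \<rho> ` {0..d (b_tilde ps) (b_pt ps)}" by (rule is_SP_geodesic[OF Y])
    show "Y = (\<Union>i\<le>n. X i)" unfolding \<rho>(4) by (rule same[OF \<rho>(1-3)])
  next
    assume Y: "Y = (\<Union>i\<le>n. X i)"
    obtain \<rho> where \<rho>: "geodesic \<rho> (d (b_tilde ps) (b_pt ps))" "\<rho> 0 = b_tilde ps" "\<rho> (d (b_tilde ps) (b_pt ps)) = b_pt ps"
      by (rule geodesic_exists[OF lk])
    show "is_SP ps R c (b_tilde ps) (b_pt ps) Y" unfolding Y same[OF \<rho>, symmetric] by (rule geodesic_is_SP[OF \<rho>])
  qed
qed

end

theorem proposition1:
  fixes ps :: "complex list" and R :: "complex set" and c :: complex and N :: nat
    and u v a :: "nat \<Rightarrow> dpoint" and \<xi> D X :: "nat \<Rightarrow> dpoint set"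
  assumes "slit_data ps R c"
    and "cut_partition ps R c N u v \<xi> D"
    and "\<forall>i\<le>N + 1. a i \<in> \<xi> i"
    and "\<forall>i\<le>N. is_SP ps R c (a i) (a (i + 1)) (X i)"
    and "\<forall>i\<in>{1..N}. collinear_condition_B (u i) (v i) (\<xi> i) (X (i - 1)) (X i) (a i)"
  shows "\<forall>Y. is_SP ps R c (b_tilde ps) (b_pt ps) Y \<longleftrightarrow> Y = (\<Union>i\<le>N. X i)"
proof -
  interpret slit_domain ps R c by (rule slit_domain.intro) fact
  show ?thesis by (rule allI) (rule shortest_path_iff_union[OF assms(2-5)])
qed

end
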